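(* Let $G$ be a countable group, let $n\ge 1$ be an integer, and let $T_1,\dots,T_n$ be uniformly locally finite trees. If $G$ acts cubically (that is, by cube complex automorphisms) and acylindrically on $X = T_1\times\cdots\times T_n$, then the orbit equivalence relation $E_G^{\partial_{\mathfrak{R}}X}$ of the induced action of $G$ on the Roller boundary $\partial_{\mathfrak{R}}X$ of $X$ is hyperfinite.
   Context: A tree is a connected graph without cycles. A graph is uniformly locally finite if there is $M \in \mathbb{N}$ such that every vertex has valency at most $M$. The product $X=T_1\times\cdots\times T_n$ is regarded as a CAT(0) cube complex with its product cube structure; $X^{(0)}$ is its vertex set. The automorphisms in the action of $G$ may permute the factors. An action of a group $G$ on a metric space $(X,d_X)$ is acylindrical if for any $\varepsilon>0$ there exist $R,M>0$ such that for any $x,y\in X$ with $d_X(x,y)\ge R$ we have $\#\{g\in G \mid d_X(x,gx)\le\varepsilon \text{ and } d_X(y,gy)\le\varepsilon\}\le M$. Here $X$ carries the $\ell^1$ product of the path metrics of the trees $T_i$ with edges of length 1 (on vertices this is the graph metric of the 1-skeleton). Roller boundary: each hyperplane of $X$ determines two complementary halfspaces (subsets of $X^{(0)}$). An ultrafilter is a choice of exactly one halfspace for each hyperplane such that any two chosen halfspaces intersect. The set of all ultrafilters (the Roller compactification) is a closed subset of the product $\prod_{h}\{h^+,h^-\}$ over all hyperplanes $h$, where $h^{\pm}$ are the two halfspaces of $h$, hence a compact metrizable space here. Each vertex $v$ gives the ultrafilter of all halfspaces containing $v$, and $\partial_{\mathfrak{R}}X$ is the set of ultrafilters not arising from vertices,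 a standard Borel space with the Borel structure inherited from the compactification. Cubical automorphisms of $X$ act on $\partial_{\mathfrak{R}}X$ in the natural way. For an action of $G$ on a set $Y$, $E_G^Y$ is the orbit equivalence relation: $x\,E_G^Y\,y \iff \exists g\in G,\ gx=y$. A Borel equivalence relation $E$ on a standard Borel space is hyperfinite if there are Borel equivalence relations $E_1\subset E_2\subset\cdots$, each with all classes finite, such that $E=\bigcup_{k\in\mathbb{N}}E_k$. *)

theory Defs
  imports "HOL-Analysis.Analysis" "HOL-Algebra.Group_Action"
begin

section \<open>Trees\<close>

record 'a ugraph =
  uverts :: "'a set"
  uedges :: "'a set set"

definition simple_ugraph :: "'a ugraph \<Rightarrow> bool" where
  "simple_ugraph T \<longleftrightarrow> (\<forall>e\<in>uedges T. e \<subseteq> uverts T \<and> card e = 2)"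

definition connected_ugraph :: "'a ugraph \<Rightarrow> bool" where
  "connected_ugraph T \<longleftrightarrow> uverts T \<noteq> {} \<and>
     (\<forall>u\<in>uverts T. \<forall>v\<in>uverts T. (u, v) \<in> {(x, y). {x, y} \<in> uedges T}\<^sup>*)"

text \<open>A cycle is given by the list of its (at least three, pairwise distinct) vertices.\<close>

definition is_cycle :: "'a ugraph \<Rightarrow> 'a list \<Rightarrow> bool" where
  "is_cycle T xs \<longleftrightarrow> length xs \<ge> 3 \<and> distinct xs \<and> set xs \<subseteq> uverts T \<and>
     successively (\<lambda>u v. {u, v} \<in> uedges T) xs \<and> {last xs, hd xs} \<in> uedges T"

definition is_tree :: "'a ugraph \<Rightarrow> bool" where
  "is_tree T \<longleftrightarrow> simple_ugraph T \<and> connected_ugraph T \<and> \<not> (\<exists>xs. is_cycle T xs)"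

definition uniformly_locally_finite :: "'a ugraph \<Rightarrow> bool" where
  "uniformly_locally_finite T \<longleftrightarrow>
     (\<exists>M::nat. \<forall>v\<in>uverts T. finite {e\<in>uedges T. v \<in> e} \<and> card {e\<in>uedges T. v \<in> e} \<le> M)"

section \<open>The metric tree\<close>

text \<open>
  Points of the geometric realization of \<open>T\<close> are given by barycentric coordinates: the closed cell
  spanned by \<open>c\<close> (a single vertex or the two ends of an edge) consists of the nonnegative functions
  of total mass 1 that vanish outside \<open>c\<close>.
\<close>

definition tree_cells :: "'a ugraph \<Rightarrow> 'a set set" where
  "tree_cells T = {{v} | v. v \<in> uverts T} \<union> uedges T"

definition cell_points :: "'a set \<Rightarrow> ('a \<Rightarrow> real) set" where
  "cell_points c = {p. (\<forall>w. 0 \<le> p w) \<and> (\<forall>w. w \<notin> c \<longrightarrow> p w = 0) \<and> (\<Sum>w\<in>c. p w) = 1}"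

text \<open>
  The distance inside one closed cell: for two points on the edge with ends \<open>u\<close>, \<open>v\<close> this is
  \<open>\<bar>p u - q u\<bar> = \<bar>p v - q v\<bar>\<close>, so that every edge has length 1.
\<close>

definition cell_dist :: "('a \<Rightarrow> real) \<Rightarrow> ('a \<Rightarrow> real) \<Rightarrow> real" where
  "cell_dist p q = (\<Sum>w | p w \<noteq> 0 \<or> q w \<noteq> 0. \<bar>p w - q w\<bar>) / 2"

text \<open>
  The path metric is the infimum of the lengths of piecewise linear paths, i.e. of finite chains
  of points in which any two consecutive points lie in a common closed cell.
\<close>

definition tree_chain :: "'a ugraph \<Rightarrow> ('a \<Rightarrow> real) \<Rightarrow> ('a \<Rightarrow> real) \<Rightarrow> ('a \<Rightarrow> real) list \<Rightarrow> bool" where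
  "tree_chain T p q ps \<longleftrightarrow> ps \<noteq> [] \<and> hd ps = p \<and> last ps = q \<and>
     successively (\<lambda>r s. \<exists>c\<in>tree_cells T. r \<in> cell_points c \<and> s \<in> cell_points c) ps"

definition chain_length :: "('a \<Rightarrow> real) list \<Rightarrow> real" where
  "chain_length ps = (\<Sum>i<length ps - 1. cell_dist (ps ! i) (ps ! Suc i))"

definition tree_dist :: "'a ugraph \<Rightarrow> ('a \<Rightarrow> real) \<Rightarrow> ('a \<Rightarrow> real) \<Rightarrow> real" where
  "tree_dist T p q = Inf {chain_length ps | ps. tree_chain T p q ps}"

section \<open>The product cube complex\<close>

text \<open>
  The product of \<open>T 0, \<dots>, T (n - 1)\<close>; a point has the coordinates \<open>x i\<close> for \<open>i < n\<close>. A cube is a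
  product of closed cells of the factors, and its dimension is the number of edges among these.
\<close>

type_synonym 'a prod_point = "nat \<Rightarrow> 'a \<Rightarrow> real"

definition cubes_of_dim :: "nat \<Rightarrow> (nat \<Rightarrow> 'a ugraph) \<Rightarrow> nat \<Rightarrow> 'a prod_point set set" where
  "cubes_of_dim n T k =
     {(\<Pi>\<^sub>E i\<in>{..<n}. cell_points (\<sigma> i)) | \<sigma>.
        (\<forall>i<n. \<sigma> i \<in> tree_cells (T i)) \<and> card {i. i < n \<and> \<sigma> i \<in> uedges (T i)} = k}"

definition cubes :: "nat \<Rightarrow> (nat \<Rightarrow> 'a ugraph) \<Rightarrow> 'a prod_point set set" where
  "cubes n T = (\<Union>k. cubes_of_dim n T k)"

definition tree_product :: "nat \<Rightarrow> (nat \<Rightarrow> 'a ugraph) \<Rightarrow> 'a prod_point set" where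
  "tree_product n T = \<Union> (cubes n T)"

definition product_dist :: "nat \<Rightarrow> (nat \<Rightarrow> 'a ugraph) \<Rightarrow> 'a prod_point \<Rightarrow> 'a prod_point \<Rightarrow> real" where
  "product_dist n T x y = (\<Sum>i<n. tree_dist (T i) (x i) (y i))"

definition vertices :: "nat \<Rightarrow> (nat \<Rightarrow> 'a ugraph) \<Rightarrow> 'a prod_point set" where
  "vertices n T = \<Union> (cubes_of_dim n T 0)"

text \<open>Edges and squares are represented by their sets of vertices.\<close>

definition edges :: "nat \<Rightarrow> (nat \<Rightarrow> 'a ugraph) \<Rightarrow> 'a prod_point set set" where
  "edges n T = {C \<inter> vertices n T | C. C \<in> cubes_of_dim n T 1}"

definition squares :: "nat \<Rightarrow> (nat \<Rightarrow> 'a ugraph) \<Rightarrow> 'a prod_point set set" where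
  "squares n T = {C \<inter> vertices n T | C. C \<in> cubes_of_dim n T 2}"

text \<open>
  Cube complex automorphisms map every cube onto a cube by an affine map. An affine bijection
  between unit cubes is a combinatorial isomorphism (in particular an isometry), and it may permute
  the coordinates.
\<close>

definition affine_on_cube :: "nat \<Rightarrow> 'a prod_point set \<Rightarrow> ('a prod_point \<Rightarrow> 'a prod_point) \<Rightarrow> bool" where
  "affine_on_cube n C \<alpha> \<longleftrightarrow>
     (\<forall>x\<in>C. \<forall>y\<in>C. \<forall>z\<in>C. \<forall>t\<in>{0..1}.
        (\<forall>i<n. \<forall>w. z i w = (1 - t) * x i w + t * y i w) \<longrightarrow>
        (\<forall>i<n. \<forall>w. \<alpha> z i w = (1 - t) * \<alpha> x i w + t * \<alpha> y i w))"

definition cube_automorphism ::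
  "nat \<Rightarrow> (nat \<Rightarrow> 'a ugraph) \<Rightarrow> ('a prod_point \<Rightarrow> 'a prod_point) \<Rightarrow> bool" where
  "cube_automorphism n T \<alpha> \<longleftrightarrow> bij_betw \<alpha> (tree_product n T) (tree_product n T) \<and>
     (\<forall>C\<in>cubes n T. \<alpha> ` C \<in> cubes n T \<and> affine_on_cube n C \<alpha>)"

section \<open>Hyperplanes and the Roller boundary\<close>

text \<open>
  A hyperplane is represented by the set of edges it crosses, i.e. by a class of the equivalence
  relation on edges generated by being opposite in a square. Its halfspaces are the vertex sets of
  the components left after removing these edges from the 1-skeleton.
\<close>

definition opposite_edges ::
  "nat \<Rightarrow> (nat \<Rightarrow> 'a ugraph) \<Rightarrow> ('a prod_point set \<times> 'a prod_point set) set" where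
  "opposite_edges n T =
     {(e, f). e \<in> edges n T \<and> f \<in> edges n T \<and> e \<inter> f = {} \<and> e \<union> f \<in> squares n T}"

definition hyperplanes :: "nat \<Rightarrow> (nat \<Rightarrow> 'a ugraph) \<Rightarrow> 'a prod_point set set set" where
  "hyperplanes n T = edges n T // (opposite_edges n T)\<^sup>*"

definition halfspaces ::
  "nat \<Rightarrow> (nat \<Rightarrow> 'a ugraph) \<Rightarrow> 'a prod_point set set \<Rightarrow> 'a prod_point set set" where
  "halfspaces n T h = vertices n T // {(x, y). {x, y} \<in> edges n T - h}\<^sup>*"

type_synonym 'a halfspace_choice = "'a prod_point set set \<Rightarrow> 'a prod_point set"

definition ultrafilters :: "nat \<Rightarrow> (nat \<Rightarrow> 'a ugraph) \<Rightarrow> 'a halfspace_choice set" where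
  "ultrafilters n T = {u \<in> (\<Pi>\<^sub>E h\<in>hyperplanes n T. halfspaces n T h).
     \<forall>h\<in>hyperplanes n T. \<forall>k\<in>hyperplanes n T. u h \<inter> u k \<noteq> {}}"

definition roller_topology :: "nat \<Rightarrow> (nat \<Rightarrow> 'a ugraph) \<Rightarrow> 'a halfspace_choice topology" where
  "roller_topology n T =
     subtopology (product_topology (\<lambda>h. discrete_topology (halfspaces n T h)) (hyperplanes n T))
       (ultrafilters n T)"

definition roller_boundary :: "nat \<Rightarrow> (nat \<Rightarrow> 'a ugraph) \<Rightarrow> 'a halfspace_choice set" where
  "roller_boundary n T = {u \<in> ultrafilters n T.
     \<not> (\<exists>v\<in>vertices n T. \<forall>h\<in>hyperplanes n T. v \<in> u h)}"

definition borel_of_topology :: "'b topology \<Rightarrow> 'b measure" where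
  "borel_of_topology S = sigma (topspace S) {U. openin S U}"

definition roller_boundary_borel :: "nat \<Rightarrow> (nat \<Rightarrow> 'a ugraph) \<Rightarrow> 'a halfspace_choice measure" where
  "roller_boundary_borel n T =
     restrict_space (borel_of_topology (roller_topology n T)) (roller_boundary n T)"

text \<open>
  The action of an automorphism on ultrafilters sends the set of chosen halfspaces to the set of
  their images; as a function of hyperplanes, it assigns to \<open>h\<close> the image of the halfspace chosen
  for the preimage of \<open>h\<close>.
\<close>

definition roller_map ::
  "nat \<Rightarrow> (nat \<Rightarrow> 'a ugraph) \<Rightarrow> ('a prod_point \<Rightarrow> 'a prod_point) \<Rightarrow>
     'a halfspace_choice \<Rightarrow> 'a halfspace_choice" where
  "roller_map n T \<alpha> u =
     (\<lambda>h\<in>hyperplanes n T. \<alpha> ` u ((\<lambda>e. inv_into (tree_product n T) \<alpha> ` e) ` h))"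

section \<open>Acylindrical actions and hyperfiniteness\<close>

definition acylindrical ::
  "('g, 'm) monoid_scheme \<Rightarrow> 'x set \<Rightarrow> ('x \<Rightarrow> 'x \<Rightarrow> real) \<Rightarrow> ('g \<Rightarrow> 'x \<Rightarrow> 'x) \<Rightarrow> bool" where
  "acylindrical G X d \<phi> \<longleftrightarrow>
     (\<forall>\<epsilon>>0. \<exists>R>0. \<exists>M>0::real. \<forall>x\<in>X. \<forall>y\<in>X. d x y \<ge> R \<longrightarrow>
        finite {g \<in> carrier G. d x (\<phi> g x) \<le> \<epsilon> \<and> d y (\<phi> g y) \<le> \<epsilon>} \<and>
        real (card {g \<in> carrier G. d x (\<phi> g x) \<le> \<epsilon> \<and> d y (\<phi> g y) \<le> \<epsilon>}) \<le> M)"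

definition orbit_relation ::
  "('g, 'm) monoid_scheme \<Rightarrow> 'y set \<Rightarrow> ('g \<Rightarrow> 'y \<Rightarrow> 'y) \<Rightarrow> ('y \<times> 'y) set" where
  "orbit_relation G Y \<psi> = {(x, y). x \<in> Y \<and> y \<in> Y \<and> (\<exists>g\<in>carrier G. \<psi> g x = y)}"

definition borel_equivalence :: "'y measure \<Rightarrow> ('y \<times> 'y) set \<Rightarrow> bool" where
  "borel_equivalence M E \<longleftrightarrow> equiv (space M) E \<and> E \<in> sets (M \<Otimes>\<^sub>M M)"

definition hyperfinite :: "'y measure \<Rightarrow> ('y \<times> 'y) set \<Rightarrow> bool" where
  "hyperfinite M E \<longleftrightarrow> borel_equivalence M E \<and>
     (\<exists>F :: nat \<Rightarrow> ('y \<times> 'y) set.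
        (\<forall>k. borel_equivalence M (F k) \<and> (\<forall>x\<in>space M. finite (F k `` {x})) \<and> F k \<subseteq> F (Suc k)) \<and>
        E = (\<Union>k. F k))"

end

theory Submission
  imports Defs
begin

text \<open>
  An ultrafilter \<open>u\<close> on \<open>T 0 \<times> \<dots> \<times> T (n - 1)\<close> orients every edge of every factor, and each
  vertex of \<open>T i\<close> has at most one outgoing edge. Following these edges gives \<open>n\<close> commuting flows on
  the vertices of the product along which any two vertices eventually merge, so that the forward
  cone of a vertex is a quotient of \<open>\<nat>\<^sup>n\<close>. If the Roller boundary is nonempty, then the product is
  infinite and, since it is uniformly locally finite, acylindricity makes the transporter of any
  two vertices finite.

  The elements of \<open>G\<close> that preserve the direction of every edge form a subgroup of finite index.
  For this subgroup, Weiss's argument for \<open>\<int>\<^sup>n\<close> applies: at each scale \<open>r\<close> a finite Borel colouring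
  of the pairs of an ultrafilter and a vertex yields an equivariant Borel set of markers that is
  \<open>r\<close>-separated (up to the stabilizer of the ultrafilter) and \<open>2 * r\<close>-dense in every forward cone.
  Moving a base vertex forward to markers of larger and larger scales, and relating two
  ultrafilters if a group element matches them together with their current markers, gives an
  increasing sequence of finite Borel equivalence relations. A box of side \<open>r\<close> in a cone sees at
  most \<open>3 ^ n\<close> inequivalent markers, hence every orbit contains only finitely many classes of the
  union. The passage to a finite index extension then gives the theorem.
\<close>

section \<open>Commuting maps\<close>

text \<open>The flows have no inverses: they give an action of the semigroup \<nat>^n, not of
  \<int>^n, and vertices with a common future may have different pasts. Every selection therefore
  looks only ahead, where merging vertices agree. The second obstacle is the stabilizer of an
  ultrafilter. If it moves a vertex to a nearby one, no equivariant colouring tells the two apart.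
  Separation modulo stabilizers is the best possible, and it is enough, because the finite relations
  ask only for some group element that matches the markers. Finite transporters replace freeness of
  the action: they isolate a vertex from its inequivalent neighbours by Borel sets and keep the
  classes of each stage finite. Acylindricity controls only elements that nearly fix two distant
  points, so a distant partner of each vertex is required. A boundary point provides it, since on
  finite trees all flows would have fixed vertices, and these would induce the ultrafilter. The
  subgroup of finite index appears because the flows are numbered by the factors: an element that
  permutes the factors permutes the flows as well.\<close>

primrec multi_iter :: "nat \<Rightarrow> (nat \<Rightarrow> 'v \<Rightarrow> 'v) \<Rightarrow> (nat \<Rightarrow> nat) \<Rightarrow> 'v \<Rightarrow> 'v" where
  "multi_iter 0 s a v = v"
| "multi_iter (Suc k) s a v = (s k ^^ a k) (multi_iter k s a v)"

text \<open>Values are fixed outside \<open>{..<n}\<close> to make the set finite;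
  \<open>multi_iter_restrict\<close> recovers arbitrary vectors.\<close>

definition vecs :: "nat \<Rightarrow> nat \<Rightarrow> (nat \<Rightarrow> nat) set" where
  "vecs n m = (\<Pi>\<^sub>E i\<in>{..<n}. {..m})"

lemma finite_vecs [simp]: "finite (vecs n m)"
  by (auto simp: vecs_def intro: finite_PiE)

lemma multi_iter_cong: "(\<And>i. i < n \<Longrightarrow> a i = b i) \<Longrightarrow> multi_iter n s a v = multi_iter n s b v"
  by (induction n) auto

lemma multi_iter_restrict [simp]: "multi_iter n s (restrict a {..<n}) v = multi_iter n s a v"
  by (rule multi_iter_cong) auto

locale commuting_maps =
  fixes V :: "'v set" and n :: nat and s :: "nat \<Rightarrow> 'v \<Rightarrow> 'v"
  assumes maps_closed: "\<And>i v. i < n \<Longrightarrow> v \<in> V \<Longrightarrow> s i v \<in> V"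
    and maps_commute: "\<And>i j v. i < n \<Longrightarrow> j < n \<Longrightarrow> v \<in> V \<Longrightarrow> s i (s j v) = s j (s i v)"
begin

abbreviation mv :: "(nat \<Rightarrow> nat) \<Rightarrow> 'v \<Rightarrow> 'v" where "mv \<equiv> multi_iter n s"

lemma funpow_closed: "i < n \<Longrightarrow> v \<in> V \<Longrightarrow> (s i ^^ k) v \<in> V"
  by (induction k) (auto intro: maps_closed)

lemma funpow_commute:
  assumes "i < n" "j < n" "v \<in> V"
  shows "(s i ^^ k) ((s j ^^ l) v) = (s j ^^ l) ((s i ^^ k) v)"
proof -
  have 1: "s i ((s j ^^ l) w) = (s j ^^ l) (s i w)" if "w \<in> V" for w
    using that by (induction l) (auto simp: maps_commute[OF assms(1,2)] funpow_closed assms)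
  show ?thesis
    by (induction k) (auto simp: 1 funpow_closed assms)
qed

lemma multi_iter_closed: "k \<le> n \<Longrightarrow> v \<in> V \<Longrightarrow> multi_iter k s a v \<in> V"
  by (induction k) (auto intro: funpow_closed)

lemma mv_closed [simp]: "v \<in> V \<Longrightarrow> mv a v \<in> V"
  by (simp add: multi_iter_closed)

lemma funpow_multi_iter:
  assumes "j < n" "v \<in> V" "k \<le> n"
  shows "(s j ^^ l) (multi_iter k s a v) = multi_iter k s a ((s j ^^ l) v)"
  using assms(3)
  by (induction k) (auto simp: funpow_commute[OF assms(1)] multi_iter_closed assms)

lemma multi_iter_add:
  assumes "v \<in> V" "k \<le> n"
  shows "multi_iter k s (\<lambda>i. a i + b i) v = multi_iter k s a (multi_iter k s b v)"
  using assms(2)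
proof (induction k)
  case (Suc k)
  then have "multi_iter (Suc k) s (\<lambda>i. a i + b i) v
      = (s k ^^ a k) ((s k ^^ b k) (multi_iter k s a (multi_iter k s b v)))"
    by (simp add: funpow_add)
  also have "(s k ^^ b k) (multi_iter k s a (multi_iter k s b v))
      = multi_iter k s a ((s k ^^ b k) (multi_iter k s b v))"
    using Suc assms by (intro funpow_multi_iter) (auto simp: multi_iter_closed)
  finally show ?case by simp
qed simp

lemma mv_add: "v \<in> V \<Longrightarrow> mv a (mv b v) = mv (\<lambda>i. a i + b i) v"
  by (simp add: multi_iter_add)

text \<open>By induction: once \<open>W\<close> is gathered at \<open>z\<close>, merge
  \<open>x\<close> with \<open>z\<close> and push all of \<open>W\<close> further by the vector
  \<open>c\<close> that \<open>z\<close> needs.\<close>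

lemma merge_finite:
  assumes merge: "\<And>v w. v \<in> V \<Longrightarrow> w \<in> V \<Longrightarrow> \<exists>a b. mv a v = mv b w"
    and "finite W" "W \<noteq> {}" "W \<subseteq> V"
  shows "\<exists>z\<in>V. \<exists>a. \<forall>w\<in>W. mv (a w) w = z"
  using assms(2-)
proof (induction W rule: finite_ne_induct)
  case (singleton x)
  then show ?case by (intro bexI[of _ "mv (\<lambda>_. 0) x"] exI[of _ "\<lambda>_ _. 0"]) auto
next
  case (insert x W)
  then obtain z a where z: "z \<in> V" "\<And>w. w \<in> W \<Longrightarrow> mv (a w) w = z"
    by auto
  from merge[of x z] z insert obtain b c where bc: "mv b x = mv c z" by auto
  have "mv ((\<lambda>w i. if w = x then b i else c i + a w i) w) w = mv c z" if "w \<in> insert x W" for w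
  proof (cases "w = x")
    case False
    with that have "w \<in> W" by simp
    then show ?thesis using False z insert.prems by (auto simp flip: mv_add)
  qed (use bc in auto)
  then show ?case using z by (intro bexI[of _ "mv c z"] exI) auto
qed

end

section \<open>Markers in the forward cones of commuting maps\<close>

text \<open>
  A vertex \<open>v\<close> in stage \<open>j\<close> stands for the selected point obtained by moving \<open>v\<close> forward by \<open>j * r\<close>
  in all directions. With this shift the greedy selection of an \<open>r\<close>-separated set, colour by
  colour, looks only at the forward cone of \<open>v\<close>, on which all vertices that merge with \<open>v\<close> agree.
\<close>

primrec marks :: "nat \<Rightarrow> (nat \<Rightarrow> 'v \<Rightarrow> 'v) \<Rightarrow> ('v \<Rightarrow> nat) \<Rightarrow> nat \<Rightarrow> nat \<Rightarrow> 'v set" where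
  "marks n s \<kappa> r 0 = {}"
| "marks n s \<kappa> r (Suc j) =
     {v. multi_iter n s (\<lambda>_. r) v \<in> marks n s \<kappa> r j} \<union>
     {v. \<kappa> (multi_iter n s (\<lambda>_. Suc j * r) v) = j \<and>
         (\<forall>a\<in>vecs n (2 * r). multi_iter n s a v \<notin> marks n s \<kappa> r j)}"

context commuting_maps
begin

text \<open>A new mark cannot be close to an old one because of the window in \<open>marks\<close>,
  and two new marks have equal colour, so that the colouring decides. The relation \<open>Q\<close>
  is kept abstract, since a colouring will separate vertices only up to a stabilizer. Closeness is
  expressed by displacement vectors from a common \<open>z\<close>, as the flows cannot be inverted
  to compare two vertices directly.\<close>

lemma marks_separated:
  assumes equiv: "\<And>v w a b. v \<in> V \<Longrightarrow> (\<And>i. i < n \<Longrightarrow> a i \<le> b i + r \<and> b i \<le> a i + r) \<Longrightarrow>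
            \<kappa> (mv a v) = \<kappa> (mv b v) \<Longrightarrow> Q (mv a v) (mv b v)"
    and "z \<in> V"
    and "mv a z \<in> marks n s \<kappa> r j" "mv b z \<in> marks n s \<kappa> r j"
    and "\<And>i. i < n \<Longrightarrow> a i \<le> b i + r \<and> b i \<le> a i + r"
  shows "Q (mv (\<lambda>i. j * r + a i) z) (mv (\<lambda>i. j * r + b i) z)"
  using assms(3-)
proof (induction j arbitrary: a b)
  case (Suc j)
  define old where "old c \<longleftrightarrow> mv (\<lambda>i. r + c i) z \<in> marks n s \<kappa> r j" for c
  define new where "new c \<longleftrightarrow> \<kappa> (mv (\<lambda>i. Suc j * r + c i) z) = j \<and>
     (\<forall>a\<in>vecs n (2 * r). mv (\<lambda>i. a i + c i) z \<notin> marks n s \<kappa> r j)" for c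
  have cases: "old c \<or> new c" if "mv c z \<in> marks n s \<kappa> r (Suc j)" for c
    using that \<open>z \<in> V\<close> by (auto simp: old_def new_def mv_add)
  have clash: False if "new c" "old d" "\<And>i. i < n \<Longrightarrow> c i \<le> d i + r \<and> d i \<le> c i + r" for c d
  proof -
    \<comment> \<open>One stage earlier the old mark sits at displacement \<open>r + d\<close> from
      \<open>z\<close>, while the new vertex sits at \<open>c\<close>. As \<open>c\<close> and
      \<open>d\<close> differ by at most \<open>r\<close>, the difference lies between 0 and
      \<open>2 * r\<close>: this is the origin of both the shift \<open>r\<close> and the window
      \<open>2 * r\<close>.\<close>
    have "restrict (\<lambda>i. r + d i - c i) {..<n} \<in> vecs n (2 * r)"
      using that(3) by (force simp: vecs_def)
    with \<open>new c\<close> have "mv (\<lambda>i. restrict (\<lambda>i. r + d i - c i) {..<n} i + c i) z \<notin> marks n s \<kappa> r j"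
      unfolding new_def by blast
    also have "mv (\<lambda>i. restrict (\<lambda>i. r + d i - c i) {..<n} i + c i) z = mv (\<lambda>i. r + d i) z"
      using that(3) by (intro multi_iter_cong) (auto simp: add.commute)
    finally show False using \<open>old d\<close> by (simp add: old_def)
  qed
  consider "old a" "old b" | "new a" "new b" | "new a" "old b" | "old a" "new b"
    using cases Suc.prems by blast
  then show ?case
  proof cases
    case 1
    then have "Q (mv (\<lambda>i. j * r + (r + a i)) z) (mv (\<lambda>i. j * r + (r + b i)) z)"
      unfolding old_def using Suc.prems(3) by (intro Suc.IH) auto
    then show ?thesis by (simp add: algebra_simps)
  next
    case 2
    then show ?thesis unfolding new_def using Suc.prems(3) \<open>z \<in> V\<close>
      by (intro equiv) auto
  next
    case 3 then show ?thesis using clash[of a b] Suc.prems(3) by auto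
  next
    case 4 then show ?thesis using clash[of b a] Suc.prems(3) by auto
  qed
qed simp

text \<open>Each later stage keeps a mark but names it by a vertex \<open>r\<close> further back, so
  that \<open>t\<close> stages cost the displacement \<open>t * r\<close>.\<close>

lemma marks_mono:
  assumes "v \<in> V" "mv (\<lambda>_. t * r) v \<in> marks n s \<kappa> r j"
  shows "v \<in> marks n s \<kappa> r (j + t)"
  using assms
proof (induction t arbitrary: v)
  case 0
  have "mv (\<lambda>_. 0) v = v"
    by (induction n) auto
  with 0 show ?case by simp
next
  case (Suc t)
  have "mv (\<lambda>_. t * r) (mv (\<lambda>_. r) v) \<in> marks n s \<kappa> r j"
    using Suc.prems by (simp add: mv_add add.commute)
  then have "mv (\<lambda>_. r) v \<in> marks n s \<kappa> r (j + t)"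
    using Suc by simp
  then show ?case by simp
qed

text \<open>Colour \<open>j\<close> gives a vertex its chance at stage \<open>Suc j\<close>: either
  it is selected or an older mark in its window blocks it. In both cases the mark found is carried
  on to stage \<open>K\<close>.\<close>

lemma marks_dense:
  assumes "v \<in> V" "\<And>v. v \<in> V \<Longrightarrow> \<kappa> v < K"
  shows "\<exists>a\<in>vecs n (2 * r). mv a v \<in> marks n s \<kappa> r K"
proof -
  \<comment> \<open>Starting \<open>r\<close> ahead of \<open>v\<close> pays for a blocking mark
    being one stage older than \<open>v'\<close>: carried to stage \<open>K\<close> it is pulled
    back by \<open>r\<close> more and still lies in the cone of \<open>v\<close>, at displacement
    \<open>a\<close>.\<close>
  define y where "y = mv (\<lambda>_. r) v"
  have y: "y \<in> V" using assms by (simp add: y_def)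
  define j where "j = \<kappa> (mv (\<lambda>_. K * r) y)"
  have "j < K" using y assms by (simp add: j_def)
  then obtain t where t: "K = Suc j + t" using less_iff_Suc_add by auto
  define v' where "v' = mv (\<lambda>_. t * r) y"
  have v': "v' \<in> V" using y by (simp add: v'_def)
  have "mv (\<lambda>_. Suc j * r) v' = mv (\<lambda>_. K * r) y"
    using y by (simp add: v'_def t mv_add algebra_simps)
  then have colour: "\<kappa> (mv (\<lambda>_. Suc j * r) v') = j"
    by (simp add: j_def)
  show ?thesis
  proof (cases "\<forall>a\<in>vecs n (2 * r). mv a v' \<notin> marks n s \<kappa> r j")
    case True
    with colour have "v' \<in> marks n s \<kappa> r (Suc j)" by simp
    then have "y \<in> marks n s \<kappa> r K"
      unfolding v'_def t by (intro marks_mono y)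
    then have "mv (restrict (\<lambda>_. r) {..<n}) v \<in> marks n s \<kappa> r K"
      unfolding y_def by simp
    then show ?thesis
      by (intro bexI[of _ "restrict (\<lambda>_. r) {..<n}"]) (auto simp: vecs_def)
  next
    case False
    then obtain a where a: "a \<in> vecs n (2 * r)" "mv a v' \<in> marks n s \<kappa> r j" by auto
    have "mv (\<lambda>_. Suc t * r) (mv a v) = mv a v'"
      using assms unfolding v'_def y_def by (simp add: mv_add algebra_simps)
    with a have "mv a v \<in> marks n s \<kappa> r (j + Suc t)"
      using assms by (intro marks_mono) auto
    with a t show ?thesis by auto
  qed
qed

end

section \<open>Greedy colourings\<close>

function greedy_colour :: "('v \<Rightarrow> nat) \<Rightarrow> ('v \<Rightarrow> 'v set) \<Rightarrow> 'v \<Rightarrow> nat" where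
  "greedy_colour l N v = (LEAST c. \<not> (\<exists>w\<in>{w \<in> N v. l w < l v}. greedy_colour l N w = c))"
  by pat_completeness auto
termination by (relation "Wellfounded.measure (\<lambda>(l, N, v). l v)") auto

declare greedy_colour.simps [simp del]

lemma greedy_colour_less:
  assumes "finite (N v)" "card (N v) < K"
  shows "greedy_colour l N v < K"
proof -
  let ?I = "greedy_colour l N ` {w \<in> N v. l w < l v}"
  have fin: "finite {w \<in> N v. l w < l v}" using assms(1) by simp
  have "card ?I \<le> card {w \<in> N v. l w < l v}" using fin by (rule card_image_le)
  also have "\<dots> \<le> card (N v)" using assms(1) by (intro card_mono) auto
  finally have "card ?I < card {..<K}" using assms(2) by simp
  then have "\<not> {..<K} \<subseteq> ?I" using fin card_mono[of ?I "{..<K}"] by auto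
  then obtain c where "c < K" "c \<notin> ?I" by auto
  then have "(LEAST c. \<not> (\<exists>w\<in>{w \<in> N v. l w < l v}. greedy_colour l N w = c)) \<le> c"
    by (intro Least_le) blast
  with \<open>c < K\<close> show ?thesis by (simp add: greedy_colour.simps[of l N v])
qed

lemma greedy_colour_neq:
  assumes "finite (N v)" "w \<in> N v" "l w < l v"
  shows "greedy_colour l N w \<noteq> greedy_colour l N v"
proof -
  let ?P = "\<lambda>c. \<not> (\<exists>w\<in>{w \<in> N v. l w < l v}. greedy_colour l N w = c)"
  have "finite (greedy_colour l N ` {w \<in> N v. l w < l v})" using assms(1) by simp
  then obtain c where "c \<notin> greedy_colour l N ` {w \<in> N v. l w < l v}"
    using ex_new_if_finite[OF infinite_UNIV_nat] by blast
  then have "?P (LEAST c. ?P c)" by (intro LeastI[of ?P c]) auto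
  then show ?thesis using assms by (auto simp: greedy_colour.simps[of l N v])
qed

section \<open>Balls in a graph\<close>

text \<open>Adding \<open>Id\<close> lets a walk rest, so that the \<open>k\<close>-th power gives
  the closed ball rather than the ends of walks of length exactly \<open>k\<close>.\<close>

definition rel_ball :: "('v \<times> 'v) set \<Rightarrow> nat \<Rightarrow> 'v \<Rightarrow> 'v set" where
  "rel_ball A k v = ((A \<union> Id) ^^ k) `` {v}"

lemma rel_ball_0 [simp]: "rel_ball A 0 v = {v}"
  by (auto simp: rel_ball_def)

lemma rel_ball_Suc: "rel_ball A (Suc k) v = (\<Union>w\<in>rel_ball A k v. insert w (A `` {w}))"
  by (auto simp: rel_ball_def)

lemma rel_ball_trans: "v \<in> rel_ball A k u \<Longrightarrow> w \<in> rel_ball A l v \<Longrightarrow> w \<in> rel_ball A (k + l) u"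
  by (auto simp: rel_ball_def relpow_add)

lemma rel_ball_sym:
  assumes "sym A"
  shows "w \<in> rel_ball A k v \<Longrightarrow> v \<in> rel_ball A k w"
proof (induction k arbitrary: w)
  case (Suc k)
  then obtain u where u: "u \<in> rel_ball A k v" "(u, w) \<in> A \<union> Id"
    by (auto simp: rel_ball_Suc)
  then have "u \<in> rel_ball A 1 w" using assms by (auto simp: rel_ball_def sym_def)
  with Suc.IH[OF u(1)] show ?case using rel_ball_trans by fastforce
qed simp

lemma rel_ball_mono: "k \<le> l \<Longrightarrow> rel_ball A k v \<subseteq> rel_ball A l v"
proof (induction l)
  case (Suc l)
  then show ?case by (cases "k = Suc l") (auto simp: rel_ball_Suc)
qed simp

lemma finite_card_rel_ball:
  assumes "\<And>v. finite (A `` {v})" "\<And>v. card (A `` {v}) \<le> d"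
  shows "finite (rel_ball A k v) \<and> card (rel_ball A k v) \<le> (d + 1) ^ k"
proof (induction k)
  case (Suc k)
  have "card (rel_ball A (Suc k) v) \<le> (\<Sum>w\<in>rel_ball A k v. card (insert w (A `` {w})))"
    unfolding rel_ball_Suc using Suc by (intro card_UN_le) auto
  also have "\<dots> \<le> (\<Sum>w\<in>rel_ball A k v. d + 1)"
    using assms by (intro sum_mono) (simp add: card_insert_if le_SucI)
  also have "\<dots> \<le> (d + 1) ^ Suc k"
    using Suc mult_le_mono1[of "card (rel_ball A k v)" "(d + 1) ^ k" "d + 1"] by (simp add: mult.commute)
  finally show ?case using Suc assms by (simp add: rel_ball_Suc)
qed simp

lemma rel_ball_subset: "A \<subseteq> V \<times> V \<Longrightarrow> v \<in> V \<Longrightarrow> rel_ball A k v \<subseteq> V"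
  by (induction k) (auto simp: rel_ball_Suc)

lemma rel_ball_image:
  assumes "\<And>v w. (v, w) \<in> A \<Longrightarrow> (g v, g w) \<in> A"
  shows "w \<in> rel_ball A k v \<Longrightarrow> g w \<in> rel_ball A k (g v)"
  by (induction k arbitrary: w) (use assms in \<open>auto simp: rel_ball_Suc\<close>)

lemma (in commuting_maps) mv_mem_rel_ball:
  assumes step: "\<And>i v. i < n \<Longrightarrow> v \<in> V \<Longrightarrow> s i v = v \<or> (v, s i v) \<in> A"
    and "v \<in> V" "\<And>i. i < n \<Longrightarrow> a i \<le> m"
  shows "mv a v \<in> rel_ball A (n * m) v"
proof -
  have 1: "(s i ^^ k) u \<in> rel_ball A k u" if "i < n" "u \<in> V" for i k u
  proof (induction k)
    case (Suc k)
    have "(s i ^^ Suc k) u \<in> insert ((s i ^^ k) u) (A `` {(s i ^^ k) u})"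
      using step[OF that(1) funpow_closed[OF that], of k] unfolding funpow.simps o_apply by blast
    with Suc show ?case unfolding rel_ball_Suc by blast
  qed simp
  have "multi_iter k s a v \<in> rel_ball A (k * m) v" if "k \<le> n" for k
    using that
  proof (induction k)
    case (Suc k)
    have "multi_iter (Suc k) s a v \<in> rel_ball A (a k) (multi_iter k s a v)"
      using Suc.prems assms(2) by (auto intro!: 1 multi_iter_closed)
    also have "\<dots> \<subseteq> rel_ball A m (multi_iter k s a v)"
      using Suc.prems assms(3) by (intro rel_ball_mono) auto
    finally have "multi_iter (Suc k) s a v \<in> rel_ball A (k * m + m) v"
      using Suc by (intro rel_ball_trans[of "multi_iter k s a v"]) auto
    then show ?case by (simp add: add.commute)
  qed simp
  then show ?thesis by simp
qed

text \<open>Both vertices lie ahead of the one reached by the coordinatewise minimum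
  \<open>c\<close>, by at most \<open>r\<close> in each direction. Walking back to it and forward
  again gives the radius \<open>n * r + n * r\<close>, which reappears in
  \<open>colour\<close>.\<close>

lemma (in commuting_maps) mv_near:
  assumes step: "\<And>i v. i < n \<Longrightarrow> v \<in> V \<Longrightarrow> s i v = v \<or> (v, s i v) \<in> A"
    and "sym A" "v \<in> V" "\<And>i. i < n \<Longrightarrow> a i \<le> b i + r \<and> b i \<le> a i + r"
  shows "mv b v \<in> rel_ball A (n * r + n * r) (mv a v)"
proof -
  define c where "c i = min (a i) (b i)" for i
  define u where "u = mv c v"
  have u: "u \<in> V" using assms by (simp add: u_def)
  have a: "mv a v = mv (\<lambda>i. a i - c i) u" and b: "mv b v = mv (\<lambda>i. b i - c i) u"
    unfolding u_def mv_add[OF \<open>v \<in> V\<close>] by (intro multi_iter_cong; simp add: c_def)+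
  have "mv (\<lambda>i. a i - c i) u \<in> rel_ball A (n * r) u" "mv (\<lambda>i. b i - c i) u \<in> rel_ball A (n * r) u"
    using assms(4) by (intro mv_mem_rel_ball step u; force simp: c_def)+
  then show ?thesis
    unfolding a b by (intro rel_ball_trans[of u]) (auto intro: rel_ball_sym[OF \<open>sym A\<close>])
qed

section \<open>Measurability with countable index sets\<close>

lemma pred_ex_countable:
  assumes "countable I" "\<And>i. i \<in> I \<Longrightarrow> Measurable.pred M (P i)"
  shows "Measurable.pred M (\<lambda>x. \<exists>i\<in>I. P i x)"
  using assms by (auto simp: pred_def intro: sets.sets_Collect_countable_Ex')

lemma pred_all_countable:
  assumes "countable I" "\<And>i. i \<in> I \<Longrightarrow> Measurable.pred M (P i)"
  shows "Measurable.pred M (\<lambda>x. \<forall>i\<in>I. P i x)"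
  using assms by (auto simp: pred_def intro: sets.sets_Collect_countable_All')

lemma pred_countable_values:
  assumes "f \<in> measurable M (count_space I)" "countable I"
    and "\<And>i. i \<in> I \<Longrightarrow> Measurable.pred M (P i)"
  shows "Measurable.pred M (\<lambda>x. P (f x) x)"
  by (rule measurable_compose_countable'[of I P, OF assms(3,1,2)])

lemma pred_cong:
  assumes "\<And>x. x \<in> space M \<Longrightarrow> P x \<longleftrightarrow> Q x"
  shows "Measurable.pred M P \<longleftrightarrow> Measurable.pred M Q"
  using assms by (intro measurable_cong) auto

lemma measurable_countable_pred:
  assumes "countable I" "\<And>x. x \<in> space M \<Longrightarrow> f x \<in> I"
    and "\<And>c. c \<in> I \<Longrightarrow> Measurable.pred M (\<lambda>x. f x = c)"
  shows "f \<in> measurable M (count_space I)"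
  using assms by (auto simp: measurable_count_space_eq_countable pred_def vimage_def Int_def conj_commute)

text \<open>The depth of the recursion is not bounded uniformly in \<open>x\<close>, so the value
  \<open>q\<close> of the label is fixed and the induction is on \<open>q\<close>. On
  \<open>l x v = q\<close> the colour depends on finitely many neighbours with labels below
  \<open>q\<close>, and countably many values \<open>q\<close> cover everything.\<close>

lemma pred_greedy_colour:
  fixes l :: "'x \<Rightarrow> 'v \<Rightarrow> nat"
  assumes N: "\<And>v. v \<in> V \<Longrightarrow> finite (N v) \<and> N v \<subseteq> V"
    and l: "\<And>v q. v \<in> V \<Longrightarrow> Measurable.pred M (\<lambda>x. l x v = q)"
    and v: "v \<in> V"
  shows "Measurable.pred M (\<lambda>x. greedy_colour (l x) N v = c)"
proof -
  have "Measurable.pred M (\<lambda>x. l x v = q \<and> greedy_colour (l x) N v = c)" if "v \<in> V" for q v c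
    using that
  proof (induction q arbitrary: v c rule: less_induct)
    case (less q)
    \<comment> \<open>The colour that \<open>v\<close> would receive if its label were
      \<open>q\<close>; unlike the true colour it is covered by the induction hypothesis for all
      \<open>x\<close>.\<close>
    define t where
      "t x = (LEAST c. \<not> (\<exists>w\<in>N v. \<exists>q'\<in>{..<q}. l x w = q' \<and> greedy_colour (l x) N w = c))" for x
    have "t \<in> measurable M (count_space UNIV)"
      unfolding t_def
      by (intro measurable_Least pred_intros_logic pred_intros_finite less.IH) (use N less.prems in auto)
    then have 1: "Measurable.pred M (\<lambda>x. t x = c)" by measurable
    have 2: "greedy_colour (l x) N v = t x" if "l x v = q" for x
      unfolding t_def greedy_colour.simps[of _ _ v] using that by (intro arg_cong[where f = Least] ext) auto
    have "(\<lambda>x. l x v = q \<and> greedy_colour (l x) N v = c) = (\<lambda>x. l x v = q \<and> t x = c)"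
      using 2 by auto
    then show ?case using 1 l less.prems by (auto intro: pred_intros_logic)
  qed
  then have "Measurable.pred M (\<lambda>x. \<exists>q\<in>UNIV. l x v = q \<and> greedy_colour (l x) N v = c)"
    using v by (intro pred_ex_countable) auto
  then show ?thesis by simp
qed

section \<open>Equivariant families of commuting flows\<close>

text \<open>The interface between dynamics and geometry: \<open>M\<close> will be the Roller
  boundary, \<open>V\<close> the vertex set, and \<open>f i x\<close> the flow in the
  \<open>i\<close>-th factor towards \<open>x\<close>. The countable separating family
  \<open>B\<close> turns equality of points into a countable conjunction. Finiteness of transporters
  is asked only if \<open>M\<close> is nonempty, because on a bounded complex acylindricity imposes
  no finiteness.\<close>

locale flow_system = group G for G (structure) +
  fixes M :: "'z measure" and B :: "nat \<Rightarrow> 'z set" and V :: "'v set" and A :: "('v \<times> 'v) set"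
    and zact :: "'a \<Rightarrow> 'z \<Rightarrow> 'z" and vact :: "'a \<Rightarrow> 'v \<Rightarrow> 'v"
    and n d :: nat and f :: "nat \<Rightarrow> 'z \<Rightarrow> 'v \<Rightarrow> 'v"
  assumes countable_carrier: "countable (carrier G)" and countable_V: "countable V"
    and zact_measurable: "\<And>g. g \<in> carrier G \<Longrightarrow> zact g \<in> measurable M M"
    and zact_one: "\<And>x. x \<in> space M \<Longrightarrow> zact \<one> x = x"
    and zact_mult: "\<And>g h x. g \<in> carrier G \<Longrightarrow> h \<in> carrier G \<Longrightarrow> x \<in> space M \<Longrightarrow>
           zact (g \<otimes> h) x = zact g (zact h x)"
    and vact_closed: "\<And>g v. g \<in> carrier G \<Longrightarrow> v \<in> V \<Longrightarrow> vact g v \<in> V"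
    and vact_one: "\<And>v. v \<in> V \<Longrightarrow> vact \<one> v = v"
    and vact_mult: "\<And>g h v. g \<in> carrier G \<Longrightarrow> h \<in> carrier G \<Longrightarrow> v \<in> V \<Longrightarrow>
           vact (g \<otimes> h) v = vact g (vact h v)"
    and B_sets: "\<And>i. B i \<in> sets M"
    and B_separates: "\<And>x y. x \<in> space M \<Longrightarrow> y \<in> space M \<Longrightarrow> x \<noteq> y \<Longrightarrow> \<exists>i. (x \<in> B i) \<noteq> (y \<in> B i)"
    and A_subset: "A \<subseteq> V \<times> V" and A_sym: "sym A"
    and A_finite: "\<And>v. finite (A `` {v})" and A_card: "\<And>v. card (A `` {v}) \<le> d"
    and A_vact: "\<And>g v w. g \<in> carrier G \<Longrightarrow> (v, w) \<in> A \<Longrightarrow> (vact g v, vact g w) \<in> A"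
    and proper: "\<And>v w. v \<in> V \<Longrightarrow> w \<in> V \<Longrightarrow> space M \<noteq> {} \<Longrightarrow> finite {g \<in> carrier G. vact g v = w}"
    and f_measurable: "\<And>i v. i < n \<Longrightarrow> v \<in> V \<Longrightarrow> (\<lambda>x. f i x v) \<in> measurable M (count_space V)"
    and f_step: "\<And>i x v. i < n \<Longrightarrow> x \<in> space M \<Longrightarrow> v \<in> V \<Longrightarrow> f i x v = v \<or> (v, f i x v) \<in> A"
    and f_commute: "\<And>i j x v. i < n \<Longrightarrow> j < n \<Longrightarrow> x \<in> space M \<Longrightarrow> v \<in> V \<Longrightarrow>
           f i x (f j x v) = f j x (f i x v)"
    and f_equivariant: "\<And>g i x v. g \<in> carrier G \<Longrightarrow> i < n \<Longrightarrow> x \<in> space M \<Longrightarrow> v \<in> V \<Longrightarrow>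
           f i (zact g x) (vact g v) = vact g (f i x v)"
    and f_merge: "\<And>x v w. x \<in> space M \<Longrightarrow> v \<in> V \<Longrightarrow> w \<in> V \<Longrightarrow>
           \<exists>a b. multi_iter n (\<lambda>i. f i x) a v = multi_iter n (\<lambda>i. f i x) b w"
begin

abbreviation mv :: "'z \<Rightarrow> (nat \<Rightarrow> nat) \<Rightarrow> 'v \<Rightarrow> 'v" where "mv x \<equiv> multi_iter n (\<lambda>i. f i x)"
abbreviation ball :: "nat \<Rightarrow> 'v \<Rightarrow> 'v set" where "ball \<equiv> rel_ball A"

lemma f_closed: "i < n \<Longrightarrow> x \<in> space M \<Longrightarrow> v \<in> V \<Longrightarrow> f i x v \<in> V"
  using f_step[of i x v] A_subset by auto

lemma commuting_maps: "x \<in> space M \<Longrightarrow> commuting_maps V n (\<lambda>i. f i x)"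
  by unfold_locales (auto intro: f_closed f_commute)

lemma mv_closed: "x \<in> space M \<Longrightarrow> v \<in> V \<Longrightarrow> mv x a v \<in> V"
  by (rule commuting_maps.mv_closed[OF commuting_maps])

lemma mv_add: "x \<in> space M \<Longrightarrow> v \<in> V \<Longrightarrow> mv x a (mv x b v) = mv x (\<lambda>i. a i + b i) v"
  by (rule commuting_maps.mv_add[OF commuting_maps])

lemma zact_closed: "g \<in> carrier G \<Longrightarrow> x \<in> space M \<Longrightarrow> zact g x \<in> space M"
  using zact_measurable by (rule measurable_space)

lemma zact_inv: "g \<in> carrier G \<Longrightarrow> x \<in> space M \<Longrightarrow> zact (inv g) (zact g x) = x"
  using zact_mult[of "inv g" g x] by (simp add: zact_one)

lemma vact_inv: "g \<in> carrier G \<Longrightarrow> v \<in> V \<Longrightarrow> vact (inv g) (vact g v) = v"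
  using vact_mult[of "inv g" g v] by (simp add: vact_one)

lemma finite_ball: "finite (ball k v)"
  and card_ball: "card (ball k v) \<le> (d + 1) ^ k"
  using finite_card_rel_ball[of A d k v] A_finite A_card by auto

lemma ball_subset: "v \<in> V \<Longrightarrow> ball k v \<subseteq> V"
  using A_subset by (rule rel_ball_subset)

lemma ball_vact: "g \<in> carrier G \<Longrightarrow> w \<in> ball k v \<Longrightarrow> vact g w \<in> ball k (vact g v)"
  by (rule rel_ball_image) (auto intro: A_vact)

lemma ball_vact_eq:
  assumes g: "g \<in> carrier G" and v: "v \<in> V"
  shows "ball k (vact g v) = vact g ` ball k v"
proof
  show "ball k (vact g v) \<subseteq> vact g ` ball k v"
  proof
    fix w assume w: "w \<in> ball k (vact g v)"
    then have "w \<in> V" using ball_subset[OF vact_closed[OF g v]] by blast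
    then have "w = vact g (vact (inv g) w)" using vact_inv[of "inv g" w] g by simp
    moreover have "vact (inv g) w \<in> ball k v"
      using ball_vact[of "inv g" w k "vact g v"] w g v by (simp add: vact_inv)
    ultimately show "w \<in> vact g ` ball k v" by (rule image_eqI)
  qed
qed (use ball_vact g in auto)

lemma mv_vact:
  assumes "g \<in> carrier G" "x \<in> space M" "v \<in> V"
  shows "mv (zact g x) a (vact g v) = vact g (mv x a v)"
proof -
  have 1: "(f i (zact g x) ^^ k) (vact g u) = vact g ((f i x ^^ k) u) \<and> (f i x ^^ k) u \<in> V"
    if "i < n" "u \<in> V" for i k u
  proof (induction k)
    case (Suc k)
    then show ?case using that assms f_closed by (simp add: f_equivariant)
  qed (use that in simp)
  have "multi_iter k (\<lambda>i. f i (zact g x)) a (vact g v) = vact g (multi_iter k (\<lambda>i. f i x) a v)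
     \<and> multi_iter k (\<lambda>i. f i x) a v \<in> V" if "k \<le> n" for k
    using that by (induction k) (auto simp: 1 assms)
  then show ?thesis by simp
qed

text \<open>Orbits of the stabilizer of \<open>x\<close>: vertices that no equivariant family can
  distinguish at \<open>x\<close>.\<close>

definition stab_equiv :: "'z \<Rightarrow> 'v \<Rightarrow> 'v \<Rightarrow> bool" where
  "stab_equiv x v w \<longleftrightarrow> (\<exists>g\<in>carrier G. zact g x = x \<and> vact g v = w)"

lemma stab_equiv_sym:
  assumes "x \<in> space M" "v \<in> V" "stab_equiv x v w"
  shows "stab_equiv x w v"
proof -
  from assms(3) obtain g where g: "g \<in> carrier G" "zact g x = x" "vact g v = w"
    by (auto simp: stab_equiv_def)
  with assms zact_inv[of g x] vact_inv[of g v] show ?thesis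
    unfolding stab_equiv_def by (intro bexI[of _ "inv g"]) auto
qed

text \<open>Conjugation by \<open>g\<close> turns the stabilizer of \<open>x\<close> into that of
  \<open>zact g x\<close>.\<close>

lemma stab_equiv_vact:
  assumes "g \<in> carrier G" "x \<in> space M" "v \<in> V" "stab_equiv x v w"
  shows "stab_equiv (zact g x) (vact g v) (vact g w)"
proof -
  from assms(4) obtain h where h: "h \<in> carrier G" "zact h x = x" "vact h v = w"
    by (auto simp: stab_equiv_def)
  have "zact (g \<otimes> h \<otimes> inv g) (zact g x) = zact g x" "vact (g \<otimes> h \<otimes> inv g) (vact g v) = vact g w"
    using assms h by (simp_all add: zact_mult vact_mult zact_closed vact_closed zact_inv vact_inv)
  with assms h show ?thesis unfolding stab_equiv_def by (intro bexI[of _ "g \<otimes> h \<otimes> inv g"]) auto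
qed

section \<open>Invariant Borel sets that isolate a vertex\<close>

definition cylinder :: "bool list \<Rightarrow> 'z set" where
  "cylinder bs = {x \<in> space M. \<forall>i\<in>{..<length bs}. x \<in> B i \<longleftrightarrow> bs ! i}"

lemma cylinder_sets: "cylinder bs \<in> sets M"
proof -
  have "Measurable.pred M (\<lambda>x. \<forall>i\<in>{..<length bs}. x \<in> B i \<longleftrightarrow> bs ! i)"
    using B_sets by (intro pred_intros_finite pred_intros_logic) auto
  then show ?thesis by (simp add: cylinder_def pred_def)
qed

text \<open>Each point of \<open>Y\<close> is told apart from \<open>x\<close> by one of the sets
  \<open>B i\<close>; the bits of \<open>x\<close> up to the largest index used tell apart all of
  them.\<close>

lemma cylinder_avoids:
  assumes "x \<in> space M" "finite Y" "Y \<subseteq> space M" "x \<notin> Y"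
  shows "\<exists>bs. x \<in> cylinder bs \<and> Y \<inter> cylinder bs = {}"
proof -
  have "\<forall>y\<in>Y. \<exists>i. (x \<in> B i) \<noteq> (y \<in> B i)"
    using assms by (intro ballI B_separates) auto
  then obtain i where i: "\<And>y. y \<in> Y \<Longrightarrow> (x \<in> B (i y)) \<noteq> (y \<in> B (i y))" by metis
  define m where "m = Suc (Max (insert 0 (i ` Y)))"
  have m: "i y < m" if "y \<in> Y" for y
    using that assms(2) by (simp add: m_def less_Suc_eq_le)
  show ?thesis
  proof (intro exI[of _ "map (\<lambda>i. x \<in> B i) [0..<m]"] conjI)
    show "x \<in> cylinder (map (\<lambda>i. x \<in> B i) [0..<m])" using assms by (simp add: cylinder_def)
    show "Y \<inter> cylinder (map (\<lambda>i. x \<in> B i) [0..<m]) = {}"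
      using m i by (fastforce simp: cylinder_def)
  qed
qed

text \<open>
  The sets \<open>pattern q\<close> are countably many invariant Borel sets. Isolating a vertex from its
  inequivalent neighbours by one of them takes the finiteness of transporters, because a
  neighbour \<open>w\<close> is compared with \<open>v\<close> through all group elements that move \<open>w\<close> to \<open>v\<close>.
\<close>

definition pattern :: "nat \<Rightarrow> 'z \<Rightarrow> 'v \<Rightarrow> bool" where
  "pattern q x v \<longleftrightarrow> (\<exists>g\<in>carrier G. vact g v = from_nat_into V (fst (from_nat q :: nat \<times> bool list)) \<and>
      zact g x \<in> cylinder (snd (from_nat q :: nat \<times> bool list)))"

lemma pattern_vact:
  assumes "g \<in> carrier G" "x \<in> space M" "v \<in> V"
  shows "pattern q (zact g x) (vact g v) \<longleftrightarrow> pattern q x v"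
proof
  assume "pattern q (zact g x) (vact g v)"
  then obtain h where "h \<in> carrier G"
      "vact h (vact g v) = from_nat_into V (fst (from_nat q :: nat \<times> bool list))"
      "zact h (zact g x) \<in> cylinder (snd (from_nat q :: nat \<times> bool list))"
    by (auto simp: pattern_def)
  with assms show "pattern q x v" unfolding pattern_def
    by (intro bexI[of _ "h \<otimes> g"]) (auto simp: vact_mult zact_mult)
next
  assume "pattern q x v"
  then obtain h where "h \<in> carrier G"
      "vact h v = from_nat_into V (fst (from_nat q :: nat \<times> bool list))"
      "zact h x \<in> cylinder (snd (from_nat q :: nat \<times> bool list))"
    by (auto simp: pattern_def)
  with assms show "pattern q (zact g x) (vact g v)" unfolding pattern_def
    by (intro bexI[of _ "h \<otimes> inv g"])
      (auto simp: vact_mult zact_mult vact_inv zact_inv vact_closed zact_closed)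
qed

text \<open>The family \<open>B\<close> reduces the equation to countably many membership
  tests.\<close>

lemma pred_zact_eq:
  assumes "g \<in> carrier G"
  shows "Measurable.pred M (\<lambda>x. zact g x = x)"
proof -
  have "Measurable.pred M (\<lambda>x. \<forall>i. zact g x \<in> B i \<longleftrightarrow> x \<in> B i)"
    using zact_measurable[OF assms] B_sets
    by (intro pred_intros_countable pred_intros_logic) (auto intro: pred_sets2)
  also have "?this \<longleftrightarrow> Measurable.pred M (\<lambda>x. zact g x = x)"
    using B_separates zact_closed[OF assms] by (intro pred_cong) metis
  finally show ?thesis .
qed

lemma pred_stab_equiv: "Measurable.pred M (\<lambda>x. stab_equiv x v w)"
  unfolding stab_equiv_def
  by (intro pred_ex_countable countable_carrier pred_intros_logic pred_zact_eq) auto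

lemma pred_pattern: "Measurable.pred M (\<lambda>x. pattern q x v)"
  unfolding pattern_def
  by (intro pred_ex_countable countable_carrier pred_intros_logic)
    (auto intro: pred_sets2[OF cylinder_sets] zact_measurable)

definition isolates :: "nat \<Rightarrow> 'z \<Rightarrow> 'v \<Rightarrow> nat \<Rightarrow> bool" where
  "isolates k x v q \<longleftrightarrow> pattern q x v \<and> (\<forall>w\<in>ball k v. pattern q x w \<longrightarrow> stab_equiv x v w)"

text \<open>A pattern based at \<open>v\<close> itself works. The vertex \<open>v\<close> satisfies
  it through the identity, and a \<open>w\<close> in the ball can satisfy it only through elements
  moving \<open>w\<close> to \<open>v\<close>. For inequivalent \<open>w\<close> these elements move
  \<open>x\<close> to finitely many points, all different from \<open>x\<close>, and a small
  cylinder around \<open>x\<close> misses them.\<close>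

lemma ex_isolates:
  assumes x: "x \<in> space M" and v: "v \<in> V"
  shows "\<exists>q. isolates k x v q"
proof -
  define W where "W = {w \<in> ball k v. \<not> stab_equiv x v w}"
  define Y where "Y = (\<Union>w\<in>W. (\<lambda>g. zact g x) ` {g \<in> carrier G. vact g w = v})"
  have W: "finite W" "W \<subseteq> V" using finite_ball ball_subset[OF v] by (auto simp: W_def)
  have "finite Y" unfolding Y_def using W v x by (intro finite_UN_I finite_imageI proper) auto
  moreover have "Y \<subseteq> space M" using x zact_closed by (auto simp: Y_def)
  moreover have "x \<notin> Y"
  proof
    assume "x \<in> Y"
    then obtain w g where "w \<in> W" "g \<in> carrier G" "vact g w = v" "zact g x = x"
      by (auto simp: Y_def)
    then have "stab_equiv x w v" by (auto simp: stab_equiv_def)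
    then show False using stab_equiv_sym x \<open>w \<in> W\<close> W by (auto simp: W_def)
  qed
  ultimately obtain bs where bs: "x \<in> cylinder bs" "Y \<inter> cylinder bs = {}"
    using cylinder_avoids[OF x] by blast
  define q where "q = to_nat (to_nat_on V v, bs)"
  have q: "from_nat_into V (fst (from_nat q :: nat \<times> bool list)) = v"
      "snd (from_nat q :: nat \<times> bool list) = bs"
    using v countable_V by (auto simp: q_def)
  have "isolates k x v q"
    unfolding isolates_def pattern_def q
  proof (intro conjI ballI impI)
    show "\<exists>g\<in>carrier G. vact g v = v \<and> zact g x \<in> cylinder bs"
      using x v bs by (intro bexI[of _ \<one>]) (auto simp: vact_one zact_one)
    fix w assume "w \<in> ball k v" "\<exists>g\<in>carrier G. vact g w = v \<and> zact g x \<in> cylinder bs"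
    then show "stab_equiv x v w" using bs(2) by (auto simp: Y_def W_def)
  qed
  then show ?thesis ..
qed

section \<open>Equivariant labels and colours of vertices\<close>

definition label :: "nat \<Rightarrow> 'z \<Rightarrow> 'v \<Rightarrow> nat" where
  "label k x v = (LEAST q. isolates k x v q)"

text \<open>One pattern isolates both vertices: \<open>w\<close> satisfies the pattern chosen for
  \<open>v\<close> and lies in the ball, so the isolation of \<open>v\<close> applies.\<close>

lemma label_eq:
  assumes "x \<in> space M" "v \<in> V" "w \<in> ball k v" "label k x v = label k x w"
  shows "stab_equiv x v w"
proof -
  have "w \<in> V" using assms ball_subset by auto
  have "isolates k x v (label k x v)" "isolates k x w (label k x w)"
    unfolding label_def using ex_isolates assms \<open>w \<in> V\<close> by (auto intro: LeastI_ex)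
  then show ?thesis using assms by (auto simp: isolates_def)
qed

lemma stab_equiv_vact_iff:
  assumes "g \<in> carrier G" "x \<in> space M" "v \<in> V" "w \<in> V"
  shows "stab_equiv (zact g x) (vact g v) (vact g w) \<longleftrightarrow> stab_equiv x v w"
  using stab_equiv_vact[of g x v w] stab_equiv_vact[of "inv g" "zact g x" "vact g v" "vact g w"] assms
  by (auto simp: zact_closed vact_closed zact_inv vact_inv)

lemma label_vact:
  assumes "g \<in> carrier G" "x \<in> space M" "v \<in> V"
  shows "label k (zact g x) (vact g v) = label k x v"
proof -
  have "isolates k (zact g x) (vact g v) q \<longleftrightarrow> isolates k x v q" for q
    using assms ball_subset[OF assms(3), of k]
    by (auto simp: isolates_def ball_vact_eq pattern_vact stab_equiv_vact_iff subset_iff)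
  then show ?thesis by (simp add: label_def)
qed

lemma pred_label: "v \<in> V \<Longrightarrow> Measurable.pred M (\<lambda>x. label k x v = q)"
proof -
  have "(\<lambda>x. label k x v) \<in> measurable M (count_space UNIV)"
    unfolding label_def isolates_def
    by (intro measurable_Least pred_intros_logic pred_intros_finite finite_ball pred_pattern pred_stab_equiv)
  then show ?thesis by measurable
qed

text \<open>The radius is that of \<open>mv_near\<close>, so that vertices whose displacements
  differ by at most \<open>r\<close> are neighbours.\<close>

definition colour :: "nat \<Rightarrow> 'z \<Rightarrow> 'v \<Rightarrow> nat" where
  "colour r x = greedy_colour (label (n * r + n * r) x) (ball (n * r + n * r))"

definition num_colours :: "nat \<Rightarrow> nat" where
  "num_colours r = (d + 1) ^ (n * r + n * r) + 1"

lemma colour_less: "colour r x v < num_colours r"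
  unfolding colour_def num_colours_def
  by (intro greedy_colour_less finite_ball) (metis card_ball less_Suc_eq_le Suc_eq_plus1)

text \<open>Of two neighbours with different labels the later one avoids the colour of the earlier
  one; neighbours with equal labels are equivalent by \<open>label_eq\<close>.\<close>

lemma colour_eq:
  assumes "x \<in> space M" "v \<in> V" "w \<in> ball (n * r + n * r) v" "colour r x v = colour r x w"
  shows "stab_equiv x v w"
proof -
  let ?k = "n * r + n * r"
  have "v \<in> ball ?k w" using rel_ball_sym[OF A_sym assms(3)] .
  then have "\<not> label ?k x v < label ?k x w" "\<not> label ?k x w < label ?k x v"
    using assms(4) greedy_colour_neq[where l = "label ?k x" and N = "ball ?k", OF finite_ball assms(3)]
      greedy_colour_neq[where l = "label ?k x" and N = "ball ?k" and w = v and v = w, OF finite_ball]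
    unfolding colour_def by auto
  then show ?thesis using assms by (intro label_eq) auto
qed

text \<open>Induction along the labels, which are invariant: the recursion at
  \<open>vact g v\<close> runs through the translates of the neighbours of \<open>v\<close>.\<close>

lemma colour_vact:
  assumes "g \<in> carrier G" "x \<in> space M" "v \<in> V"
  shows "colour r (zact g x) (vact g v) = colour r x v"
proof -
  let ?k = "n * r + n * r"
  let ?l = "label ?k"
  have "greedy_colour (?l (zact g x)) (ball ?k) (vact g v) = greedy_colour (?l x) (ball ?k) v"
    using assms(3)
  proof (induction "?l x v" arbitrary: v rule: less_induct)
    case less
    have "(\<exists>w\<in>{w \<in> ball ?k (vact g v). ?l (zact g x) w < ?l (zact g x) (vact g v)}.
             greedy_colour (?l (zact g x)) (ball ?k) w = c) \<longleftrightarrow>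
          (\<exists>w\<in>{w \<in> ball ?k v. ?l x w < ?l x v}. greedy_colour (?l x) (ball ?k) w = c)"
      (is "?L \<longleftrightarrow> ?R") for c
    proof -
      have 1: "?l (zact g x) (vact g w) < ?l (zact g x) (vact g v) \<longleftrightarrow> ?l x w < ?l x v"
        and 2: "?l x w < ?l x v \<Longrightarrow> greedy_colour (?l (zact g x)) (ball ?k) (vact g w) = greedy_colour (?l x) (ball ?k) w"
        if w: "w \<in> ball ?k v" for w
      proof -
        have "w \<in> V" using w ball_subset[OF less.prems] by blast
        then show "?l (zact g x) (vact g w) < ?l (zact g x) (vact g v) \<longleftrightarrow> ?l x w < ?l x v"
          "?l x w < ?l x v \<Longrightarrow> greedy_colour (?l (zact g x)) (ball ?k) (vact g w) = greedy_colour (?l x) (ball ?k) w"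
          using assms less.prems less.hyps by (simp_all add: label_vact)
      qed
      have "{w \<in> vact g ` ball ?k v. ?l (zact g x) w < ?l (zact g x) (vact g v)} =
          vact g ` {w \<in> ball ?k v. ?l x w < ?l x v}"
        using 1 by auto
      then show ?thesis unfolding ball_vact_eq[OF assms(1) less.prems] by (auto simp: 2)
    qed
    then show ?case unfolding greedy_colour.simps[of _ _ "vact g v"] greedy_colour.simps[of _ _ v]
      by simp
  qed
  then show ?thesis by (simp add: colour_def)
qed

lemma pred_colour: "v \<in> V \<Longrightarrow> Measurable.pred M (\<lambda>x. colour r x v = c)"
  unfolding colour_def using finite_ball ball_subset
  by (intro pred_greedy_colour[where V = V] pred_label) auto

lemma measurable_mv:
  assumes "v \<in> V"
  shows "(\<lambda>x. mv x a v) \<in> measurable M (count_space V)"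
proof -
  have 1: "(\<lambda>x. (f i x ^^ k) (g x)) \<in> measurable M (count_space V)"
    if "i < n" "g \<in> measurable M (count_space V)" for i k g
  proof (induction k)
    case (Suc k)
    show ?case unfolding funpow.simps o_apply
      by (rule measurable_compose_countable'[OF f_measurable[OF that(1)] Suc countable_V])
  qed (use that in simp)
  have "(\<lambda>x. multi_iter k (\<lambda>i. f i x) a v) \<in> measurable M (count_space V)" if "k \<le> n" for k
    using that by (induction k) (use assms in \<open>auto intro: 1\<close>)
  then show ?thesis by simp
qed

section \<open>Markers and the move to the next marker\<close>

definition sel :: "nat \<Rightarrow> 'z \<Rightarrow> 'v set" where
  "sel r x = marks n (\<lambda>i. f i x) (colour r x) r (num_colours r)"

lemma pred_sel:
  assumes "v \<in> V"
  shows "Measurable.pred M (\<lambda>x. v \<in> sel r x)"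
proof -
  have "Measurable.pred M (\<lambda>x. v \<in> marks n (\<lambda>i. f i x) (colour r x) r j)" if "v \<in> V" for v j
    using that
  proof (induction j arbitrary: v)
    case (Suc j)
    have 1: "Measurable.pred M (\<lambda>x. mv x a v \<in> marks n (\<lambda>i. f i x) (colour r x) r j)" for a
      by (rule pred_countable_values[where f = "\<lambda>x. mv x a v" and
            P = "\<lambda>u x. u \<in> marks n (\<lambda>i. f i x) (colour r x) r j",
            OF measurable_mv[OF Suc.prems] countable_V Suc.IH])
    have 2: "Measurable.pred M (\<lambda>x. colour r x (mv x a v) = c)" for a c
      by (rule pred_countable_values[where f = "\<lambda>x. mv x a v" and P = "\<lambda>u x. colour r x u = c",
            OF measurable_mv[OF Suc.prems] countable_V pred_colour])
    show ?case
      unfolding marks.simps Un_iff mem_Collect_eq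
      by (intro pred_intros_logic pred_intros_finite finite_vecs 1 2)
  qed simp
  then show ?thesis using assms by (simp add: sel_def)
qed

lemma sel_vact:
  assumes "g \<in> carrier G" "x \<in> space M" "v \<in> V"
  shows "vact g v \<in> sel r (zact g x) \<longleftrightarrow> v \<in> sel r x"
proof -
  have "vact g v \<in> marks n (\<lambda>i. f i (zact g x)) (colour r (zact g x)) r j \<longleftrightarrow>
      v \<in> marks n (\<lambda>i. f i x) (colour r x) r j" for j
    using assms(3)
    by (induction j arbitrary: v) (use assms(1,2) in \<open>simp_all add: mv_vact colour_vact mv_closed\<close>)
  then show ?thesis by (simp add: sel_def)
qed

text \<open>The choice is made from a set of displacement vectors, not of vertices. This set does
  not change under the group and has only finitely many possible values, so that the choice is
  invariant and Borel although \<open>SOME\<close> is arbitrary.\<close>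

definition offset :: "nat \<Rightarrow> 'z \<Rightarrow> 'v \<Rightarrow> nat \<Rightarrow> nat" where
  "offset r x v = (SOME a. a \<in> {a \<in> vecs n (2 * r). mv x a v \<in> sel r x})"

text \<open>A member of \<open>sel\<close> names the point \<open>num_colours r * r\<close> ahead of
  it. The shift passes from the name to that point, for which \<open>marks_separated\<close> gives
  separation.\<close>

definition contract :: "nat \<Rightarrow> 'z \<Rightarrow> 'v \<Rightarrow> 'v" where
  "contract r x v = mv x (\<lambda>i. num_colours r * r + offset r x v i) v"

lemma offset:
  assumes "x \<in> space M" "v \<in> V"
  shows "offset r x v \<in> vecs n (2 * r)" "mv x (offset r x v) v \<in> sel r x"
proof -
  obtain a where "a \<in> vecs n (2 * r)" "mv x a v \<in> sel r x"
    using commuting_maps.marks_dense[OF commuting_maps[OF assms(1)] assms(2), of "colour r x"]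
    unfolding sel_def using colour_less by blast
  then have "a \<in> {a \<in> vecs n (2 * r). mv x a v \<in> sel r x}" by simp
  then have "offset r x v \<in> {a \<in> vecs n (2 * r). mv x a v \<in> sel r x}"
    unfolding offset_def by (rule someI[of "\<lambda>a. a \<in> {a \<in> vecs n (2 * r). mv x a v \<in> sel r x}"])
  then show "offset r x v \<in> vecs n (2 * r)" "mv x (offset r x v) v \<in> sel r x" by auto
qed

lemma offset_vact:
  assumes "g \<in> carrier G" "x \<in> space M" "v \<in> V"
  shows "offset r (zact g x) (vact g v) = offset r x v"
proof -
  have "{a \<in> vecs n (2 * r). mv (zact g x) a (vact g v) \<in> sel r (zact g x)} =
      {a \<in> vecs n (2 * r). mv x a v \<in> sel r x}"
    using assms by (auto simp: mv_vact sel_vact mv_closed)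
  then show ?thesis by (simp only: offset_def)
qed

lemma contract_vact:
  "g \<in> carrier G \<Longrightarrow> x \<in> space M \<Longrightarrow> v \<in> V \<Longrightarrow>
     contract r (zact g x) (vact g v) = vact g (contract r x v)"
  by (simp add: contract_def mv_vact offset_vact)

lemma measurable_offset:
  assumes "v \<in> V"
  shows "(\<lambda>x. offset r x v) \<in> measurable M (count_space (vecs n (2 * r)))"
proof -
  let ?D = "\<lambda>x. {a \<in> vecs n (2 * r). mv x a v \<in> sel r x}"
  have "?D \<in> measurable M (count_space (Pow (vecs n (2 * r))))"
  proof (rule measurable_countable_pred)
    fix C assume "C \<in> Pow (vecs n (2 * r))"
    then have eq: "(\<lambda>x. ?D x = C) = (\<lambda>x. \<forall>a\<in>vecs n (2 * r). mv x a v \<in> sel r x \<longleftrightarrow> a \<in> C)"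
      by auto
    have "Measurable.pred M (\<lambda>x. mv x a v \<in> sel r x)" for a
      by (rule pred_countable_values[where f = "\<lambda>x. mv x a v" and P = "\<lambda>u x. u \<in> sel r x",
            OF measurable_mv[OF assms] countable_V pred_sel])
    then show "Measurable.pred M (\<lambda>x. ?D x = C)"
      unfolding eq by (intro pred_intros_finite pred_intros_logic) auto
  qed (auto intro: countable_finite)
  then have "(\<lambda>x. offset r x v) \<in> measurable M (count_space UNIV)"
    unfolding offset_def by (rule measurable_compose) simp
  then have "Measurable.pred M (\<lambda>x. offset r x v = c)" for c
    by measurable
  with offset(1)[OF _ assms] show ?thesis
    by (rule measurable_countable_pred[OF countable_finite[OF finite_vecs]])
qed

lemma contract_closed: "x \<in> space M \<Longrightarrow> v \<in> V \<Longrightarrow> contract r x v \<in> V"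
  by (simp add: contract_def mv_closed)

lemma measurable_contract:
  assumes "v \<in> V"
  shows "(\<lambda>x. contract r x v) \<in> measurable M (count_space V)"
proof -
  have "(\<lambda>x. (\<lambda>a x. mv x (\<lambda>i. num_colours r * r + a i) v) (offset r x v) x) \<in> measurable M (count_space V)"
    using measurable_offset[OF assms] countable_finite[OF finite_vecs] measurable_mv[OF assms]
    by (rule measurable_compose_countable'[rotated 1])
  then show ?thesis by (simp add: contract_def)
qed

end

section \<open>Borel graphs and equivalence relations\<close>

lemma pred_graph:
  assumes g: "g \<in> measurable M M" and B: "\<And>i. B i \<in> sets M"
    and sep: "\<And>x y. x \<in> space M \<Longrightarrow> y \<in> space M \<Longrightarrow> x \<noteq> y \<Longrightarrow> \<exists>i::nat. (x \<in> B i) \<noteq> (y \<in> B i)"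
  shows "Measurable.pred (M \<Otimes>\<^sub>M M) (\<lambda>p. g (fst p) = snd p)"
proof -
  have [measurable]: "g \<in> measurable M M" "\<And>i. B i \<in> sets M" by fact+
  have "Measurable.pred (M \<Otimes>\<^sub>M M) (\<lambda>p. \<forall>i. g (fst p) \<in> B i \<longleftrightarrow> snd p \<in> B i)"
    by measurable
  also have "?this \<longleftrightarrow> Measurable.pred (M \<Otimes>\<^sub>M M) (\<lambda>p. g (fst p) = snd p)"
    using sep measurable_space[OF g] by (intro pred_cong) (auto simp: space_pair_measure, metis)
  finally show ?thesis .
qed

lemma borel_equivalenceI:
  assumes "equiv (space M) E" "Measurable.pred (M \<Otimes>\<^sub>M M) (\<lambda>p. p \<in> E)"
  shows "borel_equivalence M E"
proof -
  have "E \<subseteq> space M \<times> space M" using assms(1) by (rule equiv_type)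
  then have "{p \<in> space (M \<Otimes>\<^sub>M M). p \<in> E} = E" by (auto simp: space_pair_measure)
  with assms show ?thesis by (simp add: borel_equivalence_def pred_def)
qed

section \<open>The approximating finite relations\<close>

context flow_system
begin

text \<open>
  The scale at step \<open>k\<close> exceeds by \<open>k\<close> the total displacement \<open>reach k\<close> of the previous steps;
  thus any finitely many vertices end up in one box whose side is the current scale.
\<close>

primrec reach :: "nat \<Rightarrow> nat" where
  "reach 0 = 0"
| "reach (Suc k) = reach k + k + num_colours (reach k + k) * (reach k + k) + 2 * (reach k + k)"

text \<open>The move by \<open>k\<close> before each contraction serves
  \<open>approx_finite_index\<close>: paths from several start vertices are to be compared from one
  common vertex \<open>z\<close>, and for large \<open>k\<close> this move covers all displacements
  to \<open>z\<close>.\<close>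

primrec path :: "nat \<Rightarrow> 'z \<Rightarrow> 'v \<Rightarrow> 'v" where
  "path 0 x v = v"
| "path (Suc k) x v = contract (reach k + k) x (mv x (\<lambda>_. k) (path k x v))"

lemma path_closed: "x \<in> space M \<Longrightarrow> v \<in> V \<Longrightarrow> path k x v \<in> V"
  by (induction k) (auto intro: contract_closed mv_closed)

lemma path_vact:
  "g \<in> carrier G \<Longrightarrow> x \<in> space M \<Longrightarrow> v \<in> V \<Longrightarrow> path k (zact g x) (vact g v) = vact g (path k x v)"
  by (induction k) (simp_all add: contract_vact mv_vact path_closed mv_closed)

lemma measurable_path: "v \<in> V \<Longrightarrow> (\<lambda>x. path k x v) \<in> measurable M (count_space V)"
proof (induction k)
  case (Suc k)
  have "(\<lambda>x. mv x (\<lambda>_. k) (path k x v)) \<in> measurable M (count_space V)"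
    by (rule measurable_compose_countable'[OF measurable_mv Suc.IH[OF Suc.prems] countable_V])
  from measurable_compose_countable'[OF measurable_contract this countable_V]
  show ?case by simp
qed simp

lemma path_eq:
  assumes "x \<in> space M" "v \<in> V"
  shows "\<exists>e. path k x v = mv x e v \<and> (\<forall>i<n. e i \<le> reach k)"
proof (induction k)
  case 0
  have "mv x (\<lambda>_. 0) v = v" by (induction n) auto
  then show ?case by (intro exI[of _ "\<lambda>_. 0"]) auto
next
  case (Suc k)
  then obtain e where e: "path k x v = mv x e v" "\<And>i. i < n \<Longrightarrow> e i \<le> reach k" by auto
  define r where "r = reach k + k"
  define u where "u = mv x (\<lambda>_. k) (path k x v)"
  have "u \<in> V" using assms by (simp add: u_def mv_closed path_closed)
  then have o: "offset r x u i \<le> 2 * r" if "i < n" for i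
    using offset(1)[OF assms(1), of u r] that by (auto simp: vecs_def)
  have "path (Suc k) x v = mv x (\<lambda>i. num_colours r * r + offset r x u i + (k + e i)) v"
    using assms by (simp add: r_def u_def contract_def e(1) mv_add mv_closed)
  moreover have "num_colours r * r + offset r x u i + (k + e i) \<le> reach (Suc k)" if "i < n" for i
    using o[OF that] e(2)[OF that] unfolding reach.simps r_def[symmetric] by (simp add: r_def)
  ultimately show ?case by blast
qed

text \<open>
  Two markers whose offsets from \<open>z\<close> lie in the same cube of side \<open>r\<close> are equivalent, and the
  offsets are at most \<open>3 * r\<close>, so that \<open>3 ^ n\<close> such cubes suffice.
\<close>

lemma contract_few_values:
  fixes b :: "'j \<Rightarrow> nat \<Rightarrow> nat"
  assumes x: "x \<in> space M" and z: "z \<in> V" and J: "finite J" "card J > 3 ^ n"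
    and b: "\<And>j i. j \<in> J \<Longrightarrow> i < n \<Longrightarrow> b j i \<le> r"
  shows "\<exists>j\<in>J. \<exists>l\<in>J. j \<noteq> l \<and> stab_equiv x (contract r x (mv x (b j) z)) (contract r x (mv x (b l) z))"
proof -
  \<comment> \<open>The displacement from \<open>z\<close> to the member of \<open>sel\<close>
    chosen for \<open>mv x (b j) z\<close>, still without the shift
    \<open>num_colours r * r\<close>.\<close>
  define a where "a j i = offset r x (mv x (b j) z) i + b j i" for j i
  have o: "offset r x (mv x (b j) z) \<in> vecs n (2 * r)" "mv x (a j) z \<in> sel r x" for j
    using offset[OF x mv_closed[OF x z], where r = r] mv_add[OF x z] by (simp_all add: a_def[abs_def])
  \<comment> \<open>A cube has \<open>r + 1\<close> integer points in each direction, so that two of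
    its points differ by at most \<open>r\<close>. Since \<open>3 * r < 3 * (r + 1)\<close>, each
    coordinate meets three cubes.\<close>
  define q where "q j = restrict (\<lambda>i. a j i div (r + 1)) {..<n}" for j
  have q: "q j \<in> (\<Pi>\<^sub>E i\<in>{..<n}. {..<3})" if "j \<in> J" for j
  proof -
    have "a j i div (r + 1) < 3" if "i < n" for i
    proof -
      have "a j i \<le> 2 * r + r" using o(1)[of j] b[OF \<open>j \<in> J\<close> that] that
        unfolding a_def by (intro add_mono) (auto simp: vecs_def)
      also have "\<dots> < 3 * (r + 1)" by simp
      finally show ?thesis by (rule less_mult_imp_div_less)
    qed
    then show ?thesis by (auto simp: q_def)
  qed
  have "card (q ` J) \<le> card (\<Pi>\<^sub>E i\<in>{..<n}. {..<3::nat})"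
    using q by (intro card_mono finite_PiE) auto
  also have "\<dots> = 3 ^ n" by (simp add: card_PiE)
  finally have "\<not> inj_on q J" using J by (intro pigeonhole) auto
  then obtain j l where jl: "j \<in> J" "l \<in> J" "j \<noteq> l" "q j = q l" by (auto simp: inj_on_def)
  have close: "a j i \<le> a l i + r \<and> a l i \<le> a j i + r" if "i < n" for i
  proof -
    define t where "t = a l i div (r + 1)"
    have "a j i div (r + 1) = t"
      using that fun_cong[OF jl(4), of i] by (simp add: q_def t_def)
    then have "a j i = t * (r + 1) + a j i mod (r + 1)" "a l i = t * (r + 1) + a l i mod (r + 1)"
      unfolding t_def by (metis div_mult_mod_eq)+
    moreover have "a j i mod (r + 1) < r + 1" "a l i mod (r + 1) < r + 1" by simp_all
    ultimately show ?thesis by linarith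
  qed
  interpret cm: commuting_maps V n "\<lambda>i. f i x" by (rule commuting_maps[OF x])
  \<comment> \<open>The abstract relation of \<open>marks_separated\<close> becomes
    \<open>stab_equiv x\<close>: close vertices are neighbours for the colouring, and equal colours
    make them equivalent.\<close>
  have "stab_equiv x (mv x (\<lambda>i. num_colours r * r + a j i) z) (mv x (\<lambda>i. num_colours r * r + a l i) z)"
  proof (rule cm.marks_separated[where \<kappa> = "colour r x" and r = r])
    fix v a b assume *: "v \<in> V" "\<And>i. i < n \<Longrightarrow> a i \<le> b i + r \<and> b i \<le> a i + r"
      "colour r x (mv x a v) = colour r x (mv x b v)"
    have "mv x b v \<in> ball (n * r + n * r) (mv x a v)"
      using * by (intro cm.mv_near A_sym) (auto simp: f_step x)
    then show "stab_equiv x (mv x a v) (mv x b v)"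
      using * x by (intro colour_eq) (auto simp: mv_closed)
  qed (use z close o(2) in \<open>auto simp: sel_def\<close>)
  moreover have "contract r x (mv x (b j) z) = mv x (\<lambda>i. num_colours r * r + a j i) z" for j
    using x z by (simp add: contract_def mv_add a_def add.assoc)
  ultimately show ?thesis using jl by metis
qed

definition approx :: "'v \<Rightarrow> nat \<Rightarrow> ('z \<times> 'z) set" where
  "approx v k = {(x, y). x \<in> space M \<and> y \<in> space M \<and>
     (\<exists>g\<in>carrier G. zact g x = y \<and> vact g (path k x v) = path k y v)}"

lemma approx_equiv:
  assumes v: "v \<in> V"
  shows "equiv (space M) (approx v k)"
proof (rule equivI)
  show "refl_on (space M) (approx v k)"
    using v by (auto simp: refl_on_def approx_def zact_one vact_one path_closed intro!: bexI[of _ \<one>])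
  show "sym (approx v k)"
  proof (rule symI)
    fix x y assume "(x, y) \<in> approx v k"
    then obtain g where "x \<in> space M" "y \<in> space M" "g \<in> carrier G" "zact g x = y"
        "vact g (path k x v) = path k y v"
      by (auto simp: approx_def)
    moreover from this have "zact (inv g) y = x" "vact (inv g) (path k y v) = path k x v"
      using zact_inv[of g x] vact_inv[of g "path k x v"] v by (auto simp: path_closed)
    ultimately show "(y, x) \<in> approx v k" by (auto simp: approx_def)
  qed
  show "trans (approx v k)"
  proof (rule transI)
    fix x y z assume "(x, y) \<in> approx v k" "(y, z) \<in> approx v k"
    then obtain g h where "x \<in> space M" "y \<in> space M" "z \<in> space M" "g \<in> carrier G" "zact g x = y"
        "vact g (path k x v) = path k y v" "h \<in> carrier G" "zact h y = z"
        "vact h (path k y v) = path k z v"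
      by (auto simp: approx_def)
    moreover from this have "zact (h \<otimes> g) x = z" "vact (h \<otimes> g) (path k x v) = path k z v"
      using v by (auto simp: zact_mult vact_mult path_closed)
    ultimately show "(x, z) \<in> approx v k" unfolding approx_def
      by (auto intro!: bexI[of _ "h \<otimes> g"])
  qed
qed (auto simp: approx_def)

lemma approx_borel:
  assumes v: "v \<in> V"
  shows "borel_equivalence M (approx v k)"
proof (rule borel_equivalenceI[OF approx_equiv[OF v]])
  let ?P = "M \<Otimes>\<^sub>M M"
  have path: "Measurable.pred M (\<lambda>x. path k x v = u)" for u
  proof -
    have "path k x v \<in> V" if "x \<in> space M" for x using that v by (rule path_closed)
    moreover have "Measurable.pred M (\<lambda>x. path k x v \<in> V \<inter> {u})"
      by (rule pred_sets2[OF _ measurable_path[OF v]]) simp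
    ultimately show ?thesis by (subst pred_cong[where Q = "\<lambda>x. path k x v \<in> V \<inter> {u}"]) auto
  qed
  have 1: "Measurable.pred ?P (\<lambda>p. path k (fst p) v = u)" for u
    by (rule measurable_compose[OF measurable_fst path])
  have 2: "Measurable.pred ?P (\<lambda>p. path k (snd p) v = u)" for u
    by (rule measurable_compose[OF measurable_snd path])
  have "Measurable.pred ?P (\<lambda>p. \<exists>g\<in>carrier G. zact g (fst p) = snd p \<and>
      (\<exists>u\<in>V. path k (fst p) v = u \<and> path k (snd p) v = vact g u))"
    by (intro pred_ex_countable countable_carrier countable_V pred_intros_logic 1 2
        pred_graph[OF zact_measurable B_sets B_separates])
  also have "?this \<longleftrightarrow> Measurable.pred ?P (\<lambda>p. p \<in> approx v k)"
    using path_closed[OF _ v] by (intro pred_cong) (auto simp: approx_def space_pair_measure)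
  finally show "Measurable.pred ?P (\<lambda>p. p \<in> approx v k)" .
qed

text \<open>All paths start at the same \<open>v\<close>, so for every \<open>y\<close> the marker
  of stage \<open>k\<close> lies within \<open>n * reach k\<close> of \<open>v\<close>. A point
  related to \<open>x\<close> is thus reached by an element moving the marker of \<open>x\<close> to
  one of finitely many vertices, and transporters are finite.\<close>

lemma approx_finite:
  assumes v: "v \<in> V" and x: "x \<in> space M"
  shows "finite (approx v k `` {x})"
proof -
  let ?W = "ball (n * reach k) v" and ?p = "path k x v"
  have p: "?p \<in> V" using x v by (rule path_closed)
  have "path k y v \<in> ?W" if y: "y \<in> space M" for y
  proof -
    interpret cm: commuting_maps V n "\<lambda>i. f i y" by (rule commuting_maps[OF y])
    obtain e where "path k y v = mv y e v" "\<And>i. i < n \<Longrightarrow> e i \<le> reach k"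
      using path_eq[OF y v] by blast
    then show ?thesis using cm.mv_mem_rel_ball[OF f_step[OF _ y] v] by simp
  qed
  then have "approx v k `` {x} \<subseteq> (\<Union>w\<in>?W. (\<lambda>g. zact g x) ` {g \<in> carrier G. vact g ?p = w})"
    by (fastforce simp: approx_def)
  moreover have "finite \<dots>"
    using ball_subset[OF v] p x by (intro finite_UN_I finite_ball finite_imageI proper) auto
  ultimately show ?thesis by (rule finite_subset)
qed

text \<open>The element that matches the markers of stage \<open>k\<close> also matches those of the
  next stage, because the moves between them are equivariant.\<close>

lemma approx_mono: "v \<in> V \<Longrightarrow> approx v k \<subseteq> approx v (Suc k)"
proof
  fix p assume v: "v \<in> V" and p: "p \<in> approx v k"
  then obtain x g where p: "p = (x, zact g x)" "x \<in> space M" "g \<in> carrier G"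
      "vact g (path k x v) = path k (zact g x) v"
    by (auto simp: approx_def)
  then have "vact g (path (Suc k) x v) = path (Suc k) (zact g x) v"
    using v mv_vact[of g x "path k x v"] contract_vact[of g x "mv x (\<lambda>_. k) (path k x v)"]
    by (simp add: path_closed mv_closed)
  with p show "p \<in> approx v (Suc k)" by (auto simp: approx_def zact_closed)
qed

lemma approx_subset: "approx v k \<subseteq> orbit_relation G (space M) zact"
  by (auto simp: approx_def orbit_relation_def)

text \<open>Equivariance replaces the many points \<open>zact g x\<close> with one base vertex by
  the single point \<open>x\<close> with the start vertices \<open>vact (inv g) v\<close>. At a late
  stage their paths lie in one box of the current scale ahead of a common \<open>z\<close>, and
  \<open>contract_few_values\<close> makes two of the next markers equivalent under the stabilizer
  of \<open>x\<close>.\<close>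

lemma approx_finite_index:
  assumes v: "v \<in> V" and x: "x \<in> space M"
    and J: "finite J" "card J > 3 ^ n" "J \<subseteq> carrier G"
  shows "\<exists>g\<in>J. \<exists>h\<in>J. g \<noteq> h \<and> (zact g x, zact h x) \<in> (\<Union>k. approx v k)"
proof -
  interpret cm: commuting_maps V n "\<lambda>i. f i x" by (rule commuting_maps[OF x])
  define w where "w g = vact (inv g) v" for g
  have w: "w g \<in> V" if "g \<in> J" for g using that J v by (auto simp: w_def vact_closed)
  have "J \<noteq> {}" using J by auto
  then have "finite (w ` J)" "w ` J \<noteq> {}" "w ` J \<subseteq> V" using w J by auto
  then have "\<exists>z\<in>V. \<exists>a. \<forall>u\<in>w ` J. mv x (a u) u = z"
    by (intro cm.merge_finite f_merge[OF x])
  then obtain z a where z: "z \<in> V" and a: "\<And>g. g \<in> J \<Longrightarrow> mv x (a (w g)) (w g) = z"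
    by auto
  \<comment> \<open>Large enough to dominate every displacement from a start vertex to
    \<open>z\<close>. As a path has moved by at most \<open>reach k\<close>, the box at
    \<open>z\<close> has side \<open>reach k + k\<close>, the scale of the next contraction.\<close>
  define k where "k = Max (insert 0 ((\<lambda>(g, i). a (w g) i) ` (J \<times> {..<n})))"
  have k: "a (w g) i \<le> k" if "g \<in> J" "i < n" for g i
    unfolding k_def using that J by (intro Max_ge) auto
  have "\<exists>b. mv x (\<lambda>_. k) (path k x (w g)) = mv x b z \<and> (\<forall>i<n. b i \<le> reach k + k)" if g: "g \<in> J" for g
  proof -
    obtain e where e: "path k x (w g) = mv x e (w g)" "\<And>i. i < n \<Longrightarrow> e i \<le> reach k"
      using path_eq[OF x w[OF g]] by blast
    have "mv x (\<lambda>_. k) (path k x (w g)) = mv x (\<lambda>i. k + e i) (w g)"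
      using e w[OF g] by (simp add: mv_add[OF x])
    also have "\<dots> = mv x (\<lambda>i. (k + e i - a (w g) i) + a (w g) i) (w g)"
      using k[OF g] by (intro multi_iter_cong) (simp add: trans_le_add1)
    also have "\<dots> = mv x (\<lambda>i. k + e i - a (w g) i) z"
      by (subst mv_add[OF x w[OF g], symmetric]) (simp add: a[OF g])
    finally show ?thesis using e(2) by (intro exI conjI) (auto simp: le_diff_conv trans_le_add1 add.commute)
  qed
  then obtain b where b: "\<And>g. g \<in> J \<Longrightarrow> mv x (\<lambda>_. k) (path k x (w g)) = mv x (b g) z"
      "\<And>g i. g \<in> J \<Longrightarrow> i < n \<Longrightarrow> b g i \<le> reach k + k" by metis
  obtain g h where gh: "g \<in> J" "h \<in> J" "g \<noteq> h"
      "stab_equiv x (contract (reach k + k) x (mv x (b g) z)) (contract (reach k + k) x (mv x (b h) z))"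
    using contract_few_values[OF x z J(1,2), of b "reach k + k"] b(2) by blast
  then have "stab_equiv x (path (Suc k) x (w g)) (path (Suc k) x (w h))"
    using b(1) by simp
  then obtain s where s: "s \<in> carrier G" "zact s x = x"
      "vact s (path (Suc k) x (w g)) = path (Suc k) x (w h)"
    by (auto simp: stab_equiv_def)
  have G: "g \<in> carrier G" "h \<in> carrier G" using gh J by auto
  have p: "path (Suc k) (zact g x) v = vact g (path (Suc k) x (w g))" if "g \<in> J" for g
    using path_vact[of g x "w g" "Suc k"] that J x w[OF that] vact_inv[of "inv g" v] v
    by (auto simp: w_def)
  \<comment> \<open>Back from \<open>zact g x\<close> to \<open>x\<close>, through the stabilizer
    from one marker to the other, and forward to \<open>zact h x\<close>.\<close>
  have 1: "zact (h \<otimes> s \<otimes> inv g) (zact g x) = zact h x"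
    using G s x by (simp add: zact_mult zact_closed zact_inv)
  have 2: "vact (h \<otimes> s \<otimes> inv g) (path (Suc k) (zact g x) v) = path (Suc k) (zact h x) v"
    unfolding p[OF gh(1)] p[OF gh(2)]
    using G s x w gh by (simp add: vact_mult vact_closed vact_inv path_closed del: path.simps)
  have "(zact g x, zact h x) \<in> approx v (Suc k)"
    unfolding approx_def using 1 2 G s x
    by (auto simp: zact_closed simp del: path.simps intro!: bexI[of _ "h \<otimes> s \<otimes> inv g"])
  with gh show ?thesis by blast
qed

end

section \<open>Hyperfiniteness passes to finite index extensions\<close>

text \<open>
  Two points are related at stage \<open>k\<close> if the canonical representatives of the classes of
  \<open>\<Union>k. F k\<close> in their common \<open>E\<close>-class are pairwise related by \<open>F k\<close> as soon as
  they are related at all.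
\<close>

lemma hyperfinite_finite_index:
  fixes act :: "nat \<Rightarrow> 'z \<Rightarrow> 'z"
  assumes E: "borel_equivalence M E"
    and F: "\<And>k. borel_equivalence M (F k)" "\<And>k x. x \<in> space M \<Longrightarrow> finite (F k `` {x})"
      "\<And>k. F k \<subseteq> F (Suc k)" "\<And>k. F k \<subseteq> E"
    and act: "\<And>j. act j \<in> measurable M M" "\<And>x. x \<in> space M \<Longrightarrow> act 0 x = x"
      "\<And>x j. x \<in> space M \<Longrightarrow> (x, act j x) \<in> E" "\<And>x y. (x, y) \<in> E \<Longrightarrow> \<exists>j. act j x = y"
    and index: "\<And>x. x \<in> space M \<Longrightarrow> finite {j. \<forall>i<j. (act i x, act j x) \<notin> (\<Union>k. F k)}"
  shows "hyperfinite M E"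
proof -
  define U where "U = (\<Union>k. F k)"
  \<comment> \<open>An index is kept if its point is the first one enumerated in its class of
    \<open>U\<close>. The points \<open>act j x\<close> with \<open>j\<close> in \<open>D x\<close>
    thus represent each class of \<open>U\<close> in the \<open>E\<close>-class of \<open>x\<close>
    once. The enumeration starts at \<open>x\<close>, so the representatives depend on
    \<open>x\<close> and not only on its class.\<close>
  define D where "D x = {j. \<forall>i<j. (act i x, act j x) \<notin> U}" for x
  define F' where "F' k = {(x, y) \<in> E. \<forall>i\<in>D x. \<forall>j\<in>D y. (act i x, act j y) \<in> U \<longrightarrow>
      (act i x, act j y) \<in> F k}" for k
  have eqE: "equiv (space M) E" and eqF: "\<And>k. equiv (space M) (F k)"
    using E F(1) by (auto simp: borel_equivalence_def)
  have monoF: "k \<le> l \<Longrightarrow> F k \<subseteq> F l" for k l by (rule lift_Suc_mono_le[of F, OF F(3)])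
  have spE: "x \<in> space M" "y \<in> space M" if "(x, y) \<in> E" for x y
    using that equiv_type[OF eqE] by auto
  have symE: "(y, x) \<in> E" if "(x, y) \<in> E" for x y using eqE that by (auto simp: equiv_def sym_def)
  have transE: "(x, z) \<in> E" if "(x, y) \<in> E" "(y, z) \<in> E" for x y z
    using eqE that by (auto simp: equiv_def dest: transD)
  have reflF: "(x, x) \<in> F k" if "x \<in> space M" for x k
    using eqF[of k] that by (auto simp: equiv_def refl_on_def)
  have symF: "(y, x) \<in> F k" if "(x, y) \<in> F k" for x y k
    using eqF[of k] that by (auto simp: equiv_def sym_def)
  have transF: "(x, z) \<in> F k" if "(x, y) \<in> F k" "(y, z) \<in> F k" for x y z k
    using eqF[of k] that by (auto simp: equiv_def dest: transD)
  have reflU: "(x, x) \<in> U" if "x \<in> space M" for x using reflF that by (auto simp: U_def)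
  have symU: "(y, x) \<in> U" if "(x, y) \<in> U" for x y using symF that by (auto simp: U_def)
  have transU: "(x, z) \<in> U" if "(x, y) \<in> U" "(y, z) \<in> U" for x y z
  proof -
    from that obtain k l where "(x, y) \<in> F k" "(y, z) \<in> F l" by (auto simp: U_def)
    then have "(x, y) \<in> F (max k l)" "(y, z) \<in> F (max k l)"
      using monoF[of k "max k l"] monoF[of l "max k l"] by auto
    then show ?thesis using transF unfolding U_def by blast
  qed
  have act_sp: "act j x \<in> space M" if "x \<in> space M" for j x
    using act(1) that by (rule measurable_space)
  have D0: "0 \<in> D x" for x by (simp add: D_def)
  have finD: "finite (D x)" if "x \<in> space M" for x
    using index[OF that] by (simp add: D_def U_def)
  have D_unique: "i = j" if "i \<in> D x" "j \<in> D x" "(act i x, act j x) \<in> U" for i j x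
  proof (rule ccontr)
    assume "i \<noteq> j"
    then consider "i < j" | "j < i" by linarith
    then show False using that symU by cases (auto simp: D_def)
  qed
  have D_meets: "\<exists>j\<in>D x. (act j x, y) \<in> U" if "(x, y) \<in> E" for x y
  proof -
    obtain m where m: "act m x = y" using act(4) \<open>(x, y) \<in> E\<close> by blast
    define j where "j = (LEAST j. (act j x, y) \<in> U)"
    have j: "(act j x, y) \<in> U" unfolding j_def
      using m reflU spE[OF that] by (intro LeastI[of "\<lambda>j. (act j x, y) \<in> U" m]) auto
    have "(act i x, act j x) \<notin> U" if "i < j" for i
      using not_less_Least[OF that[unfolded j_def]] transU[of "act i x" "act j x" y] j by blast
    then show ?thesis using j by (auto simp: D_def)
  qed
  have F'_equiv: "equiv (space M) (F' k)" for k
  proof (rule equivI)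
    show "F' k \<subseteq> space M \<times> space M" using equiv_type[OF eqE] by (auto simp: F'_def)
    show "refl_on (space M) (F' k)"
    proof (rule refl_onI)
      fix x assume x: "x \<in> space M"
      have "(x, x) \<in> E" using eqE x by (auto simp: equiv_def refl_on_def)
      then show "(x, x) \<in> F' k"
        using D_unique reflF act_sp x unfolding F'_def by fastforce
    qed
    show "sym (F' k)"
      using symE symU symF unfolding F'_def sym_def by blast
    show "trans (F' k)"
    proof (rule transI)
      fix x y z assume xy: "(x, y) \<in> F' k" and yz: "(y, z) \<in> F' k"
      then have E: "(x, y) \<in> E" "(y, z) \<in> E" by (auto simp: F'_def)
      have "(act i x, act l z) \<in> F k" if il: "i \<in> D x" "l \<in> D z" "(act i x, act l z) \<in> U" for i l
      proof -
        \<comment> \<open>The representatives seen from \<open>x\<close> and from \<open>z\<close>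
          are compared through the one seen from \<open>y\<close> in the same class of
          \<open>U\<close>.\<close>
        have "(y, act i x) \<in> E" using E act(3)[of x i] symE transE spE by blast
        then obtain j where j: "j \<in> D y" "(act j y, act i x) \<in> U" using D_meets by blast
        then have "(act i x, act j y) \<in> F k" using xy il symU unfolding F'_def by blast
        moreover have "(act j y, act l z) \<in> F k"
          using yz j il transU unfolding F'_def by blast
        ultimately show ?thesis using transF by blast
      qed
      then show "(x, z) \<in> F' k" using E transE unfolding F'_def by blast
    qed
  qed
  have F'_borel: "borel_equivalence M (F' k)" for k
  proof (rule borel_equivalenceI[OF F'_equiv])
    let ?P = "M \<Otimes>\<^sub>M M"
    have [measurable]: "\<And>j. act j \<in> measurable M M" by fact
    have [measurable]: "E \<in> sets ?P" "\<And>k. F k \<in> sets ?P"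
      using E F(1) by (auto simp: borel_equivalence_def)
    have [measurable]: "U \<in> sets ?P" by (simp add: U_def)
    have D: "Measurable.pred M (\<lambda>x. j \<in> D x)" for j
      unfolding D_def by measurable
    have [measurable]: "Measurable.pred ?P (\<lambda>p. j \<in> D (fst p))" "Measurable.pred ?P (\<lambda>p. j \<in> D (snd p))" for j
      by (rule measurable_compose[OF _ D], measurable)+
    have "Measurable.pred ?P (\<lambda>p. p \<in> E \<and> (\<forall>i j. i \<in> D (fst p) \<and> j \<in> D (snd p) \<and>
        (act i (fst p), act j (snd p)) \<in> U \<longrightarrow> (act i (fst p), act j (snd p)) \<in> F k))"
      by measurable
    also have "(\<lambda>p. p \<in> E \<and> (\<forall>i j. i \<in> D (fst p) \<and> j \<in> D (snd p) \<and>
        (act i (fst p), act j (snd p)) \<in> U \<longrightarrow> (act i (fst p), act j (snd p)) \<in> F k)) = (\<lambda>p. p \<in> F' k)"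
      by (auto simp: F'_def fun_eq_iff)
    finally show "Measurable.pred ?P (\<lambda>p. p \<in> F' k)" .
  qed
  have F'_finite: "finite (F' k `` {x})" if x: "x \<in> space M" for k x
  proof -
    have "y \<in> (\<Union>j\<in>D x. F k `` {act j x})" if y: "(x, y) \<in> F' k" for y
    proof -
      have xy: "(x, y) \<in> E" using y by (simp add: F'_def)
      then obtain j where j: "j \<in> D x" "(act j x, y) \<in> U" using D_meets by blast
      \<comment> \<open>Index 0 always belongs to \<open>D y\<close>: every point represents its own
        class, so the condition in \<open>F'\<close> applies to \<open>y\<close> itself.\<close>
      moreover have "act 0 y = y" using act(2) spE[OF xy] by simp
      ultimately have "(act j x, y) \<in> F k" using y D0[of y] by (force simp: F'_def)
      with j show ?thesis by auto
    qed
    then have "F' k `` {x} \<subseteq> (\<Union>j\<in>D x. F k `` {act j x})" by blast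
    moreover have "finite \<dots>" using finD x F(2) act_sp by auto
    ultimately show ?thesis by (rule finite_subset)
  qed
  have F'_mono: "F' k \<subseteq> F' (Suc k)" for k
    using F(3)[of k] unfolding F'_def by blast
  have F'_union: "E = (\<Union>k. F' k)"
  proof
    show "(\<Union>k. F' k) \<subseteq> E" by (auto simp: F'_def)
    show "E \<subseteq> (\<Union>k. F' k)"
    proof (rule subrelI)
      fix x y assume xy: "(x, y) \<in> E"
      define S where "S = {(i, j). i \<in> D x \<and> j \<in> D y \<and> (act i x, act j y) \<in> U}"
      have "S \<subseteq> D x \<times> D y" by (auto simp: S_def)
      then have finS: "finite S" using finD spE[OF xy] by (meson finite_SigmaI finite_subset)
      have "\<forall>p\<in>S. \<exists>k. (act (fst p) x, act (snd p) y) \<in> F k" by (auto simp: S_def U_def)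
      then obtain K where K: "\<And>p. p \<in> S \<Longrightarrow> (act (fst p) x, act (snd p) y) \<in> F (K p)" by metis
      define k where "k = Max (insert 0 (K ` S))"
      have "K p \<le> k" if "p \<in> S" for p using that finS by (simp add: k_def)
      then have "(act (fst p) x, act (snd p) y) \<in> F k" if "p \<in> S" for p
        using K[OF that] monoF that by blast
      then have "(x, y) \<in> F' k" using xy by (force simp: F'_def S_def)
      then show "(x, y) \<in> (\<Union>k. F' k)" by blast
    qed
  qed
  show ?thesis
    unfolding hyperfinite_def using E F'_borel F'_finite F'_mono F'_union by blast
qed

section \<open>Trees\<close>

definition tree_adj :: "'a ugraph \<Rightarrow> ('a \<times> 'a) set" where
  "tree_adj T = {(x, y). {x, y} \<in> uedges T}"

text \<open>The component of \<open>a\<close> after removal of the edge \<open>{a, b}\<close>, one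
  of the two halfspaces of that edge.\<close>

definition tree_side :: "'a ugraph \<Rightarrow> 'a \<Rightarrow> 'a \<Rightarrow> 'a set" where
  "tree_side T a b = {x. (a, x) \<in> {(x, y). {x, y} \<in> uedges T - {{a, b}}}\<^sup>*}"

text \<open>A walk that returns to a visited vertex is cut back to that visit. The last conclusion
  keeps the path among reachable points, which supplies the vertex condition of a cycle.\<close>

lemma rtrancl_simple_path:
  assumes "(a, b) \<in> R\<^sup>*"
  shows "\<exists>xs. xs \<noteq> [] \<and> hd xs = a \<and> last xs = b \<and> distinct xs \<and>
           successively (\<lambda>x y. (x, y) \<in> R) xs \<and> set xs \<subseteq> R\<^sup>* `` {a}"
  using assms
proof (induction rule: rtrancl_induct)
  case base
  then show ?case by (intro exI[of _ "[a]"]) auto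
next
  case (step y z)
  then obtain xs where xs: "xs \<noteq> []" "hd xs = a" "last xs = y" "distinct xs"
      "successively (\<lambda>x y. (x, y) \<in> R) xs" "set xs \<subseteq> R\<^sup>* `` {a}" by blast
  show ?case
  proof (cases "z \<in> set xs")
    case True
    then obtain ys zs where "xs = ys @ z # zs" by (auto simp: in_set_conv_decomp)
    moreover from this xs(5) have "successively (\<lambda>x y. (x, y) \<in> R) (ys @ [z])"
      using successively_append_iff[of _ "ys @ [z]" zs] by simp
    ultimately show ?thesis
      using xs by (intro exI[of _ "ys @ [z]"]) (cases ys; auto)
  next
    case False
    with xs step show ?thesis
      by (intro exI[of _ "xs @ [z]"]) (auto simp: successively_append_iff)
  qed
qed

lemma rel_ball_rtrancl:
  assumes "(v, w) \<in> A\<^sup>*"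
  shows "\<exists>k. w \<in> rel_ball A k v"
  using assms
proof (induction rule: rtrancl_induct)
  case base
  have "v \<in> rel_ball A 0 v" by simp
  then show ?case by blast
next
  case (step y z)
  then obtain k where "y \<in> rel_ball A k v" by blast
  with step(2) have "z \<in> rel_ball A (Suc k) v" by (auto simp: rel_ball_Suc)
  then show ?case by blast
qed

lemma rtrancl_sym:
  assumes "sym R" "(a, b) \<in> R\<^sup>*"
  shows "(b, a) \<in> R\<^sup>*"
  using sym_rtrancl[OF assms(1)] assms(2) by (auto simp: sym_def)

locale tree =
  fixes T :: "'a ugraph"
  assumes is_tree: "is_tree T"
begin

abbreviation adj where "adj \<equiv> tree_adj T"
abbreviation side where "side \<equiv> tree_side T"

lemma edge_verts: "{a, b} \<in> uedges T \<Longrightarrow> a \<in> uverts T \<and> b \<in> uverts T \<and> a \<noteq> b"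
  using is_tree by (auto simp: is_tree_def simple_ugraph_def dest!: bspec)

lemma edge_cases:
  assumes "e \<in> uedges T"
  obtains a b where "e = {a, b}" "a \<noteq> b" "a \<in> uverts T" "b \<in> uverts T"
  using assms is_tree by (auto simp: is_tree_def simple_ugraph_def card_2_iff dest!: bspec)

lemma adj_verts: "adj \<subseteq> uverts T \<times> uverts T"
  using edge_verts by (auto simp: tree_adj_def)

lemma adj_connected: "a \<in> uverts T \<Longrightarrow> b \<in> uverts T \<Longrightarrow> (a, b) \<in> adj\<^sup>*"
  using is_tree by (auto simp: is_tree_def connected_ugraph_def tree_adj_def)

lemma verts_nonempty: "uverts T \<noteq> {}"
  using is_tree by (auto simp: is_tree_def connected_ugraph_def)

lemma side_refl: "a \<in> side a b"
  by (simp add: tree_side_def)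

lemma side_step: "x \<in> side a b \<Longrightarrow> {x, y} \<in> uedges T \<Longrightarrow> {x, y} \<noteq> {a, b} \<Longrightarrow> y \<in> side a b"
  by (auto simp: tree_side_def intro: rtrancl_into_rtrancl)

lemma side_verts: "a \<in> uverts T \<Longrightarrow> side a b \<subseteq> uverts T"
proof
  fix x assume "x \<in> side a b" "a \<in> uverts T"
  then show "x \<in> uverts T"
    unfolding tree_side_def mem_Collect_eq
    by (induction rule: rtrancl_induct) (auto dest: edge_verts)
qed

lemma side_total:
  assumes "{a, b} \<in> uedges T" "x \<in> uverts T"
  shows "x \<in> side a b \<or> x \<in> side b a"
proof -
  have "(a, x) \<in> adj\<^sup>*" using assms edge_verts adj_connected by blast
  then show ?thesis
  proof (induction rule: rtrancl_induct)
    case (step y z)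
    show ?case
    proof (cases "{y, z} = {a, b}")
      case True
      then show ?thesis using side_refl[of a b] side_refl[of b a] by (auto simp: doubleton_eq_iff)
    next
      case False
      then show ?thesis using step side_step[of y _ _ z] by (auto simp: tree_adj_def insert_commute)
    qed
  qed (simp add: side_refl)
qed

text \<open>A simple path from \<open>a\<close> to \<open>b\<close> avoiding the edge would close up
  with it to a cycle. It has at least three vertices, as a path with two would be the edge
  itself.\<close>

lemma side_notin:
  assumes "{a, b} \<in> uedges T"
  shows "b \<notin> side a b"
proof
  let ?R = "{(x, y). {x, y} \<in> uedges T - {{a, b}}}"
  assume "b \<in> side a b"
  then obtain xs where xs: "xs \<noteq> []" "hd xs = a" "last xs = b" "distinct xs"
      "successively (\<lambda>x y. (x, y) \<in> ?R) xs" "set xs \<subseteq> ?R\<^sup>* `` {a}"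
    using rtrancl_simple_path[of a b ?R] by (auto simp: tree_side_def)
  have ab: "a \<noteq> b" "a \<in> uverts T" using edge_verts[OF assms] by auto
  have "length xs \<noteq> 1" using xs ab by (auto simp: length_Suc_conv)
  moreover have "length xs \<noteq> 2" using xs by (auto simp: length_Suc_conv numeral_2_eq_2)
  moreover have "length xs \<noteq> 0" using xs(1) by simp
  ultimately have "length xs \<ge> 3" by linarith
  moreover have "set xs \<subseteq> uverts T"
    using xs(6) side_verts[OF ab(2), of b] by (auto simp: tree_side_def)
  moreover have "successively (\<lambda>u v. {u, v} \<in> uedges T) xs"
    using xs(5) by (rule successively_mono) auto
  ultimately have "is_cycle T xs"
    using xs assms by (simp add: is_cycle_def insert_commute)
  then show False using is_tree by (auto simp: is_tree_def)
qed

lemma side_sym: "x \<in> side a b \<Longrightarrow> (x, a) \<in> {(x, y). {x, y} \<in> uedges T - {{a, b}}}\<^sup>*"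
  unfolding tree_side_def mem_Collect_eq
  by (rule rtrancl_sym) (auto simp: sym_def insert_commute)

lemma side_disjoint:
  assumes "{a, b} \<in> uedges T"
  shows "side a b \<inter> side b a = {}"
proof -
  have False if "x \<in> side a b" "x \<in> side b a" for x
  proof -
    have "(b, x) \<in> {(x, y). {x, y} \<in> uedges T - {{a, b}}}\<^sup>*"
      using that(2) by (simp add: tree_side_def insert_commute)
    with side_sym[OF that(1)] have "(b, a) \<in> {(x, y). {x, y} \<in> uedges T - {{a, b}}}\<^sup>*"
      by (rule rtrancl_trans[rotated])
    then have "a \<in> side b a" by (simp add: tree_side_def insert_commute)
    with side_notin[of b a] assms show False by (simp add: insert_commute)
  qed
  then show ?thesis by blast
qed

lemma side_connected:
  assumes "x \<in> side a b" "y \<in> side a b"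
  shows "(x, y) \<in> {(x, y). {x, y} \<in> uedges T - {{a, b}}}\<^sup>*"
  using side_sym[OF assms(1)] assms(2) unfolding tree_side_def mem_Collect_eq by (rule rtrancl_trans)

text \<open>The branch behind \<open>b\<close> does not contain \<open>a\<close>, so none of its
  edges is \<open>{a, c}\<close>. It is reached from \<open>a\<close> without that edge and hence
  lies opposite to the branch behind \<open>c\<close>.\<close>

lemma side_disjoint_branches:
  assumes "{a, b} \<in> uedges T" "{a, c} \<in> uedges T" "b \<noteq> c"
  shows "side b a \<inter> side c a = {}"
proof -
  have "x \<in> side a c" if "x \<in> side b a" for x
  proof -
    have "(b, x) \<in> {(x, y). {x, y} \<in> uedges T - {{b, a}}}\<^sup>*"
      using that by (simp add: tree_side_def)
    then show ?thesis
    proof (induction rule: rtrancl_induct)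
      case base
      have "{a, b} \<noteq> {a, c}" using assms edge_verts by (auto simp: doubleton_eq_iff)
      then show ?case using side_step[OF side_refl assms(1)] by blast
    next
      case (step y z)
      have "z \<in> side b a" "y \<in> side b a"
        using step(1,2) by (auto simp: tree_side_def intro: rtrancl_into_rtrancl)
      moreover have "a \<notin> side b a" using side_notin[of b a] assms(1) by (simp add: insert_commute)
      ultimately have "{y, z} \<noteq> {a, c}" by (auto simp: doubleton_eq_iff)
      then show ?case using step side_step by blast
    qed
  qed
  then show ?thesis using side_disjoint[OF assms(2)] by blast
qed

end

locale ulf_tree = tree +
  assumes ulf: "uniformly_locally_finite T"
begin

definition valency_bound :: nat where
  "valency_bound = (SOME m. \<forall>v. finite (adj `` {v}) \<and> card (adj `` {v}) \<le> m)"

lemma finite_adj: "finite (adj `` {v})"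
  and card_adj: "card (adj `` {v}) \<le> valency_bound"
proof -
  obtain m where m: "\<And>v. v \<in> uverts T \<Longrightarrow> finite {e \<in> uedges T. v \<in> e} \<and> card {e \<in> uedges T. v \<in> e} \<le> m"
    using ulf by (auto simp: uniformly_locally_finite_def)
  have "finite (adj `` {v}) \<and> card (adj `` {v}) \<le> m" for v
  proof (cases "v \<in> uverts T")
    case True
    have inj: "inj_on (\<lambda>w. {v, w}) (adj `` {v})" by (auto simp: inj_on_def doubleton_eq_iff)
    have sub: "(\<lambda>w. {v, w}) ` (adj `` {v}) \<subseteq> {e \<in> uedges T. v \<in> e}" by (auto simp: tree_adj_def)
    show ?thesis
      using m[OF True] inj_on_finite[OF inj sub] card_inj_on_le[OF inj sub] by auto
  next
    case False
    then have "adj `` {v} = {}" using adj_verts by auto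
    then show ?thesis by simp
  qed
  then have "\<exists>m. \<forall>v. finite (adj `` {v}) \<and> card (adj `` {v}) \<le> m" by blast
  then have "\<forall>v. finite (adj `` {v}) \<and> card (adj `` {v}) \<le> valency_bound"
    unfolding valency_bound_def by (rule someI_ex)
  then show "finite (adj `` {v})" "card (adj `` {v}) \<le> valency_bound" by auto
qed

lemma verts_eq_balls:
  assumes "v \<in> uverts T"
  shows "uverts T = (\<Union>k. rel_ball adj k v)"
proof
  show "(\<Union>k. rel_ball adj k v) \<subseteq> uverts T" using rel_ball_subset[OF adj_verts assms] by blast
  show "uverts T \<subseteq> (\<Union>k. rel_ball adj k v)"
  proof
    fix w assume "w \<in> uverts T"
    then show "w \<in> (\<Union>k. rel_ball adj k v)"
      using rel_ball_rtrancl[OF adj_connected[OF assms]] by blast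
  qed
qed

lemma finite_adj_ball: "finite (rel_ball adj k v)"
  using finite_card_rel_ball[of adj valency_bound k v] finite_adj card_adj by blast

lemma countable_verts: "countable (uverts T)"
proof -
  obtain v where "v \<in> uverts T" using verts_nonempty by blast
  then show ?thesis using verts_eq_balls finite_adj_ball by (metis countable_UN countable_finite countableI_type)
qed

end

section \<open>A lower bound for the metric of a tree\<close>

definition vertex_point :: "'a \<Rightarrow> 'a \<Rightarrow> real" where
  "vertex_point v = (\<lambda>w. if w = v then 1 else 0)"

lemma cell_dist_nonneg: "0 \<le> cell_dist p q"
  by (simp add: cell_dist_def sum_nonneg)

lemma chain_length_nonneg: "0 \<le> chain_length ps"
  by (simp add: chain_length_def sum_nonneg cell_dist_nonneg)

lemma vertex_point_mem_cell: "finite c \<Longrightarrow> vertex_point v \<in> cell_points c \<longleftrightarrow> v \<in> c"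
  by (auto simp: cell_points_def vertex_point_def)

lemma cell_points_single: "cell_points {v} = {vertex_point v}"
  by (auto simp: cell_points_def vertex_point_def)

context tree
begin

lemma cells_finite: "c \<in> tree_cells T \<Longrightarrow> finite c"
  by (auto simp: tree_cells_def elim: edge_cases)

definition level :: "'a \<Rightarrow> 'a \<Rightarrow> nat" where
  "level v w = (LEAST k. w \<in> rel_ball adj k v)"

text \<open>The combinatorial distance from \<open>v\<close>, extended affinely over the cells. It
  is 1-Lipschitz on each cell, so its increase along a chain bounds the length of the chain from
  below.\<close>

definition height :: "'a \<Rightarrow> ('a \<Rightarrow> real) \<Rightarrow> real" where
  "height v p = (\<Sum>w | p w \<noteq> 0. p w * level v w)"

lemma height_cell:
  assumes "finite c" "p \<in> cell_points c"
  shows "height v p = (\<Sum>w\<in>c. p w * level v w)"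
  unfolding height_def using assms by (intro sum.mono_neutral_left) (auto simp: cell_points_def)

lemma level_edge:
  assumes "v \<in> uverts T" "{a, b} \<in> uedges T"
  shows "level v b \<le> level v a + 1"
proof -
  have "(v, a) \<in> adj\<^sup>*" using assms edge_verts adj_connected by blast
  then have "\<exists>k. a \<in> rel_ball adj k v" by (rule rel_ball_rtrancl)
  then have "a \<in> rel_ball adj (level v a) v" unfolding level_def by (rule LeastI_ex)
  then have "b \<in> rel_ball adj (Suc (level v a)) v"
    using assms(2) by (auto simp: rel_ball_Suc tree_adj_def)
  then show ?thesis unfolding level_def[of v b] by (simp add: Least_le)
qed

lemma height_lipschitz:
  assumes v: "v \<in> uverts T" and c: "c \<in> tree_cells T" and p: "p \<in> cell_points c" and q: "q \<in> cell_points c"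
  shows "height v q - height v p \<le> cell_dist p q"
proof -
  have fin: "finite c" by (rule cells_finite[OF c])
  have dist: "cell_dist p q = (\<Sum>w\<in>c. \<bar>p w - q w\<bar>) / 2"
    unfolding cell_dist_def using fin p q
    by (intro arg_cong[where f = "\<lambda>x. x / 2"] sum.mono_neutral_left) (auto simp: cell_points_def)
  from c consider w where "c = {w}" | "c \<in> uedges T" by (auto simp: tree_cells_def)
  then show ?thesis
  proof cases
    case 1
    with p q have "p = q" by (simp add: cell_points_single)
    then show ?thesis by (simp add: cell_dist_nonneg)
  next
    case 2
    then obtain a b where ab: "c = {a, b}" "a \<noteq> b" by (rule edge_cases)
    have pq: "p b = 1 - p a" "q b = 1 - q a" using p q ab by (auto simp: cell_points_def)
    have "height v r = r a * level v a + r b * level v b" if "r \<in> cell_points c" for r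
      using height_cell[OF fin that] ab by simp
    note h = this[OF p] this[OF q]
    \<comment> \<open>On an edge the height is affine, and its slope is the difference of the two
      levels, at most 1 in absolute value.\<close>
    have "height v q - height v p = (q a - p a) * (real (level v a) - real (level v b))"
      unfolding h pq by (simp add: algebra_simps)
    also have "\<dots> \<le> \<bar>q a - p a\<bar> * \<bar>real (level v a) - real (level v b)\<bar>"
      by (metis abs_ge_self abs_mult)
    also have "\<dots> \<le> \<bar>q a - p a\<bar> * 1"
      using level_edge[OF v, of a b] level_edge[OF v, of b a] 2 ab
      by (intro mult_left_mono) (auto simp: insert_commute)
    also have "\<dots> = cell_dist p q" unfolding dist using ab pq by simp
    finally show ?thesis .
  qed
qed

lemma height_le_chain_length:
  assumes v: "v \<in> uverts T" and ch: "tree_chain T p q ps"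
  shows "height v q - height v p \<le> chain_length ps"
proof -
  have ps: "ps \<noteq> []" "hd ps = p" "last ps = q"
      "successively (\<lambda>r s. \<exists>c\<in>tree_cells T. r \<in> cell_points c \<and> s \<in> cell_points c) ps"
    using ch by (auto simp: tree_chain_def)
  have "height v q - height v p = height v (ps ! (length ps - 1)) - height v (ps ! 0)"
    using ps by (simp add: hd_conv_nth last_conv_nth)
  also have "\<dots> = (\<Sum>i<length ps - 1. height v (ps ! Suc i) - height v (ps ! i))"
    by (rule sum_lessThan_telescope[symmetric])
  also have "\<dots> \<le> chain_length ps"
    unfolding chain_length_def
  proof (rule sum_mono)
    fix i assume "i \<in> {..<length ps - 1}"
    then have "Suc i < length ps" by simp
    then obtain c where "c \<in> tree_cells T" "ps ! i \<in> cell_points c" "ps ! Suc i \<in> cell_points c"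
      using ps(4) by (auto simp: successively_conv_nth)
    then show "height v (ps ! Suc i) - height v (ps ! i) \<le> cell_dist (ps ! i) (ps ! Suc i)"
      by (rule height_lipschitz[OF v])
  qed
  finally show ?thesis .
qed

lemma ex_tree_chain:
  assumes "v \<in> uverts T" "w \<in> uverts T"
  shows "\<exists>ps. tree_chain T (vertex_point v) (vertex_point w) ps"
proof -
  obtain xs where xs: "xs \<noteq> []" "hd xs = v" "last xs = w" "successively (\<lambda>x y. (x, y) \<in> adj) xs"
    using rtrancl_simple_path[OF adj_connected[OF assms]] by blast
  have "\<exists>c\<in>tree_cells T. vertex_point x \<in> cell_points c \<and> vertex_point y \<in> cell_points c"
    if "(x, y) \<in> adj" for x y
    using that by (intro bexI[of _ "{x, y}"])
      (auto simp: tree_adj_def tree_cells_def vertex_point_mem_cell)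
  then have "successively (\<lambda>x y. \<exists>c\<in>tree_cells T. vertex_point x \<in> cell_points c \<and>
      vertex_point y \<in> cell_points c) xs"
    using xs(4) by (auto elim: successively_mono)
  with xs show ?thesis
    by (intro exI[of _ "map vertex_point xs"])
      (auto simp: tree_chain_def successively_map hd_map last_map)
qed

lemma tree_dist_ge:
  assumes "v \<in> uverts T" "w \<in> uverts T"
  shows "real (level v w) \<le> tree_dist T (vertex_point v) (vertex_point w)"
  unfolding tree_dist_def
proof (rule cInf_greatest)
  show "{chain_length ps |ps. tree_chain T (vertex_point v) (vertex_point w) ps} \<noteq> {}"
    using ex_tree_chain[OF assms] by blast
  fix x assume "x \<in> {chain_length ps |ps. tree_chain T (vertex_point v) (vertex_point w) ps}"
  then obtain ps where ps: "x = chain_length ps" "tree_chain T (vertex_point v) (vertex_point w) ps"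
    by blast
  have height: "height v (vertex_point u) = level v u" for u
    using height_cell[of "{u}" "vertex_point u" v] by (simp add: cell_points_single vertex_point_def)
  have "level v v = 0" unfolding level_def by (rule Least_eq_0) simp
  then show "real (level v w) \<le> x"
    using height_le_chain_length[OF assms(1) ps(2)] ps(1) by (simp add: height)
qed

lemma tree_dist_refl:
  assumes "v \<in> uverts T"
  shows "tree_dist T (vertex_point v) (vertex_point v) = 0"
proof (rule antisym)
  have "tree_chain T (vertex_point v) (vertex_point v) [vertex_point v]"
    by (simp add: tree_chain_def)
  moreover have "chain_length [vertex_point v] = 0" by (simp add: chain_length_def)
  ultimately show "tree_dist T (vertex_point v) (vertex_point v) \<le> 0"
    unfolding tree_dist_def using chain_length_nonneg
    by (intro cInf_lower bdd_belowI[of _ 0]) (force, blast)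
  show "0 \<le> tree_dist T (vertex_point v) (vertex_point v)"
    using tree_dist_ge[OF assms assms] by simp
qed

end

lemma (in ulf_tree) ex_far_vertex:
  assumes "infinite (uverts T)" "v \<in> uverts T"
  shows "\<exists>w\<in>uverts T. real R \<le> tree_dist T (vertex_point v) (vertex_point w)"
proof -
  obtain w where w: "w \<in> uverts T" "w \<notin> rel_ball adj R v"
    using assms(1) finite_adj_ball[of R v] by (meson finite_subset subsetI)
  have "\<exists>k. w \<in> rel_ball adj k v" using w verts_eq_balls[OF assms(2)] by blast
  then have "w \<in> rel_ball adj (level v w) v" unfolding level_def by (rule LeastI_ex)
  then have "R \<le> level v w"
    using w(2) rel_ball_mono[of "level v w" R adj v] by (meson linear subsetD)
  then show ?thesis using tree_dist_ge[OF assms(2) w(1)] w(1) by (intro bexI[of _ w]) auto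
qed

section \<open>Cubes, edges and squares of a product of trees\<close>

locale trees =
  fixes n :: nat and T :: "nat \<Rightarrow> 'a ugraph"
  assumes ulf_trees: "i < n \<Longrightarrow> ulf_tree (T i)"
begin

lemma trees: "i < n \<Longrightarrow> tree (T i)"
  using ulf_trees by (auto simp: ulf_tree_def)

abbreviation V where "V \<equiv> vertices n T"

definition coords :: "(nat \<Rightarrow> 'a) set" where
  "coords = (\<Pi>\<^sub>E i\<in>{..<n}. uverts (T i))"

definition vt :: "(nat \<Rightarrow> 'a) \<Rightarrow> 'a prod_point" where
  "vt c = (\<lambda>i\<in>{..<n}. vertex_point (c i))"

lemma vertex_point_inject: "vertex_point v = vertex_point w \<longleftrightarrow> v = w"
  by (auto simp: vertex_point_def fun_eq_iff split: if_splits)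

lemma vt_inject: "c \<in> coords \<Longrightarrow> c' \<in> coords \<Longrightarrow> vt c = vt c' \<longleftrightarrow> c = c'"
proof
  assume c: "c \<in> coords" "c' \<in> coords" "vt c = vt c'"
  show "c = c'"
  proof (rule PiE_ext)
    fix i assume "i \<in> {..<n}"
    then show "c i = c' i" using fun_cong[OF c(3), of i] by (simp add: vt_def vertex_point_inject)
  qed (use c in \<open>auto simp: coords_def\<close>)
qed simp

lemma inj_on_vt: "inj_on vt coords"
  using vt_inject by (auto simp: inj_on_def)

lemma coords_upd: "c \<in> coords \<Longrightarrow> i < n \<Longrightarrow> b \<in> uverts (T i) \<Longrightarrow> c(i := b) \<in> coords"
  by (auto simp: coords_def PiE_def extensional_def)

lemma coords_upd_edge: "c \<in> coords \<Longrightarrow> i < n \<Longrightarrow> {a, b} \<in> uedges (T i) \<Longrightarrow> c(i := b) \<in> coords"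
  using coords_upd tree.edge_verts[OF trees] by blast

lemma coords_mem: "c \<in> coords \<Longrightarrow> i < n \<Longrightarrow> c i \<in> uverts (T i)"
  by (auto simp: coords_def)

lemma coords_ext: "c \<in> coords \<Longrightarrow> c \<in> extensional {..<n}"
  by (simp add: coords_def PiE_iff)

lemma single_not_edge: "i < n \<Longrightarrow> {v} \<notin> uedges (T i)"
  using tree.edge_verts[OF trees, of i v v] by auto

lemma cell_subset: "i < n \<Longrightarrow> s \<in> tree_cells (T i) \<Longrightarrow> s \<subseteq> uverts (T i) \<and> s \<noteq> {} \<and> finite s"
  by (auto simp: tree_cells_def elim: tree.edge_cases[OF trees])

lemma cell_cases: "s \<in> tree_cells (T i) \<Longrightarrow> s \<notin> uedges (T i) \<Longrightarrow> \<exists>v. v \<in> uverts (T i) \<and> s = {v}"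
  by (auto simp: tree_cells_def)

lemma cube_memI:
  assumes "\<And>i. i < n \<Longrightarrow> \<sigma> i \<in> tree_cells (T i)" "{i. i < n \<and> \<sigma> i \<in> uedges (T i)} = I"
  shows "(\<Pi>\<^sub>E i\<in>{..<n}. cell_points (\<sigma> i)) \<in> cubes_of_dim n T (card I)"
  unfolding cubes_of_dim_def using assms by blast

lemma vertices_eq: "V = vt ` coords"
proof
  show "V \<subseteq> vt ` coords"
  proof
    fix x assume "x \<in> V"
    then obtain \<sigma> where s: "x \<in> (\<Pi>\<^sub>E i\<in>{..<n}. cell_points (\<sigma> i))"
        "\<And>i. i < n \<Longrightarrow> \<sigma> i \<in> tree_cells (T i)" "card {i. i < n \<and> \<sigma> i \<in> uedges (T i)} = 0"
      by (auto simp: vertices_def cubes_of_dim_def)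
    then have "\<And>i. i < n \<Longrightarrow> \<sigma> i \<notin> uedges (T i)" by (auto simp: card_eq_0_iff)
    with s(2) have "\<forall>i\<in>{..<n}. \<exists>v. v \<in> uverts (T i) \<and> \<sigma> i = {v}" by (fastforce simp: tree_cells_def)
    then obtain v where v: "\<And>i. i < n \<Longrightarrow> v i \<in> uverts (T i) \<and> \<sigma> i = {v i}" by (metis lessThan_iff)
    have "x = vt (restrict v {..<n})"
    proof
      fix i show "x i = vt (restrict v {..<n}) i"
        using s(1) v[of i] by (cases "i < n") (auto simp: vt_def PiE_def Pi_def extensional_def cell_points_single)
    qed
    then show "x \<in> vt ` coords" using v by (auto simp: coords_def)
  qed
  show "vt ` coords \<subseteq> V"
  proof safe
    fix c assume c: "c \<in> coords"
    have "vt c \<in> (\<Pi>\<^sub>E i\<in>{..<n}. cell_points {c i})" by (auto simp: vt_def cell_points_single)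
    moreover have "(\<Pi>\<^sub>E i\<in>{..<n}. cell_points {c i}) \<in> cubes_of_dim n T 0"
      using cube_memI[of "\<lambda>i. {c i}" "{}"] c single_not_edge coords_mem by (simp add: tree_cells_def)
    ultimately show "vt c \<in> V" unfolding vertices_def by blast
  qed
qed

lemma cube_coords:
  assumes "\<And>i. i < n \<Longrightarrow> \<sigma> i \<in> tree_cells (T i)"
  shows "(\<Pi>\<^sub>E i\<in>{..<n}. \<sigma> i) \<subseteq> coords"
  unfolding coords_def using cell_subset[OF _ assms] by (intro PiE_mono) simp

lemma cube_inter_vertices:
  assumes "\<And>i. i < n \<Longrightarrow> \<sigma> i \<in> tree_cells (T i)"
  shows "(\<Pi>\<^sub>E i\<in>{..<n}. cell_points (\<sigma> i)) \<inter> V = vt ` (\<Pi>\<^sub>E i\<in>{..<n}. \<sigma> i)"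
proof -
  have "vt c \<in> (\<Pi>\<^sub>E i\<in>{..<n}. cell_points (\<sigma> i)) \<longleftrightarrow> c \<in> (\<Pi>\<^sub>E i\<in>{..<n}. \<sigma> i)" if "c \<in> coords" for c
  proof -
    have "vt c \<in> (\<Pi>\<^sub>E i\<in>{..<n}. cell_points (\<sigma> i)) \<longleftrightarrow> (\<forall>i<n. vertex_point (c i) \<in> cell_points (\<sigma> i))"
      by (auto simp: vt_def PiE_iff)
    also have "\<dots> \<longleftrightarrow> (\<forall>i<n. c i \<in> \<sigma> i)"
      using cell_subset[OF _ assms] by (simp add: vertex_point_mem_cell)
    also have "\<dots> \<longleftrightarrow> c \<in> (\<Pi>\<^sub>E i\<in>{..<n}. \<sigma> i)" using that by (auto simp: coords_def PiE_iff)
    finally show ?thesis .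
  qed
  moreover have "(\<Pi>\<^sub>E i\<in>{..<n}. \<sigma> i) \<subseteq> coords"
    by (rule cube_coords) (rule assms)
  ultimately show ?thesis unfolding vertices_eq by blast
qed

text \<open>Each edge factor contributes two vertices and each vertex factor one. The count reads
  off the dimension of a cube from its vertices, so that automorphisms will preserve it.\<close>

lemma cube_vertices_card:
  assumes "C \<in> cubes_of_dim n T k"
  shows "finite (C \<inter> V) \<and> card (C \<inter> V) = 2 ^ k"
proof -
  obtain \<sigma> where s: "C = (\<Pi>\<^sub>E i\<in>{..<n}. cell_points (\<sigma> i))"
      "\<And>i. i < n \<Longrightarrow> \<sigma> i \<in> tree_cells (T i)" "card {i. i < n \<and> \<sigma> i \<in> uedges (T i)} = k"
    using assms by (auto simp: cubes_of_dim_def)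
  have sub: "(\<Pi>\<^sub>E i\<in>{..<n}. \<sigma> i) \<subseteq> coords"
    by (rule cube_coords) (rule s(2))
  have "card (\<sigma> i) = (if \<sigma> i \<in> uedges (T i) then 2 else 1)" if "i < n" for i
  proof (cases "\<sigma> i \<in> uedges (T i)")
    case True
    then show ?thesis using tree.edge_cases[OF trees[OF that] True] by (metis card_2_iff)
  next
    case False
    then show ?thesis using s(2)[OF that] by (auto simp: tree_cells_def)
  qed
  then have "card (\<Pi>\<^sub>E i\<in>{..<n}. \<sigma> i) = (\<Prod>i<n. if \<sigma> i \<in> uedges (T i) then 2 else 1)"
    by (simp add: card_PiE)
  also have "\<dots> = 2 ^ card {i \<in> {..<n}. \<sigma> i \<in> uedges (T i)}"
    by (simp add: prod.If_cases Int_def)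
  also have "{i \<in> {..<n}. \<sigma> i \<in> uedges (T i)} = {i. i < n \<and> \<sigma> i \<in> uedges (T i)}" by auto
  finally have "card (\<Pi>\<^sub>E i\<in>{..<n}. \<sigma> i) = 2 ^ k" using s(3) by simp
  moreover have "finite (\<Pi>\<^sub>E i\<in>{..<n}. \<sigma> i)" using cell_subset[OF _ s(2)] by (intro finite_PiE) simp_all
  ultimately show ?thesis
    using inj_on_vt sub cube_inter_vertices[of \<sigma>] s(1,2)
    by (auto simp: card_image inj_on_subset)
qed

lemma edges_subset: "e \<in> edges n T \<Longrightarrow> e \<subseteq> V"
  by (auto simp: edges_def)

section \<open>Coordinates for the vertex sets of edges and squares\<close>

lemma box_eq:
  assumes "c \<in> extensional {..<n}" "I \<subseteq> {..<n}"
  shows "(\<Pi>\<^sub>E i\<in>{..<n}. if i \<in> I then {c i, b i} else {c i}) = override_on c b ` Pow I" (is "?L = ?R")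
proof
  show "?L \<subseteq> ?R"
  proof
    fix x assume x: "x \<in> ?L"
    have "x i = override_on c b {i \<in> I. x i = b i} i" for i
    proof (cases "i < n")
      case True
      then have "x i \<in> (if i \<in> I then {c i, b i} else {c i})" using PiE_mem[OF x] by simp
      then show ?thesis by (auto simp: override_on_def split: if_splits)
    next
      case False
      then have "x i = c i" "i \<notin> I" using PiE_arb[OF x] assms by (auto simp: extensional_def)
      then show ?thesis by (simp add: override_on_def)
    qed
    then have "x = override_on c b {i \<in> I. x i = b i}" by (rule ext)
    then show "x \<in> ?R" by (rule image_eqI) blast
  qed
  show "?R \<subseteq> ?L"
  proof (rule image_subsetI)
    fix A assume "A \<in> Pow I"
    then show "override_on c b A \<in> ?L"
      using assms by (intro PiE_I) (auto simp: override_on_def extensional_def)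
  qed
qed

text \<open>A cube is given by a corner \<open>c\<close>, the set \<open>I\<close> of its edge
  directions and the values \<open>b\<close> of the opposite corner; a vertex switches from
  \<open>c\<close> to \<open>b\<close> on some subset of \<open>I\<close>. For \<open>k = 1\<close>
  and \<open>k = 2\<close> this yields explicit edges and squares.\<close>

lemma cube_vertices_iff:
  "(\<exists>C\<in>cubes_of_dim n T k. S = C \<inter> V) \<longleftrightarrow>
     (\<exists>c b I. c \<in> coords \<and> I \<subseteq> {..<n} \<and> card I = k \<and> (\<forall>i\<in>I. {c i, b i} \<in> uedges (T i)) \<and>
        S = vt ` override_on c b ` Pow I)"
proof (intro iffI; elim bexE exE conjE)
  fix C assume C: "C \<in> cubes_of_dim n T k" "S = C \<inter> V"
  then obtain \<sigma> where s: "C = (\<Pi>\<^sub>E i\<in>{..<n}. cell_points (\<sigma> i))"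
      "\<And>i. i < n \<Longrightarrow> \<sigma> i \<in> tree_cells (T i)" "card {i. i < n \<and> \<sigma> i \<in> uedges (T i)} = k"
    by (auto simp: cubes_of_dim_def)
  define I where "I = {i. i < n \<and> \<sigma> i \<in> uedges (T i)}"
  have "\<exists>a b. a \<in> uverts (T i) \<and> \<sigma> i = (if i \<in> I then {a, b} else {a})" if i: "i < n" for i
  proof (cases "\<sigma> i \<in> uedges (T i)")
    case True
    then obtain a b where "\<sigma> i = {a, b}" "a \<noteq> b" "a \<in> uverts (T i)" "b \<in> uverts (T i)"
      by (rule tree.edge_cases[OF trees[OF i]])
    then show ?thesis using True i by (intro exI[of _ a] exI[of _ b]) (simp add: I_def)
  next
    case False
    with cell_cases[OF s(2)[OF i]] show ?thesis by (auto simp: I_def)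
  qed
  then obtain a b where ab: "\<And>i. i < n \<Longrightarrow> a i \<in> uverts (T i) \<and> \<sigma> i = (if i \<in> I then {a i, b i} else {a i})"
    by metis
  define c where "c = restrict a {..<n}"
  have c: "c \<in> coords" using ab by (auto simp: c_def coords_def)
  have eq: "\<sigma> i = (if i \<in> I then {c i, b i} else {c i})" if "i < n" for i
    using ab[OF that] that by (simp add: c_def)
  have I: "I \<subseteq> {..<n}" by (auto simp: I_def)
  have I': "\<forall>i\<in>I. {c i, b i} \<in> uedges (T i)"
  proof
    fix i assume "i \<in> I"
    then show "{c i, b i} \<in> uedges (T i)" using eq[of i] by (simp add: I_def)
  qed
  have "(\<Pi>\<^sub>E i\<in>{..<n}. \<sigma> i) = (\<Pi>\<^sub>E i\<in>{..<n}. if i \<in> I then {c i, b i} else {c i})"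
    using eq by (intro PiE_cong) simp
  then have "S = vt ` override_on c b ` Pow I"
    using C(2) s(1) cube_inter_vertices[OF s(2)] box_eq[OF coords_ext[OF c] I] by simp
  with c I I' s(3) show "\<exists>c b I. c \<in> coords \<and> I \<subseteq> {..<n} \<and> card I = k \<and>
      (\<forall>i\<in>I. {c i, b i} \<in> uedges (T i)) \<and> S = vt ` override_on c b ` Pow I"
    unfolding I_def by blast
next
  fix c b I assume c: "c \<in> coords" "I \<subseteq> {..<n}" "card I = k" "\<forall>i\<in>I. {c i, b i} \<in> uedges (T i)"
    and S: "S = vt ` override_on c b ` Pow I"
  define \<sigma> where "\<sigma> i = (if i \<in> I then {c i, b i} else {c i})" for i
  have s: "\<sigma> i \<in> tree_cells (T i)" if "i < n" for i
    using c(4) coords_mem[OF c(1) that] by (simp add: \<sigma>_def tree_cells_def)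
  have "{i. i < n \<and> \<sigma> i \<in> uedges (T i)} = I"
    using c(2,4) single_not_edge by (auto simp: \<sigma>_def split: if_splits)
  from cube_memI[OF s this] have "(\<Pi>\<^sub>E i\<in>{..<n}. cell_points (\<sigma> i)) \<in> cubes_of_dim n T k"
    using c(3) by simp
  moreover have "S = (\<Pi>\<^sub>E i\<in>{..<n}. cell_points (\<sigma> i)) \<inter> V"
    using S box_eq[OF coords_ext[OF c(1)] c(2), of b] cube_inter_vertices[OF s] by (simp add: \<sigma>_def)
  ultimately show "\<exists>C\<in>cubes_of_dim n T k. S = C \<inter> V" by blast
qed

lemma override_on_singleton: "override_on c b {i} = c(i := b i)"
  by (auto simp: override_on_def)

lemma edge_iff:
  "e \<in> edges n T \<longleftrightarrow> (\<exists>c i b. c \<in> coords \<and> i < n \<and> {c i, b} \<in> uedges (T i) \<and> e = {vt c, vt (c(i := b))})"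
  (is "_ \<longleftrightarrow> ?R")
proof
  have box: "override_on c b ` Pow {i} = {c, c(i := b i)}" for c b :: "nat \<Rightarrow> 'a" and i
    by (simp add: Pow_insert override_on_singleton insert_commute)
  {
    assume "e \<in> edges n T"
    then have "\<exists>C\<in>cubes_of_dim n T 1. e = C \<inter> V" by (auto simp: edges_def)
    then obtain c b I where I: "c \<in> coords" "I \<subseteq> {..<n}" "card I = 1" "\<forall>i\<in>I. {c i, b i} \<in> uedges (T i)"
        "e = vt ` override_on c b ` Pow I"
      unfolding cube_vertices_iff by blast
    then obtain i where i: "I = {i}" by (auto simp: card_1_singleton_iff)
    show ?R using I(1,2,4,5) unfolding i box by (intro exI[of _ c] exI[of _ i] exI[of _ "b i"]) simp
  }
  assume ?R
  then obtain c i b where c: "c \<in> coords" "i < n" "{c i, b} \<in> uedges (T i)" "e = {vt c, vt (c(i := b))}"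
    by blast
  have "\<exists>C\<in>cubes_of_dim n T 1. e = C \<inter> V"
    unfolding cube_vertices_iff using c box[of c "\<lambda>_. b" i]
    by (intro exI[of _ c] exI[of _ "\<lambda>_. b"] exI[of _ "{i}"]) simp
  then show "e \<in> edges n T" by (auto simp: edges_def)
qed

lemma square_iff:
  "s \<in> squares n T \<longleftrightarrow> (\<exists>c i b j d. c \<in> coords \<and> i < n \<and> j < n \<and> i \<noteq> j \<and>
     {c i, b} \<in> uedges (T i) \<and> {c j, d} \<in> uedges (T j) \<and>
     s = vt ` {c, c(i := b), c(j := d), c(i := b, j := d)})" (is "_ \<longleftrightarrow> ?R")
proof
  have box: "override_on c b ` Pow {i, j} = {c, c(i := b i), c(j := b j), c(i := b i, j := b j)}"
    if "i \<noteq> j" for c b :: "nat \<Rightarrow> 'a" and i j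
    using that by (simp add: Pow_insert override_on_insert override_on_singleton fun_upd_twist[of i j]) blast
  {
    assume "s \<in> squares n T"
    then have "\<exists>C\<in>cubes_of_dim n T 2. s = C \<inter> V" by (auto simp: squares_def)
    then obtain c b I where I: "c \<in> coords" "I \<subseteq> {..<n}" "card I = 2" "\<forall>i\<in>I. {c i, b i} \<in> uedges (T i)"
        "s = vt ` override_on c b ` Pow I"
      unfolding cube_vertices_iff by blast
    then obtain i j where ij: "I = {i, j}" "i \<noteq> j" by (auto simp: card_2_iff)
    show ?R using I(1,2,4,5) unfolding ij(1) box[OF ij(2)] using ij(2)
      by (intro exI[of _ c] exI[of _ i] exI[of _ "b i"] exI[of _ j] exI[of _ "b j"]) simp
  }
  assume ?R
  then obtain c i b j d where c: "c \<in> coords" "i < n" "j < n" "i \<noteq> j" "{c i, b} \<in> uedges (T i)"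
      "{c j, d} \<in> uedges (T j)" "s = vt ` {c, c(i := b), c(j := d), c(i := b, j := d)}"
    by blast
  have "\<exists>C\<in>cubes_of_dim n T 2. s = C \<inter> V"
    unfolding cube_vertices_iff using c box[OF c(4), of c "\<lambda>k. if k = i then b else d"]
    by (intro exI[of _ c] exI[of _ "\<lambda>k. if k = i then b else d"] exI[of _ "{i, j}"]) auto
  then show "s \<in> squares n T" by (auto simp: squares_def)
qed

lemma edge_nbr:
  assumes c: "c \<in> coords"
  shows "{vt c, y} \<in> edges n T \<longleftrightarrow> (\<exists>i<n. \<exists>b. {c i, b} \<in> uedges (T i) \<and> y = vt (c(i := b)))"
proof
  assume "{vt c, y} \<in> edges n T"
  then obtain q i b where q: "q \<in> coords" "i < n" "{q i, b} \<in> uedges (T i)" "{vt c, y} = {vt q, vt (q(i := b))}"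
    by (auto simp: edge_iff)
  have q': "q(i := b) \<in> coords" using q coords_upd_edge by blast
  from q(4) consider "vt c = vt q" "y = vt (q(i := b))" | "vt c = vt (q(i := b))" "y = vt q"
    by (auto simp: doubleton_eq_iff)
  then show "\<exists>i<n. \<exists>b. {c i, b} \<in> uedges (T i) \<and> y = vt (c(i := b))"
  proof cases
    case 1
    then have "c = q" using c q vt_inject by simp
    with 1 q show ?thesis by blast
  next
    case 2
    then have "c = q(i := b)" using c q' vt_inject by simp
    with 2 q show ?thesis by (intro exI[of _ i] conjI exI[of _ "q i"]) (auto simp: insert_commute)
  qed
qed (use c edge_iff in blast)

end

section \<open>Hyperplanes and halfspaces of a product of trees\<close>

context trees
begin

text \<open>The edges in direction \<open>i\<close> that lie over the edge \<open>{a, b}\<close> of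
  the factor; \<open>hyperplane_par\<close> shows that they form one hyperplane.\<close>

definition par :: "nat \<Rightarrow> 'a \<Rightarrow> 'a \<Rightarrow> 'a prod_point set set" where
  "par i a b = {{vt c, vt (c(i := d))} | c d. c \<in> coords \<and> {c i, d} = {a, b}}"

definition HS :: "nat \<Rightarrow> 'a \<Rightarrow> 'a \<Rightarrow> 'a prod_point set" where
  "HS i a b = vt ` {c \<in> coords. c i \<in> tree_side (T i) a b}"

lemma par_commute: "par i a b = par i b a"
  by (simp add: par_def insert_commute)

text \<open>The witness \<open>g\<close> is the corner that differs from \<open>p\<close> in
  direction \<open>l\<close> only; it begins the edge parallel to the removed one.\<close>

lemma square_minus_edge_aux:
  assumes "k \<noteq> l" "u \<noteq> c k" "w \<noteq> c l" and S: "S = {c, c(k := u), c(l := w), c(k := u, l := w)}"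
    and p: "p \<in> S" "p(k := x) \<in> S" "x \<noteq> p k"
  shows "\<exists>g\<in>S. g k = p k \<and> S - {p, p(k := x)} = {g, g(k := x)}"
proof -
  have ne: "c \<noteq> c(k := u)" "c \<noteq> c(l := w)" "c \<noteq> c(k := u, l := w)" "c(k := u) \<noteq> c(l := w)"
      "c(k := u) \<noteq> c(k := u, l := w)" "c(l := w) \<noteq> c(k := u, l := w)"
    and twist: "c(l := w, k := u) = c(k := u, l := w)" "c(k := u, l := w, k := c k) = c(l := w)"
    using assms(1-3) by (auto simp: fun_eq_iff)
  have "q k = c k \<or> q k = u" if "q \<in> S" for q using that assms(1) unfolding S by auto
  from this[OF p(1)] this[OF p(2)] have x: "x = (if p k = c k then u else c k)" using p(3) by auto
  from p(1) consider "p = c" | "p = c(k := u)" | "p = c(l := w)" | "p = c(k := u, l := w)"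
    unfolding S by blast
  then show ?thesis
  proof cases
    case 1
    with x ne twist show ?thesis by (intro bexI[of _ "c(l := w)"]) (auto simp: S assms(1))
  next
    case 2
    then have "x = c k" using x assms(2) by simp
    with 2 ne twist show ?thesis by (intro bexI[of _ "c(k := u, l := w)"]) (auto simp: S assms(1))
  next
    case 3
    then have "x = u" using x assms(1) by simp
    with 3 ne twist show ?thesis by (intro bexI[of _ c]) (auto simp: S assms(1))
  next
    case 4
    then have "x = c k" using x assms(1,2) by simp
    with 4 ne twist show ?thesis by (intro bexI[of _ "c(k := u)"]) (auto simp: S assms(1))
  qed
qed

text \<open>The changed coordinate \<open>i\<close> must be one of the two directions of the square,
  and exchanging these reduces the second case to the first.\<close>

lemma square_minus_edge:
  assumes "k \<noteq> l" "u \<noteq> c k" "w \<noteq> c l" and S: "S = {c, c(k := u), c(l := w), c(k := u, l := w)}"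
    and p: "p \<in> S" "p(i := x) \<in> S" "x \<noteq> p i"
  shows "\<exists>g\<in>S. g i = p i \<and> S - {p, p(i := x)} = {g, g(i := x)}"
proof -
  have "q m = c m" if "q \<in> S" "m \<noteq> k" "m \<noteq> l" for q m using that unfolding S by auto
  from this[OF p(1), of i] this[OF p(2), of i] have "i = k \<or> i = l" using p(3) by fastforce
  moreover have S': "S = {c, c(l := w), c(k := u), c(l := w, k := u)}"
    unfolding S using assms(1) by (simp add: fun_upd_twist insert_commute)
  ultimately show ?thesis
  proof (elim disjE)
    assume "i = k"
    then show ?thesis using square_minus_edge_aux[OF assms(1-3) S p(1), of x] p by simp
  next
    assume "i = l"
    then show ?thesis
      using square_minus_edge_aux[OF assms(1)[symmetric] assms(3,2) S' p(1), of x] p by simp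
  qed
qed

lemma edge_neq: "i < n \<Longrightarrow> {a, b} \<in> uedges (T i) \<Longrightarrow> a \<noteq> b"
  using tree.edge_verts[OF trees] by blast

lemma opposite_par:
  assumes ef: "(e, f) \<in> opposite_edges n T" and e: "e \<in> par i a b"
    and i: "i < n" and ab: "{a, b} \<in> uedges (T i)"
  shows "f \<in> par i a b"
proof -
  obtain p x where p: "p \<in> coords" "{p i, x} = {a, b}" "e = {vt p, vt (p(i := x))}"
    using e by (auto simp: par_def)
  have "{p i, x} \<in> uedges (T i)" using p(2) ab by simp
  then have x: "x \<noteq> p i" "p(i := x) \<in> coords" using edge_neq[OF i] coords_upd_edge[OF p(1) i] by auto
  obtain c k u l w where s: "c \<in> coords" "k < n" "l < n" "k \<noteq> l" "{c k, u} \<in> uedges (T k)"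
      "{c l, w} \<in> uedges (T l)" "e \<union> f = vt ` {c, c(k := u), c(l := w), c(k := u, l := w)}"
    using ef unfolding opposite_edges_def square_iff by blast
  define S where "S = {c, c(k := u), c(l := w), c(k := u, l := w)}"
  have S: "S \<subseteq> coords"
    using s coords_upd_edge[OF s(1)] coords_upd_edge[of "c(k := u)" l "c l" w]
    by (auto simp: S_def)
  have ef': "e \<inter> f = {}" "e \<union> f = vt ` S" using ef s by (auto simp: opposite_edges_def S_def)
  have "vt p \<in> vt ` S" "vt (p(i := x)) \<in> vt ` S" using ef'(2) p(3) by blast+
  then have pS: "p \<in> S" "p(i := x) \<in> S"
    using S vt_inject[OF p(1)] vt_inject[OF x(2)] by auto
  have "u \<noteq> c k" "w \<noteq> c l" using edge_neq[OF s(2,5)] edge_neq[OF s(3,6)] by auto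
  then obtain g where g: "g \<in> S" "g i = p i" "S - {p, p(i := x)} = {g, g(i := x)}"
    using square_minus_edge[OF s(4) _ _ S_def pS x(1)] by blast
  have "f = vt ` S - e" using ef' by auto
  also have "e = vt ` {p, p(i := x)}" using p(3) by simp
  also have "vt ` S - vt ` {p, p(i := x)} = vt ` (S - {p, p(i := x)})"
    using pS S inj_on_image_set_diff[OF inj_on_vt, of S "{p, p(i := x)}"] by auto
  also have "\<dots> = {vt g, vt (g(i := x))}" using g by simp
  finally have "f = {vt g, vt (g(i := x))}" .
  moreover have "g \<in> coords" "{g i, x} = {a, b}" using g(1,2) S p(2) by auto
  ultimately show ?thesis unfolding par_def by blast
qed

lemma opposite_move:
  assumes c: "c \<in> coords" and ij: "i < n" "j < n" "i \<noteq> j" and b: "{c i, b} \<in> uedges (T i)"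
    and d: "{c j, d} \<in> uedges (T j)"
  shows "({vt c, vt (c(i := b))}, {vt (c(j := d)), vt (c(j := d, i := b))}) \<in> opposite_edges n T"
proof -
  have co: "c(i := b) \<in> coords" "c(j := d) \<in> coords" "c(j := d, i := b) \<in> coords"
    using assms coords_upd_edge[of c i "c i" b] coords_upd_edge[of c j "c j" d]
      coords_upd_edge[of "c(j := d)" i "c i" b] by auto
  have tw: "c(i := b, j := d) = c(j := d, i := b)" using ij by (simp add: fun_upd_twist)
  have ne: "c i \<noteq> b" "c j \<noteq> d" using edge_neq assms by blast+
  have "{vt c, vt (c(i := b))} \<in> edges n T" using assms edge_iff by blast
  moreover have "{vt (c(j := d)), vt (c(j := d, i := b))} \<in> edges n T"
    unfolding edge_iff using co(2) ij b by (intro exI[of _ "c(j := d)"] exI[of _ i] exI[of _ b]) auto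
  moreover have "vt ` {c, c(i := b), c(j := d), c(i := b, j := d)} \<in> squares n T"
    unfolding square_iff using assms by blast
  then have "{vt c, vt (c(i := b))} \<union> {vt (c(j := d)), vt (c(j := d, i := b))} \<in> squares n T"
    by (simp add: tw insert_commute)
  moreover have "c \<noteq> c(j := d)" "c \<noteq> c(j := d, i := b)" "c(i := b) \<noteq> c(j := d)" "c(i := b) \<noteq> c(j := d, i := b)"
    using ne ij by (auto simp: fun_eq_iff)
  then have "{vt c, vt (c(i := b))} \<inter> {vt (c(j := d)), vt (c(j := d, i := b))} = {}"
    using c co vt_inject by simp
  ultimately show ?thesis unfolding opposite_edges_def by blast
qed

text \<open>One coordinate after another is changed along a path in its tree. The set
  \<open>J\<close> restricts the coordinates that move: with \<open>i\<close> left out, the path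
  carries an edge of direction \<open>i\<close> through parallel copies.\<close>

lemma coords_connected:
  assumes "finite J" "J \<subseteq> {..<n}" "c \<in> coords" "c' \<in> coords" "\<And>j. j \<notin> J \<Longrightarrow> c j = c' j"
  shows "(c, c') \<in> {(c, c(j := b)) | c j b. c \<in> coords \<and> j \<in> J \<and> {c j, b} \<in> uedges (T j)}\<^sup>*"
proof -
  let ?R = "\<lambda>J. {(c, c(j := b)) | c j b. c \<in> coords \<and> j \<in> J \<and> {c j, b} \<in> uedges (T j)}"
  show ?thesis
    using assms
  proof (induction J arbitrary: c rule: finite_induct)
    case empty
    then have "c = c'" by auto
    then show ?case by simp
  next
    case (insert j J)
    have j: "j < n" using insert by simp
    have "(c j, c' j) \<in> (tree_adj (T j))\<^sup>*"
      using insert j by (intro tree.adj_connected[OF trees] coords_mem) auto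
    have "(c, c(j := y)) \<in> (?R (insert j J))\<^sup>* \<and> c(j := y) \<in> coords"
      if "(c j, y) \<in> (tree_adj (T j))\<^sup>*" for y
      using that
    proof (induction y rule: rtrancl_induct)
      case base
      then show ?case using insert by simp
    next
      case (step y z)
      have co: "c(j := y) \<in> coords" by (rule conjunct2[OF step.IH])
      then have "(c(j := y), c(j := z)) \<in> ?R (insert j J)"
        using step(2)
        by (intro CollectI exI[of _ "c(j := y)"] exI[of _ j] exI[of _ z] conjI) (simp_all add: tree_adj_def)
      then have "(c, c(j := z)) \<in> (?R (insert j J))\<^sup>*"
        by (rule rtrancl_into_rtrancl[OF conjunct1[OF step.IH]])
      moreover have "c(j := z) \<in> coords"
        using step(2) j insert.prems coords_upd[of c j z] tree.edge_verts[OF trees, of j y z]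
        by (simp add: tree_adj_def)
      ultimately show ?case by (rule conjI)
    qed
    from this[of "c' j"] have "(c, c(j := c' j)) \<in> (?R (insert j J))\<^sup>* \<and> c(j := c' j) \<in> coords"
      using \<open>(c j, c' j) \<in> (tree_adj (T j))\<^sup>*\<close> by blast
    moreover have "(c(j := c' j), c') \<in> (?R J)\<^sup>*"
    proof (rule insert.IH[folded fun_upd_def])
      show "J \<subseteq> {..<n}" "c' \<in> coords" using insert.prems by auto
      show "c(j := c' j) \<in> coords" using calculation by (rule conjunct2)
      show "(c(j := c' j)) k = c' k" if "k \<notin> J" for k using insert.prems(4)[of k] that by simp
    qed
    then have "(c(j := c' j), c') \<in> (?R (insert j J))\<^sup>*"
      by (rule rtrancl_mono[THEN subsetD, rotated]) auto
    ultimately show ?case by (meson rtrancl_trans)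
  qed
qed

text \<open>Opposite edges have the same projection, and conversely moves in the other directions
  slide an edge to any other one over the same edge of the factor. The ends may come in either
  order, hence the final case distinction.\<close>

lemma hyperplane_par:
  assumes c: "c \<in> coords" and i: "i < n" and b: "{c i, b} \<in> uedges (T i)"
  shows "(opposite_edges n T)\<^sup>* `` {{vt c, vt (c(i := b))}} = par i (c i) b"
proof
  show "(opposite_edges n T)\<^sup>* `` {{vt c, vt (c(i := b))}} \<subseteq> par i (c i) b"
  proof safe
    fix f assume "({vt c, vt (c(i := b))}, f) \<in> (opposite_edges n T)\<^sup>*"
    then show "f \<in> par i (c i) b"
    proof (induction rule: rtrancl_induct)
      case base
      then show ?case using c by (auto simp: par_def)
    next
      case (step y z)
      then show ?case using opposite_par i b by blast
    qed
  qed
  have move: "({vt c, vt (c(i := b))}, {vt c', vt (c'(i := b))}) \<in> (opposite_edges n T)\<^sup>*"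
    if c': "c' \<in> coords" "c' i = c i" for c'
  proof -
    have "(c, c') \<in> {(c, c(j := b)) | c j b. c \<in> coords \<and> j \<in> {..<n} - {i} \<and> {c j, b} \<in> uedges (T j)}\<^sup>*"
      using c c' coords_ext
      by (intro coords_connected) (auto, metis coords_ext extensional_arb lessThan_iff)
    then have "({vt c, vt (c(i := b))}, {vt c', vt (c'(i := b))}) \<in> (opposite_edges n T)\<^sup>* \<and> c' i = c i"
    proof (induction rule: rtrancl_induct)
      case (step y z)
      then obtain j d where z: "z = y(j := d)" "y \<in> coords" "j < n" "j \<noteq> i" "{y j, d} \<in> uedges (T j)"
        by auto
      then have "({vt y, vt (y(i := b))}, {vt z, vt (z(i := b))}) \<in> opposite_edges n T"
        using opposite_move[of y i j b d] step.IH i b by auto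
      with step.IH have "({vt c, vt (c(i := b))}, {vt z, vt (z(i := b))}) \<in> (opposite_edges n T)\<^sup>*"
        by (meson rtrancl_into_rtrancl)
      moreover have "z i = c i" using step.IH z by simp
      ultimately show ?case by blast
    qed simp
    then show ?thesis ..
  qed
  show "par i (c i) b \<subseteq> (opposite_edges n T)\<^sup>* `` {{vt c, vt (c(i := b))}}"
  proof
    fix f assume "f \<in> par i (c i) b"
    then obtain q d where q: "q \<in> coords" "{q i, d} = {c i, b}" "f = {vt q, vt (q(i := d))}"
      by (auto simp: par_def)
    from q(2) consider "q i = c i" "d = b" | "q i = b" "d = c i" by (auto simp: doubleton_eq_iff)
    then show "f \<in> (opposite_edges n T)\<^sup>* `` {{vt c, vt (c(i := b))}}"
    proof cases
      case 1
      then show ?thesis using move[of q] q by auto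
    next
      case 2
      have "q(i := c i) \<in> coords" using q(1) i coords_upd coords_mem[OF c i] by blast
      moreover have "f = {vt (q(i := c i)), vt ((q(i := c i))(i := b))}"
        using 2 q(3) by (auto simp: fun_upd_triv insert_commute)
      ultimately show ?thesis using move[of "q(i := c i)"] by auto
    qed
  qed
qed

lemma ex_coords:
  assumes "i < n" "a \<in> uverts (T i)"
  shows "\<exists>c\<in>coords. c i = a"
proof -
  have "\<forall>j\<in>{..<n}. \<exists>v. v \<in> uverts (T j)" using tree.verts_nonempty[OF trees] by blast
  then obtain v where v: "\<And>j. j < n \<Longrightarrow> v j \<in> uverts (T j)" by (metis lessThan_iff)
  show ?thesis using assms v
    by (intro bexI[of _ "restrict (v(i := a)) {..<n}"]) (auto simp: coords_def)
qed

lemma coords_nonempty: "coords \<noteq> {}"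
proof -
  have "\<forall>j\<in>{..<n}. \<exists>v. v \<in> uverts (T j)" using tree.verts_nonempty[OF trees] by blast
  then show ?thesis by (simp add: coords_def PiE_eq_empty_iff ex_in_conv)
qed

lemma hyperplanes_eq: "hyperplanes n T = {par i a b | i a b. i < n \<and> {a, b} \<in> uedges (T i)}"
proof
  show "hyperplanes n T \<subseteq> {par i a b | i a b. i < n \<and> {a, b} \<in> uedges (T i)}"
  proof
    fix h assume "h \<in> hyperplanes n T"
    then obtain e where "e \<in> edges n T" "h = (opposite_edges n T)\<^sup>* `` {e}"
      by (auto simp: hyperplanes_def quotient_def)
    then show "h \<in> {par i a b | i a b. i < n \<and> {a, b} \<in> uedges (T i)}"
      using hyperplane_par unfolding edge_iff by blast
  qed
  show "{par i a b | i a b. i < n \<and> {a, b} \<in> uedges (T i)} \<subseteq> hyperplanes n T"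
  proof safe
    fix i a b assume ab: "i < n" "{a, b} \<in> uedges (T i)"
    then obtain c where c: "c \<in> coords" "c i = a" using ex_coords tree.edge_verts[OF trees] by metis
    then have "par i a b = (opposite_edges n T)\<^sup>* `` {{vt c, vt (c(i := b))}}"
      using hyperplane_par[of c i b] ab by simp
    moreover have "{vt c, vt (c(i := b))} \<in> edges n T" using c ab edge_iff by blast
    ultimately show "par i a b \<in> hyperplanes n T" by (auto simp: hyperplanes_def quotient_def)
  qed
qed

section \<open>Halfspaces as preimages of the sides of tree edges\<close>

lemma edge_other_direction:
  assumes "c \<in> coords" "i < n" "j < n" "j \<noteq> i" "{c j, d} \<in> uedges (T j)" "{a, b} \<in> uedges (T i)"
  shows "{vt c, vt (c(j := d))} \<notin> par i a b"
proof
  assume "{vt c, vt (c(j := d))} \<in> par i a b"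
  then obtain q e where q: "q \<in> coords" "{q i, e} = {a, b}" "{vt c, vt (c(j := d))} = {vt q, vt (q(i := e))}"
    by (auto simp: par_def)
  have "q i \<noteq> e" using q(2) edge_neq[OF assms(2,6)] by (auto simp: doubleton_eq_iff)
  have "vt c i = vt (c(j := d)) i" using assms by (simp add: vt_def)
  then have "vt q i = vt (q(i := e)) i" using q(3) by (metis doubleton_eq_iff)
  then show False using \<open>q i \<noteq> e\<close> assms(2) by (simp add: vt_def vertex_point_inject)
qed

text \<open>Removing the class only prevents the coordinate \<open>i\<close> from crossing
  \<open>{a, b}\<close>. Within one side the coordinate \<open>i\<close> is adjusted first, then the
  others, whose edges never belong to the class.\<close>

lemma component_par:
  assumes i: "i < n" and ab: "{a, b} \<in> uedges (T i)" and c: "c \<in> coords" "c i \<in> tree_side (T i) a b"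
  shows "{(x, y). {x, y} \<in> edges n T - par i a b}\<^sup>* `` {vt c} = HS i a b"
proof
  let ?R = "{(x, y). {x, y} \<in> edges n T - par i a b}"
  interpret Ti: tree "T i" by (rule trees[OF i])
  show "?R\<^sup>* `` {vt c} \<subseteq> HS i a b"
  proof safe
    fix y assume "(vt c, y) \<in> ?R\<^sup>*"
    then show "y \<in> HS i a b"
    proof (induction rule: rtrancl_induct)
      case base
      then show ?case using c by (simp add: HS_def)
    next
      case (step y z)
      then obtain q where q: "y = vt q" "q \<in> coords" "q i \<in> Ti.side a b" by (auto simp: HS_def)
      obtain j d where jd: "j < n" "{q j, d} \<in> uedges (T j)" "z = vt (q(j := d))"
        using step(2) q edge_nbr by auto
      have co: "q(j := d) \<in> coords" using q(2) jd coords_upd_edge by blast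
      have "(q(j := d)) i \<in> Ti.side a b"
      proof (cases "j = i")
        case True
        have "{q i, d} \<noteq> {a, b}" using step(2) q jd(3) True by (auto simp: par_def)
        then show ?thesis using Ti.side_step[OF q(3)] jd True by simp
      qed (use q in simp)
      then show ?case using co jd(3) by (auto simp: HS_def)
    qed
  qed
  show "HS i a b \<subseteq> ?R\<^sup>* `` {vt c}"
  proof
    fix y assume "y \<in> HS i a b"
    then obtain q where q: "y = vt q" "q \<in> coords" "q i \<in> Ti.side a b" by (auto simp: HS_def)
    have "(c i, q i) \<in> {(x, y). {x, y} \<in> uedges (T i) - {{a, b}}}\<^sup>*"
      by (rule Ti.side_connected[OF c(2) q(3)])
    then have 1: "(vt c, vt (c(i := q i))) \<in> ?R\<^sup>* \<and> c(i := q i) \<in> coords"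
    proof (induction rule: rtrancl_induct)
      case base
      then show ?case using c by simp
    next
      case (step y z)
      have yz: "{y, z} \<in> uedges (T i)" "{y, z} \<noteq> {a, b}" using step(2) by auto
      have "{vt (c(i := y)), vt (c(i := z))} \<in> edges n T"
      proof -
        have "{(c(i := y)) i, z} \<in> uedges (T i)" using yz(1) by simp
        then have "{vt (c(i := y)), vt ((c(i := y))(i := z))} \<in> edges n T"
          using edge_nbr step(3) i by blast
        then show ?thesis by (simp only: fun_upd_upd)
      qed
      moreover have "{vt (c(i := y)), vt (c(i := z))} \<notin> par i a b"
      proof
        assume "{vt (c(i := y)), vt (c(i := z))} \<in> par i a b"
        then obtain q e where qe: "{q i, e} = {a, b}"
            "{vt (c(i := y)), vt (c(i := z))} = {vt q, vt (q(i := e))}"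
          by (auto simp: par_def)
        have "{vt (c(i := y)) i, vt (c(i := z)) i} = {vt q i, vt (q(i := e)) i}"
          using arg_cong[OF qe(2), of "\<lambda>X. (\<lambda>x. x i) ` X"] by simp
        then have "vertex_point ` {y, z} = vertex_point ` {q i, e}" using i by (simp add: vt_def)
        then have "{y, z} = {q i, e}" by (rule inj_image_eq_iff[THEN iffD1, rotated]) (auto simp: inj_def vertex_point_inject)
        then show False using yz qe(1) by simp
      qed
      ultimately have "(vt (c(i := y)), vt (c(i := z))) \<in> ?R" by blast
      moreover have "c(i := z) \<in> coords" using coords_upd_edge[OF c(1) i yz(1)] .
      ultimately show ?case using step(3) by (meson rtrancl_into_rtrancl)
    qed
    have "(c(i := q i), q) \<in> {(c, c(j := b)) | c j b. c \<in> coords \<and> j \<in> {..<n} - {i} \<and> {c j, b} \<in> uedges (T j)}\<^sup>*"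
      using 1 q coords_ext
      by (intro coords_connected) (auto, metis c(1) coords_ext extensional_arb lessThan_iff)
    then have "(vt c, vt q) \<in> ?R\<^sup>*"
    proof (induction rule: rtrancl_induct)
      case (step y z)
      then obtain j d where z: "z = y(j := d)" "y \<in> coords" "j < n" "j \<noteq> i" "{y j, d} \<in> uedges (T j)"
        by auto
      have "{vt y, vt z} \<in> edges n T" using z edge_nbr by blast
      moreover have "{vt y, vt z} \<notin> par i a b" using edge_other_direction z i ab by blast
      ultimately show ?case using step(3) by (auto intro: rtrancl_into_rtrancl)
    qed (use 1 in blast)
    then show "y \<in> ?R\<^sup>* `` {vt c}" using q by simp
  qed
qed

lemma HS_disjoint:
  assumes "i < n" "{a, b} \<in> uedges (T i)"
  shows "HS i a b \<inter> HS i b a = {}"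
proof -
  have False if "c \<in> coords" "c i \<in> tree_side (T i) a b" "c' \<in> coords" "c' i \<in> tree_side (T i) b a" "vt c = vt c'" for c c'
    using that vt_inject tree.side_disjoint[OF trees assms(2)] assms by blast
  then show ?thesis by (auto simp: HS_def)
qed

lemma vt_HS: "c \<in> coords \<Longrightarrow> vt c \<in> HS i a b \<longleftrightarrow> c i \<in> tree_side (T i) a b"
  using vt_inject by (auto simp: HS_def)

lemma HS_nonempty:
  assumes "i < n" "{a, b} \<in> uedges (T i)"
  shows "HS i a b \<noteq> {}"
  using ex_coords[OF assms(1)] tree.edge_verts[OF trees assms(2)] assms tree.side_refl[OF trees]
  by (fastforce simp: HS_def)

lemma halfspaces_par:
  assumes i: "i < n" and ab: "{a, b} \<in> uedges (T i)"
  shows "halfspaces n T (par i a b) = {HS i a b, HS i b a}"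
proof -
  interpret Ti: tree "T i" by (rule trees[OF i])
  have ba: "{b, a} \<in> uedges (T i)" using ab by (simp add: insert_commute)
  let ?R = "{(x, y). {x, y} \<in> edges n T - par i a b}"
  have 1: "?R\<^sup>* `` {vt c} = (if c i \<in> Ti.side a b then HS i a b else HS i b a)" if c: "c \<in> coords" for c
    using component_par[OF i ab c] component_par[OF i ba c] Ti.side_total[OF ab coords_mem[OF c i]]
    by (auto simp: par_commute[of i b a])
  obtain c d where cd: "c \<in> coords" "c i = a" "d \<in> coords" "d i = b"
    using ex_coords[OF i] Ti.edge_verts[OF ab] by metis
  have "Ti.side a b \<inter> Ti.side b a = {}" by (rule Ti.side_disjoint[OF ab])
  then have side: "a \<in> Ti.side a b" "b \<notin> Ti.side a b" using Ti.side_refl by auto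
  have "halfspaces n T (par i a b) = (\<lambda>c. ?R\<^sup>* `` {vt c}) ` coords"
    by (auto simp: halfspaces_def quotient_def vertices_eq)
  also have "\<dots> = {HS i a b, HS i b a}"
  proof
    show "(\<lambda>c. ?R\<^sup>* `` {vt c}) ` coords \<subseteq> {HS i a b, HS i b a}" using 1 by auto
    have "HS i a b \<in> (\<lambda>c. ?R\<^sup>* `` {vt c}) ` coords"
      using 1[OF cd(1)] cd side by (intro image_eqI[of _ _ c]) auto
    moreover have "HS i b a \<in> (\<lambda>c. ?R\<^sup>* `` {vt c}) ` coords"
      using 1[OF cd(3)] cd side by (intro image_eqI[of _ _ d]) auto
    ultimately show "{HS i a b, HS i b a} \<subseteq> (\<lambda>c. ?R\<^sup>* `` {vt c}) ` coords" by blast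
  qed
  finally show ?thesis .
qed

end

section \<open>The flow towards an ultrafilter\<close>

context trees
begin

text \<open>The edge is oriented to the end whose side is chosen; \<open>HS i b a\<close> is the
  halfspace on the side of \<open>b\<close>.\<close>

definition toward :: "'a halfspace_choice \<Rightarrow> nat \<Rightarrow> 'a \<Rightarrow> 'a \<Rightarrow> bool" where
  "toward u i a b \<longleftrightarrow> {a, b} \<in> uedges (T i) \<and> u (par i a b) = HS i b a"

text \<open>The outgoing edge is unique by \<open>toward_unique\<close>; a vertex without one stays
  put.\<close>

definition step :: "'a halfspace_choice \<Rightarrow> nat \<Rightarrow> 'a \<Rightarrow> 'a" where
  "step u i a = (if \<exists>b. toward u i a b then THE b. toward u i a b else a)"

definition crd :: "'a prod_point \<Rightarrow> nat \<Rightarrow> 'a" where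
  "crd = inv_into coords vt"

definition flow :: "nat \<Rightarrow> 'a halfspace_choice \<Rightarrow> 'a prod_point \<Rightarrow> 'a prod_point" where
  "flow i u x = vt ((crd x)(i := step u i (crd x i)))"

definition adjacent :: "('a prod_point \<times> 'a prod_point) set" where
  "adjacent = {(x, y). {x, y} \<in> edges n T}"

definition valency :: nat where
  "valency = (\<Sum>i<n. ulf_tree.valency_bound (T i))"

lemma crd_vt: "c \<in> coords \<Longrightarrow> crd (vt c) = c"
  unfolding crd_def by (rule inv_into_f_f[OF inj_on_vt])

lemma vertex_cases:
  assumes "x \<in> V" obtains c where "c \<in> coords" "x = vt c"
  using assms by (auto simp: vertices_eq)

lemma countable_coords: "countable coords"
  unfolding coords_def by (intro countable_PiE) (auto intro: ulf_tree.countable_verts ulf_trees)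

lemma countable_vertices: "countable V"
  by (simp add: vertices_eq countable_coords)

lemma adjacent_subset: "adjacent \<subseteq> V \<times> V"
  using edges_subset by (fastforce simp: adjacent_def)

lemma adjacent_sym: "sym adjacent"
  by (auto simp: adjacent_def sym_def insert_commute)

lemma finite_card_adjacent: "finite (adjacent `` {x}) \<and> card (adjacent `` {x}) \<le> valency"
proof (cases "x \<in> V")
  case True
  then obtain c where c: "c \<in> coords" "x = vt c" by (rule vertex_cases)
  let ?N = "\<lambda>i. (\<lambda>b. vt (c(i := b))) ` (tree_adj (T i) `` {c i})"
  have sub: "adjacent `` {x} \<subseteq> (\<Union>i\<in>{..<n}. ?N i)"
    using edge_nbr[OF c(1)] c(2) by (auto simp: adjacent_def tree_adj_def)
  have fin: "finite (tree_adj (T i) `` {c i})" if "i < n" for i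
    using ulf_tree.finite_adj[OF ulf_trees[OF that]] .
  then have finU: "finite (\<Union>i\<in>{..<n}. ?N i)" by auto
  have "card (\<Union>i\<in>{..<n}. ?N i) \<le> (\<Sum>i<n. card (?N i))"
    by (rule card_UN_le) simp
  also have "\<dots> \<le> valency"
    unfolding valency_def
  proof (rule sum_mono)
    fix i assume "i \<in> {..<n}"
    then have i: "i < n" by simp
    have "card (?N i) \<le> card (tree_adj (T i) `` {c i})" using fin[OF i] by (rule card_image_le)
    also have "\<dots> \<le> ulf_tree.valency_bound (T i)" by (rule ulf_tree.card_adj[OF ulf_trees[OF i]])
    finally show "card (?N i) \<le> ulf_tree.valency_bound (T i)" .
  qed
  finally show ?thesis using sub finU by (meson card_mono finite_subset le_trans)
next
  case False
  then have "adjacent `` {x} = {}" using adjacent_subset by auto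
  then show ?thesis by simp
qed

lemma ultrafilter_par:
  assumes "u \<in> ultrafilters n T" "i < n" "{a, b} \<in> uedges (T i)"
  shows "u (par i a b) = HS i a b \<or> u (par i a b) = HS i b a"
proof -
  have "par i a b \<in> hyperplanes n T" using assms by (auto simp: hyperplanes_eq)
  then have "u (par i a b) \<in> halfspaces n T (par i a b)" using assms by (auto simp: ultrafilters_def)
  then show ?thesis using halfspaces_par assms by auto
qed

lemma ultrafilter_inter:
  assumes "u \<in> ultrafilters n T" "i < n" "{a, b} \<in> uedges (T i)" "j < n" "{c, d} \<in> uedges (T j)"
  shows "u (par i a b) \<inter> u (par j c d) \<noteq> {}"
proof -
  have "par i a b \<in> hyperplanes n T" "par j c d \<in> hyperplanes n T" using assms by (auto simp: hyperplanes_eq)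
  then show ?thesis using assms(1) by (auto simp: ultrafilters_def)
qed

lemma toward_total:
  assumes "u \<in> ultrafilters n T" "i < n" "{a, b} \<in> uedges (T i)"
  shows "toward u i a b \<or> toward u i b a"
  using ultrafilter_par[OF assms] assms by (auto simp: toward_def par_commute[of i b a] insert_commute)

text \<open>Two outgoing edges would select the disjoint branches behind \<open>b\<close> and
  \<open>b'\<close>, while chosen halfspaces intersect.\<close>

lemma toward_unique:
  assumes u: "u \<in> ultrafilters n T" and i: "i < n" and t: "toward u i a b" "toward u i a b'"
  shows "b = b'"
proof (rule ccontr)
  assume "b \<noteq> b'"
  interpret Ti: tree "T i" by (rule trees[OF i])
  have e: "{a, b} \<in> uedges (T i)" "{a, b'} \<in> uedges (T i)" using t by (auto simp: toward_def)
  have "Ti.side b a \<inter> Ti.side b' a = {}" using Ti.side_disjoint_branches[OF e \<open>b \<noteq> b'\<close>] .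
  then have "HS i b a \<inter> HS i b' a = {}" by (auto simp: HS_def vt_inject)
  then show False using ultrafilter_inter[OF u i e(1) i e(2)] t by (simp add: toward_def)
qed

lemma step_toward:
  assumes "u \<in> ultrafilters n T" "i < n" "toward u i a b"
  shows "step u i a = b"
  using assms toward_unique[OF assms(1,2)] unfolding step_def by (auto intro!: the_equality)

lemma step_cases:
  assumes "u \<in> ultrafilters n T" "i < n"
  shows "step u i a = a \<or> toward u i a (step u i a)"
proof (cases "\<exists>b. toward u i a b")
  case True
  then show ?thesis using step_toward[OF assms] by auto
qed (simp add: step_def)

lemma step_verts:
  assumes "u \<in> ultrafilters n T" "i < n" "a \<in> uverts (T i)"
  shows "step u i a \<in> uverts (T i)"
  using step_cases[OF assms(1,2), of a] assms(3) tree.edge_verts[OF trees[OF assms(2)], of a "step u i a"]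
  by (auto simp: toward_def)

lemma step_funpow_verts:
  assumes "u \<in> ultrafilters n T" "i < n" "a \<in> uverts (T i)"
  shows "(step u i ^^ k) a \<in> uverts (T i)"
  by (induction k) (use assms step_verts in auto)

text \<open>Every edge on a path from \<open>a\<close> to \<open>b\<close> is oriented one way or
  the other, so that its ends merge after one step; induction along the path combines these.\<close>

lemma step_merge:
  assumes u: "u \<in> ultrafilters n T" and i: "i < n" and ab: "a \<in> uverts (T i)" "b \<in> uverts (T i)"
  shows "\<exists>p q. (step u i ^^ p) a = (step u i ^^ q) b"
proof -
  interpret Ti: tree "T i" by (rule trees[OF i])
  have "(a, b) \<in> (tree_adj (T i))\<^sup>*" by (rule Ti.adj_connected[OF ab])
  then show ?thesis
  proof (induction rule: rtrancl_induct)
    case base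
    show ?case by blast
  next
    case (step y z)
    then obtain p q where pq: "(step u i ^^ p) a = (step u i ^^ q) y" by blast
    have "{y, z} \<in> uedges (T i)" using step(2) by (simp add: tree_adj_def)
    then consider "toward u i y z" | "toward u i z y" using toward_total[OF u i] by blast
    then show ?case
    proof cases
      case 1
      then have z: "step u i y = z" by (rule step_toward[OF u i])
      \<comment> \<open>With \<open>q = 0\<close> the point reached is \<open>y\<close>, and one
        more step leads to \<open>z\<close>; otherwise the first of the \<open>q\<close> steps from
        \<open>y\<close> already arrives at \<open>z\<close>.\<close>
      show ?thesis
      proof (cases q)
        case 0
        then have "(step u i ^^ Suc p) a = (step u i ^^ 0) z" using pq z by simp
        then show ?thesis by blast
      next
        case (Suc q')
        then have "(step u i ^^ p) a = (step u i ^^ q') z" using pq z by (simp add: funpow_swap1)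
        then show ?thesis by blast
      qed
    next
      case 2
      then have "step u i z = y" by (rule step_toward[OF u i])
      then have "(step u i ^^ p) a = (step u i ^^ Suc q) z" using pq by (simp add: funpow_swap1)
      then show ?thesis by blast
    qed
  qed
qed

lemma flow_vt: "c \<in> coords \<Longrightarrow> flow i u (vt c) = vt (c(i := step u i (c i)))"
  by (simp add: flow_def crd_vt)

lemma flow_coords:
  "u \<in> ultrafilters n T \<Longrightarrow> i < n \<Longrightarrow> c \<in> coords \<Longrightarrow> c(i := step u i (c i)) \<in> coords"
  by (intro coords_upd step_verts coords_mem)

lemma flow_step:
  assumes "u \<in> ultrafilters n T" "i < n" "x \<in> V"
  shows "flow i u x = x \<or> (x, flow i u x) \<in> adjacent"
proof -
  obtain c where c: "c \<in> coords" "x = vt c" using assms(3) by (rule vertex_cases)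
  from step_cases[OF assms(1,2), of "c i"] show ?thesis
  proof
    assume "step u i (c i) = c i"
    then show ?thesis using c by (simp add: flow_vt)
  next
    assume "toward u i (c i) (step u i (c i))"
    then have "{c i, step u i (c i)} \<in> uedges (T i)" by (simp add: toward_def)
    then show ?thesis using c assms(2) edge_nbr[OF c(1)] by (auto simp: adjacent_def flow_vt)
  qed
qed

lemma flow_commute:
  assumes "u \<in> ultrafilters n T" "i < n" "j < n" "x \<in> V"
  shows "flow i u (flow j u x) = flow j u (flow i u x)"
proof (cases "i = j")
  case False
  obtain c where c: "c \<in> coords" "x = vt c" using assms(4) by (rule vertex_cases)
  then show ?thesis using False flow_coords[OF assms(1) _ c(1)] assms(2,3)
    by (simp add: flow_vt fun_upd_twist)
qed simp

lemma multi_iter_flow: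
  assumes u: "u \<in> ultrafilters n T" and c: "c \<in> coords" and "k \<le> n"
  shows "multi_iter k (\<lambda>i. flow i u) a (vt c) = vt (\<lambda>i. if i < k then (step u i ^^ a i) (c i) else c i) \<and>
     (\<lambda>i. if i < k then (step u i ^^ a i) (c i) else c i) \<in> coords"
  using assms(3)
proof (induction k)
  case 0
  then show ?case using c by simp
next
  case (Suc k)
  define q where "q i = (if i < k then (step u i ^^ a i) (c i) else c i)" for i
  have q: "q \<in> coords" "multi_iter k (\<lambda>i. flow i u) a (vt c) = vt q"
    using Suc unfolding q_def by auto
  have k: "k < n" using Suc by simp
  have pow: "(flow k u ^^ m) (vt q) = vt (q(k := (step u k ^^ m) (q k))) \<and> q(k := (step u k ^^ m) (q k)) \<in> coords" for m
  proof (induction m)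
    case 0
    then show ?case using q by simp
  next
    case (Suc m)
    have "flow k u ((flow k u ^^ m) (vt q)) = vt (q(k := step u k ((step u k ^^ m) (q k))))"
      unfolding conjunct1[OF Suc.IH] flow_vt[OF conjunct2[OF Suc.IH]] by simp
    moreover have "q(k := (step u k ^^ Suc m) (q k)) \<in> coords"
      using coords_upd[OF q(1) k] step_funpow_verts[OF u k coords_mem[OF q(1) k]] by blast
    ultimately show ?case by (simp add: fun_upd_def)
  qed
  have "(\<lambda>i. if i < Suc k then (step u i ^^ a i) (c i) else c i) = q(k := (step u k ^^ a k) (q k))"
    by (auto simp: fun_eq_iff q_def less_Suc_eq)
  then show ?case using pow[of "a k"] q(2) by simp
qed

lemma flow_merge:
  assumes u: "u \<in> ultrafilters n T" and xy: "x \<in> V" "y \<in> V"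
  shows "\<exists>a b. multi_iter n (\<lambda>i. flow i u) a x = multi_iter n (\<lambda>i. flow i u) b y"
proof -
  obtain c d where cd: "c \<in> coords" "x = vt c" "d \<in> coords" "y = vt d"
    using xy vertex_cases by metis
  have "\<forall>i. \<exists>p q. i < n \<longrightarrow> (step u i ^^ p) (c i) = (step u i ^^ q) (d i)"
    using step_merge[OF u] coords_mem cd by meson
  then obtain a b where ab: "\<And>i. i < n \<Longrightarrow> (step u i ^^ a i) (c i) = (step u i ^^ b i) (d i)" by metis
  have "c i = d i" if "\<not> i < n" for i
    using coords_ext[OF cd(1)] coords_ext[OF cd(3)] that by (simp add: extensional_def)
  then have "(\<lambda>i. if i < n then (step u i ^^ a i) (c i) else c i) =
      (\<lambda>i. if i < n then (step u i ^^ b i) (d i) else d i)"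
    using ab by auto
  then have "multi_iter n (\<lambda>i. flow i u) a x = multi_iter n (\<lambda>i. flow i u) b y"
    using multi_iter_flow[OF u cd(1) order_refl, of a] multi_iter_flow[OF u cd(3) order_refl, of b] cd
    by simp
  then show ?thesis by blast
qed

text \<open>Leaving the side means following \<open>{a, b}\<close> from \<open>b\<close> to
  \<open>a\<close>, against its orientation; both orientations at once would identify two disjoint
  nonempty halfspaces.\<close>

lemma step_side:
  assumes u: "u \<in> ultrafilters n T" and i: "i < n" and ab: "toward u i a b"
    and x: "x \<in> tree_side (T i) b a"
  shows "step u i x \<in> tree_side (T i) b a"
proof -
  interpret Ti: tree "T i" by (rule trees[OF i])
  have e: "{a, b} \<in> uedges (T i)" using ab by (simp add: toward_def)
  from step_cases[OF u i, of x] show ?thesis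
  proof
    assume t: "toward u i x (step u i x)"
    define y where "y = step u i x"
    have xy: "{x, y} \<in> uedges (T i)" using t by (simp add: toward_def y_def)
    have "{x, y} \<noteq> {b, a}"
    proof
      assume "{x, y} = {b, a}"
      then consider "x = b" "y = a" | "x = a" "y = b" by (auto simp: doubleton_eq_iff)
      then show False
      proof cases
        case 1
        then have "u (par i b a) = HS i a b" using t by (simp add: toward_def y_def)
        moreover have "u (par i a b) = HS i b a" using ab by (simp add: toward_def)
        ultimately show False
          using HS_disjoint[OF i e] HS_nonempty[OF i e] by (simp add: par_commute)
      next
        case 2
        then show False using x Ti.side_notin[of b a] e by (simp add: insert_commute)
      qed
    qed
    then show ?thesis using Ti.side_step[OF x xy] by (simp add: y_def)
  qed (use x in simp)
qed

lemma step_funpow_side: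
  assumes "u \<in> ultrafilters n T" "i < n" "toward u i a b" "x \<in> tree_side (T i) b a"
  shows "(step u i ^^ k) x \<in> tree_side (T i) b a"
  by (induction k) (use assms step_side in auto)

text \<open>A step that leaves \<open>a\<close> crosses an edge, stays on the far side by
  \<open>step_funpow_side\<close>, and so never returns to \<open>a\<close>.\<close>

lemma step_periodic_fixed:
  assumes u: "u \<in> ultrafilters n T" and i: "i < n" and "p > 0" "(step u i ^^ p) a = a"
  shows "step u i a = a"
proof (rule ccontr)
  assume "step u i a \<noteq> a"
  then have t: "toward u i a (step u i a)" using step_cases[OF u i] by blast
  have "step u i a \<in> tree_side (T i) (step u i a) a" by (rule tree.side_refl[OF trees[OF i]])
  then have "(step u i ^^ (p - 1)) (step u i a) \<in> tree_side (T i) (step u i a) a"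
    by (rule step_funpow_side[OF u i t])
  moreover have "(step u i ^^ (p - 1)) (step u i a) = (step u i ^^ Suc (p - 1)) a"
    by (simp add: funpow_swap1)
  ultimately have "a \<in> tree_side (T i) (step u i a) a" using assms(3,4) by simp
  then show False using t tree.side_notin[OF trees[OF i], of "step u i a" a]
    by (simp add: toward_def insert_commute)
qed

text \<open>The head \<open>b\<close> of an oriented edge stays on its side under iteration and
  merges with the fixed vertex \<open>w i\<close>, which is therefore on the chosen side.\<close>

lemma fixed_point_in_ultrafilter:
  assumes u: "u \<in> ultrafilters n T" and w: "w \<in> coords" "\<And>i. i < n \<Longrightarrow> step u i (w i) = w i"
    and h: "h \<in> hyperplanes n T"
  shows "vt w \<in> u h"
proof -
  obtain i a b where i: "i < n" "{a, b} \<in> uedges (T i)" "toward u i a b" "h = par i a b"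
  proof -
    from h obtain i a b where *: "i < n" "{a, b} \<in> uedges (T i)" "h = par i a b"
      by (auto simp: hyperplanes_eq)
    then consider "toward u i a b" | "toward u i b a" using toward_total[OF u] by blast
    then show ?thesis
    proof cases
      case 1
      then show ?thesis using that * by blast
    next
      case 2
      then show ?thesis using that[of i b a] * par_commute[of i a b] by (simp add: insert_commute)
    qed
  qed
  interpret Ti: tree "T i" by (rule trees[OF i(1)])
  have "b \<in> uverts (T i)" using Ti.edge_verts[OF i(2)] by simp
  then obtain p q where pq: "(step u i ^^ p) b = (step u i ^^ q) (w i)"
    using step_merge[OF u i(1)] coords_mem[OF w(1) i(1)] by blast
  have "(step u i ^^ q) (w i) = w i" by (induction q) (use w(2)[OF i(1)] in auto)
  with pq have "w i \<in> Ti.side b a"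
    using step_funpow_side[OF u i(1,3) Ti.side_refl, of p] by simp
  then show ?thesis using i w(1) by (simp add: toward_def vt_HS)
qed

text \<open>In a finite factor every orbit of \<open>step\<close> becomes periodic and hence reaches
  a fixed vertex. If all factors were finite, the tuple of these would be a vertex inducing
  \<open>u\<close>.\<close>

lemma boundary_infinite_factor:
  assumes u: "u \<in> roller_boundary n T"
  shows "\<exists>i<n. infinite (uverts (T i))"
proof (rule ccontr)
  assume "\<not> (\<exists>i<n. infinite (uverts (T i)))"
  then have fin: "finite (uverts (T i))" if "i < n" for i using that by blast
  have U: "u \<in> ultrafilters n T" using u by (simp add: roller_boundary_def)
  have "\<exists>a. a \<in> uverts (T i) \<and> step u i a = a" if i: "i < n" for i
  proof -
    obtain a where a: "a \<in> uverts (T i)" using tree.verts_nonempty[OF trees[OF i]] by blast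
    have "\<not> inj (\<lambda>k. (step u i ^^ k) a)"
    proof
      assume "inj (\<lambda>k. (step u i ^^ k) a)"
      moreover have "range (\<lambda>k. (step u i ^^ k) a) \<subseteq> uverts (T i)"
        using step_funpow_verts[OF U i a] by blast
      ultimately show False using fin[OF i] by (meson finite_imageD finite_subset infinite_UNIV_nat)
    qed
    then obtain k l where kl: "k < l" "(step u i ^^ k) a = (step u i ^^ l) a"
      unfolding inj_def by (metis linorder_neqE_nat)
    have "(step u i ^^ (l - k)) ((step u i ^^ k) a) = (step u i ^^ k) a"
    proof -
      have "(step u i ^^ (l - k)) ((step u i ^^ k) a) = (step u i ^^ (l - k + k)) a"
        by (simp only: funpow_add o_apply)
      then show ?thesis using kl by simp
    qed
    then have "step u i ((step u i ^^ k) a) = (step u i ^^ k) a"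
      using kl(1) by (intro step_periodic_fixed[OF U i, of "l - k"]) auto
    then show ?thesis using step_funpow_verts[OF U i a] by blast
  qed
  then obtain w where w: "\<And>i. i < n \<Longrightarrow> w i \<in> uverts (T i) \<and> step u i (w i) = w i" by metis
  have "restrict w {..<n} \<in> coords" using w by (auto simp: coords_def)
  moreover from this have "vt (restrict w {..<n}) \<in> V" by (simp add: vertices_eq)
  ultimately show False
    using u fixed_point_in_ultrafilter[OF U] w by (auto simp: roller_boundary_def)
qed

end

section \<open>Automorphisms of a product of trees\<close>

context trees
begin

definition dir_edge :: "nat \<Rightarrow> 'a prod_point \<Rightarrow> 'a prod_point \<Rightarrow> bool" where
  "dir_edge i x y \<longleftrightarrow> (\<exists>c b. c \<in> coords \<and> {c i, b} \<in> uedges (T i) \<and> x = vt c \<and> y = vt (c(i := b)))"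

definition hyp :: "'a prod_point set \<Rightarrow> 'a prod_point set set" where
  "hyp e = (opposite_edges n T)\<^sup>* `` {e}"

lemma vertices_subset: "V \<subseteq> tree_product n T"
  by (auto simp: vertices_def tree_product_def cubes_def)

lemma dir_edge_sym:
  assumes "i < n" "dir_edge i x y"
  shows "dir_edge i y x"
proof -
  obtain c b where c: "c \<in> coords" "{c i, b} \<in> uedges (T i)" "x = vt c" "y = vt (c(i := b))"
    using assms(2) unfolding dir_edge_def by blast
  have "{(c(i := b)) i, c i} \<in> uedges (T i)" using c(2) by (simp add: insert_commute)
  moreover have "c(i := b) \<in> coords" using c assms(1) coords_upd_edge by blast
  moreover have "x = vt ((c(i := b))(i := c i))" using c(3) by simp
  ultimately show ?thesis using c(4) unfolding dir_edge_def by blast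
qed

lemma dir_edge_iff: "{x, y} \<in> edges n T \<longleftrightarrow> (\<exists>i<n. dir_edge i x y)"
proof
  assume e: "{x, y} \<in> edges n T"
  then have "x \<in> V" using edges_subset by blast
  then obtain c where c: "c \<in> coords" "x = vt c" by (rule vertex_cases)
  with e edge_nbr[OF c(1), of y] show "\<exists>i<n. dir_edge i x y" unfolding dir_edge_def by blast
next
  assume "\<exists>i<n. dir_edge i x y"
  then show "{x, y} \<in> edges n T" unfolding dir_edge_def edge_iff by blast
qed

lemma dir_edge_verts:
  assumes "i < n" "dir_edge i x y"
  shows "x \<in> V" "y \<in> V"
  using assms edges_subset[of "{x, y}"] dir_edge_iff by blast+

lemma hyp_par:
  assumes "c \<in> coords" "i < n" "{c i, b} \<in> uedges (T i)"
  shows "hyp {vt c, vt (c(i := b))} = par i (c i) b"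
  using hyperplane_par[OF assms] by (simp add: hyp_def)

lemma par_dir_edge:
  assumes "i < n" "{a, b} \<in> uedges (T i)" "{x, y} \<in> par i a b"
  shows "dir_edge i x y"
proof -
  obtain c d where c: "c \<in> coords" "{c i, d} = {a, b}" "{x, y} = {vt c, vt (c(i := d))}"
    using assms(3) unfolding par_def by blast
  then have "{c i, d} \<in> uedges (T i)" using assms(2) by simp
  then have "dir_edge i (vt c) (vt (c(i := d)))" using c(1) unfolding dir_edge_def by blast
  moreover have "(x = vt c \<and> y = vt (c(i := d))) \<or> (y = vt c \<and> x = vt (c(i := d)))"
    using c(3) by (auto simp: doubleton_eq_iff)
  ultimately show ?thesis using dir_edge_sym[OF assms(1)] by auto
qed

lemma opposite_dir_edge:
  assumes "i < n" "dir_edge i x y" "({x, y}, {x', y'}) \<in> opposite_edges n T"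
  shows "dir_edge i x' y'"
proof -
  obtain c b where c: "c \<in> coords" "{c i, b} \<in> uedges (T i)" "x = vt c" "y = vt (c(i := b))"
    using assms(2) unfolding dir_edge_def by blast
  then have "{x, y} \<in> par i (c i) b" unfolding par_def by blast
  then have "{x', y'} \<in> par i (c i) b" using opposite_par[OF assms(3)] assms(1) c(2) by blast
  then show ?thesis using par_dir_edge assms(1) c(2) by blast
qed

text \<open>Together with \<open>dir_edges_span_square\<close> this recognizes directions without
  coordinates: two distinct edges at a vertex have the same direction exactly if no square contains
  both. Automorphisms respect this criterion.\<close>

lemma square_dir_edges:
  assumes i: "i < n" and Q: "Q \<in> squares n T" "x \<in> Q" "y \<in> Q" "y' \<in> Q" and d: "dir_edge i x y" "dir_edge i x y'"
  shows "y = y'"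
proof -
  obtain c b where c: "c \<in> coords" "{c i, b} \<in> uedges (T i)" "x = vt c" "y = vt (c(i := b))"
    using d(1) unfolding dir_edge_def by blast
  obtain c' b' where c': "c' \<in> coords" "{c' i, b'} \<in> uedges (T i)" "x = vt c'" "y' = vt (c'(i := b'))"
    using d(2) unfolding dir_edge_def by blast
  have "c' = c" using c c' vt_inject by blast
  obtain q k u l w where q: "Q = vt ` {q, q(k := u), q(l := w), q(k := u, l := w)}" "k \<noteq> l"
    using Q(1) unfolding square_iff by blast
  \<comment> \<open>On the square the coordinate \<open>i\<close> takes at most the values
    \<open>q i\<close> and \<open>z\<close>. As \<open>c i\<close> is one of them, \<open>b\<close>
    and \<open>b'\<close> are both the other.\<close>
  define z where "z = (if i = k then u else if i = l then w else q i)"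
  have z: "p i = q i \<or> p i = z" if "vt p \<in> Q" for p
  proof -
    from that obtain r where r: "vt p = vt r" "r \<in> {q, q(k := u), q(l := w), q(k := u, l := w)}"
      unfolding q(1) by blast
    have "vt p i = vt r i" using r(1) by simp
    then have "vertex_point (p i) = vertex_point (r i)" using i by (simp add: vt_def)
    then have "p i = r i" by (simp only: vertex_point_inject)
    then show ?thesis using r(2) q(2) by (auto simp: z_def)
  qed
  have "c i \<noteq> b" "c i \<noteq> b'" using edge_neq[OF i] c(2) c'(2) \<open>c' = c\<close> by auto
  moreover have "c i = q i \<or> c i = z" "b = q i \<or> b = z" "b' = q i \<or> b' = z"
    using z[of c] z[of "c(i := b)"] z[of "c(i := b')"] Q c c' \<open>c' = c\<close> by auto
  ultimately have "b = b'" by auto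
  then show ?thesis using c c' \<open>c' = c\<close> by simp
qed

lemma dir_edges_span_square:
  assumes ij: "i < n" "j < n" "i \<noteq> j" and d: "dir_edge i x y" "dir_edge j x y'"
  shows "\<exists>Q\<in>squares n T. x \<in> Q \<and> y \<in> Q \<and> y' \<in> Q"
proof -
  obtain c b where c: "c \<in> coords" "{c i, b} \<in> uedges (T i)" "x = vt c" "y = vt (c(i := b))"
    using d(1) unfolding dir_edge_def by blast
  obtain c' b' where c': "c' \<in> coords" "{c' j, b'} \<in> uedges (T j)" "x = vt c'" "y' = vt (c'(j := b'))"
    using d(2) unfolding dir_edge_def by blast
  have eq: "c' = c" using c c' vt_inject by blast
  then have "{c j, b'} \<in> uedges (T j)" using c'(2) by simp
  then have "vt ` {c, c(i := b), c(j := b'), c(i := b, j := b')} \<in> squares n T"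
    unfolding square_iff using c(1,2) ij
    by (intro exI[of _ c] exI[of _ i] exI[of _ b] exI[of _ j] exI[of _ b'] conjI) simp_all
  then show ?thesis
    by (rule bexI[rotated]) (use c(3,4) c'(4) eq in simp)
qed

text \<open>Together with \<open>flow_cases\<close> this describes the flow by edges, directions and
  halfspaces instead of coordinates, the form in which automorphisms carry it along.\<close>

lemma flow_dir_edge:
  assumes u: "u \<in> ultrafilters n T" and i: "i < n" and d: "dir_edge i x y" and y: "y \<in> u (hyp {x, y})"
  shows "flow i u x = y"
proof -
  obtain c b where c: "c \<in> coords" "{c i, b} \<in> uedges (T i)" "x = vt c" "y = vt (c(i := b))"
    using d unfolding dir_edge_def by blast
  interpret Ti: tree "T i" by (rule trees[OF i])
  have co: "c(i := b) \<in> coords" using c i coords_upd_edge by blast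
  have "y \<notin> HS i (c i) b" using vt_HS[OF co] Ti.side_notin[OF c(2)] c(4) by simp
  then have "u (par i (c i) b) = HS i b (c i)"
    using ultrafilter_par[OF u i c(2)] y hyp_par[OF c(1) i c(2)] c(3,4) by auto
  then have "toward u i (c i) b" using c(2) by (simp add: toward_def)
  then show ?thesis using c step_toward[OF u i] by (simp add: flow_vt)
qed

lemma flow_cases:
  assumes u: "u \<in> ultrafilters n T" and i: "i < n" and x: "x \<in> V"
  shows "flow i u x = x \<or> (dir_edge i x (flow i u x) \<and> flow i u x \<in> u (hyp {x, flow i u x}))"
proof -
  obtain c where c: "c \<in> coords" "x = vt c" using x by (rule vertex_cases)
  from step_cases[OF u i, of "c i"] show ?thesis
  proof
    assume "step u i (c i) = c i"
    then show ?thesis using c by (simp add: flow_vt)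
  next
    assume t: "toward u i (c i) (step u i (c i))"
    define b where "b = step u i (c i)"
    have e: "{c i, b} \<in> uedges (T i)" "u (par i (c i) b) = HS i b (c i)"
      using t by (auto simp: toward_def b_def)
    have f: "flow i u x = vt (c(i := b))" using c by (simp add: flow_vt b_def)
    have "c(i := b) \<in> coords" using c i e coords_upd_edge by blast
    then have "vt (c(i := b)) \<in> HS i b (c i)"
      by (simp add: vt_HS tree.side_refl[OF trees[OF i]])
    moreover have "dir_edge i x (vt (c(i := b)))" using c e unfolding dir_edge_def by blast
    ultimately show ?thesis using f e hyp_par[OF c(1) i e(1)] c(2) by simp
  qed
qed

lemma hyperplanes_hyp: "hyperplanes n T = hyp ` edges n T"
  by (auto simp: hyperplanes_def quotient_def hyp_def)

lemma hyp_subset: "e \<in> edges n T \<Longrightarrow> hyp e \<subseteq> edges n T"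
proof -
  assume e: "e \<in> edges n T"
  have "f \<in> edges n T" if "(e, f) \<in> (opposite_edges n T)\<^sup>*" for f
    using that by (induction rule: rtrancl_induct) (auto simp: e opposite_edges_def)
  then show ?thesis by (auto simp: hyp_def)
qed

lemma halfspace_subset:
  assumes "S \<in> halfspaces n T h"
  shows "S \<subseteq> V"
proof -
  obtain x where x: "x \<in> V" "S = {(x, y). {x, y} \<in> edges n T - h}\<^sup>* `` {x}"
    using assms by (auto simp: halfspaces_def quotient_def)
  have "y \<in> V" if "(x, y) \<in> {(x, y). {x, y} \<in> edges n T - h}\<^sup>*" for y
    using that by (induction rule: rtrancl_induct) (use x edges_subset in auto)
  then show ?thesis using x by auto
qed

lemma ultrafilter_subset:
  assumes "u \<in> ultrafilters n T" "h \<in> hyperplanes n T"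
  shows "u h \<subseteq> V"
  using assms halfspace_subset by (fastforce simp: ultrafilters_def)

end

text \<open>The inverse is kept as a second automorphism, so that \<open>swap\<close> yields every
  fact for it as well.\<close>

locale cube_iso = trees n T for n :: nat and T :: "nat \<Rightarrow> 'a ugraph" +
  fixes \<alpha> \<beta> :: "'a prod_point \<Rightarrow> 'a prod_point"
  assumes aut: "cube_automorphism n T \<alpha>" "cube_automorphism n T \<beta>"
    and inverse: "\<And>x. x \<in> tree_product n T \<Longrightarrow> \<beta> (\<alpha> x) = x" "\<And>x. x \<in> tree_product n T \<Longrightarrow> \<alpha> (\<beta> x) = x"
begin

lemma swap: "cube_iso n T \<beta> \<alpha>"
  by unfold_locales (use aut inverse in auto)

lemma inverse_V: "x \<in> V \<Longrightarrow> \<beta> (\<alpha> x) = x" "x \<in> V \<Longrightarrow> \<alpha> (\<beta> x) = x"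
  using inverse vertices_subset by auto

lemma inj: "inj_on \<alpha> (tree_product n T)"
  by (rule inj_on_inverseI[of _ \<beta>]) (rule inverse(1))

lemma inj_V: "inj_on \<alpha> V"
  using inj vertices_subset by (rule inj_on_subset)

text \<open>The image of a vertex is a cube with a single point, and this point is a vertex because
  every cube contains one.\<close>

lemma vertex_image:
  assumes "x \<in> V"
  shows "\<alpha> x \<in> V"
proof -
  obtain c where c: "c \<in> coords" "x = vt c" using assms by (rule vertex_cases)
  have "(\<Pi>\<^sub>E i\<in>{..<n}. cell_points {c i}) \<in> cubes_of_dim n T (card {})"
    using cube_memI[of "\<lambda>i. {c i}" "{}"] single_not_edge coords_mem[OF c(1)] by (simp add: tree_cells_def)
  moreover have "(\<Pi>\<^sub>E i\<in>{..<n}. cell_points {c i}) = {x}"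
  proof -
    have "(\<Pi>\<^sub>E i\<in>{..<n}. cell_points {c i}) = (\<Pi>\<^sub>E i\<in>{..<n}. {vt c i})"
      by (intro PiE_cong) (simp add: cell_points_single vt_def)
    also have "\<dots> = {vt c}" by (rule PiE_singleton) (simp add: vt_def extensional_def)
    finally show ?thesis using c(2) by simp
  qed
  ultimately have "{x} \<in> cubes n T" by (auto simp: cubes_def)
  then have "\<alpha> ` {x} \<in> cubes n T" using aut(1) unfolding cube_automorphism_def by blast
  then obtain k where "{\<alpha> x} \<in> cubes_of_dim n T k" by (auto simp: cubes_def)
  then have "card ({\<alpha> x} \<inter> V) = 2 ^ k" using cube_vertices_card by blast
  then show ?thesis by (cases "\<alpha> x \<in> V") auto
qed

lemma vertex_image': "x \<in> V \<Longrightarrow> \<beta> x \<in> V"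
  by (rule cube_iso.vertex_image[OF swap])

lemma cube_image_vertices:
  assumes "C \<subseteq> tree_product n T"
  shows "\<alpha> ` (C \<inter> V) = \<alpha> ` C \<inter> V"
proof
  show "\<alpha> ` C \<inter> V \<subseteq> \<alpha> ` (C \<inter> V)"
  proof
    fix y assume "y \<in> \<alpha> ` C \<inter> V"
    then obtain x where x: "x \<in> C" "y = \<alpha> x" "y \<in> V" by blast
    then have "x = \<beta> y" using assms inverse(1) by auto
    then have "x \<in> V" using vertex_image'[OF x(3)] by simp
    with x show "y \<in> \<alpha> ` (C \<inter> V)" by blast
  qed
qed (use vertex_image in auto)

text \<open>The map is injective on vertices, and the number of vertices of a cube determines its
  dimension.\<close>

lemma cube_image:
  assumes C: "C \<in> cubes_of_dim n T k"
  shows "\<alpha> ` C \<in> cubes_of_dim n T k"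
proof -
  have sub: "C \<subseteq> tree_product n T" using C by (auto simp: tree_product_def cubes_def)
  have "C \<in> cubes n T" using C by (auto simp: cubes_def)
  then have "\<alpha> ` C \<in> cubes n T" using aut(1) unfolding cube_automorphism_def by blast
  then obtain l where l: "\<alpha> ` C \<in> cubes_of_dim n T l" by (auto simp: cubes_def)
  have "2 ^ l = card (\<alpha> ` (C \<inter> V))" using cube_vertices_card[OF l] cube_image_vertices[OF sub] by simp
  also have "\<dots> = card (C \<inter> V)" by (rule card_image[OF inj_on_subset[OF inj_V Int_lower2]])
  also have "\<dots> = 2 ^ k" using cube_vertices_card[OF C] by simp
  finally show ?thesis using l by simp
qed

lemma edge_image: "e \<in> edges n T \<Longrightarrow> \<alpha> ` e \<in> edges n T"
proof -
  assume "e \<in> edges n T"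
  then obtain C where C: "C \<in> cubes_of_dim n T 1" "e = C \<inter> V" unfolding edges_def by blast
  then have "C \<subseteq> tree_product n T" by (auto simp: tree_product_def cubes_def)
  then have "\<alpha> ` e = \<alpha> ` C \<inter> V" using C(2) cube_image_vertices by simp
  then show ?thesis using cube_image[OF C(1)] unfolding edges_def by blast
qed

lemma square_image: "e \<in> squares n T \<Longrightarrow> \<alpha> ` e \<in> squares n T"
proof -
  assume "e \<in> squares n T"
  then obtain C where C: "C \<in> cubes_of_dim n T 2" "e = C \<inter> V" unfolding squares_def by blast
  then have "C \<subseteq> tree_product n T" by (auto simp: tree_product_def cubes_def)
  then have "\<alpha> ` e = \<alpha> ` C \<inter> V" using C(2) cube_image_vertices by simp
  then show ?thesis using cube_image[OF C(1)] unfolding squares_def by blast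
qed

lemma image_inverse: "S \<subseteq> V \<Longrightarrow> \<beta> ` \<alpha> ` S = S" "S \<subseteq> V \<Longrightarrow> \<alpha> ` \<beta> ` S = S"
  using inverse_V by (force simp: image_image)+

lemma adjacent_image: "(x, y) \<in> adjacent \<Longrightarrow> (\<alpha> x, \<alpha> y) \<in> adjacent"
  using edge_image[of "{x, y}"] by (simp add: adjacent_def)

lemma opposite_image:
  assumes "(e, f) \<in> opposite_edges n T"
  shows "(\<alpha> ` e, \<alpha> ` f) \<in> opposite_edges n T"
proof -
  have ef: "e \<in> edges n T" "f \<in> edges n T" "e \<inter> f = {}" "e \<union> f \<in> squares n T"
    using assms by (auto simp: opposite_edges_def)
  have "\<alpha> ` e \<inter> \<alpha> ` f = {}"
    using inj_V edges_subset[OF ef(1)] edges_subset[OF ef(2)] ef(3)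
    by (metis image_empty inj_on_image_Int)
  then show ?thesis
    using edge_image ef square_image[OF ef(4)] by (simp add: opposite_edges_def image_Un)
qed

lemma opposite_rtrancl_image:
  "(e, f) \<in> (opposite_edges n T)\<^sup>* \<Longrightarrow> (\<alpha> ` e, \<alpha> ` f) \<in> (opposite_edges n T)\<^sup>*"
  by (induction rule: rtrancl_induct) (auto intro: opposite_image rtrancl_into_rtrancl)

lemma hyp_image_subset: "(`) \<alpha> ` hyp e \<subseteq> hyp (\<alpha> ` e)"
  using opposite_rtrancl_image by (auto simp: hyp_def)

lemma hyp_image:
  assumes "e \<in> edges n T"
  shows "(`) \<alpha> ` hyp e = hyp (\<alpha> ` e)"
proof
  show "hyp (\<alpha> ` e) \<subseteq> (`) \<alpha> ` hyp e"
  proof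
    fix f assume f: "f \<in> hyp (\<alpha> ` e)"
    then have "f \<subseteq> V" using hyp_subset[OF edge_image[OF assms]] edges_subset by blast
    then have "f = \<alpha> ` (\<beta> ` f)" by (simp add: image_inverse)
    moreover have "\<beta> ` f \<in> hyp (\<beta> ` \<alpha> ` e)"
      using cube_iso.hyp_image_subset[OF swap, of "\<alpha> ` e"] f by blast
    then have "\<beta> ` f \<in> hyp e" using image_inverse(1)[OF edges_subset[OF assms]] by simp
    ultimately show "f \<in> (`) \<alpha> ` hyp e" by blast
  qed
qed (rule hyp_image_subset)

lemma hyperplane_image: "h \<in> hyperplanes n T \<Longrightarrow> (`) \<alpha> ` h \<in> hyperplanes n T"
  using hyp_image edge_image unfolding hyperplanes_hyp by blast

lemma hyperplane_subset:
  assumes "h \<in> hyperplanes n T" "e \<in> h"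
  shows "e \<subseteq> V"
  using assms hyp_subset edges_subset unfolding hyperplanes_hyp by blast

lemma hyperplane_image_inverse:
  assumes "h \<in> hyperplanes n T"
  shows "(`) \<beta> ` (`) \<alpha> ` h = h" "(`) \<alpha> ` (`) \<beta> ` h = h"
proof -
  have "(`) \<beta> ` (`) \<alpha> ` h = (\<lambda>e. \<beta> ` \<alpha> ` e) ` h" by (simp add: image_image)
  also have "\<dots> = (\<lambda>e. e) ` h" using hyperplane_subset[OF assms] image_inverse by (intro image_cong) auto
  finally show "(`) \<beta> ` (`) \<alpha> ` h = h" by simp
  have "(`) \<alpha> ` (`) \<beta> ` h = (\<lambda>e. \<alpha> ` \<beta> ` e) ` h" by (simp add: image_image)
  also have "\<dots> = (\<lambda>e. e) ` h" using hyperplane_subset[OF assms] image_inverse by (intro image_cong) auto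
  finally show "(`) \<alpha> ` (`) \<beta> ` h = h" by simp
qed

lemma component_step:
  assumes "h \<in> hyperplanes n T" "(x, y) \<in> {(x, y). {x, y} \<in> edges n T - h}\<^sup>*"
  shows "(\<alpha> x, \<alpha> y) \<in> {(x, y). {x, y} \<in> edges n T - (`) \<alpha> ` h}\<^sup>*"
  using assms(2)
proof (induction rule: rtrancl_induct)
  case (step y z)
  have yz: "{y, z} \<in> edges n T" "{y, z} \<notin> h" using step(2) by auto
  have "\<alpha> ` {y, z} \<in> edges n T" by (rule edge_image[OF yz(1)])
  moreover have "\<alpha> ` {y, z} \<notin> (`) \<alpha> ` h"
  proof
    assume "\<alpha> ` {y, z} \<in> (`) \<alpha> ` h"
    then obtain e where e: "e \<in> h" "\<alpha> ` {y, z} = \<alpha> ` e" by blast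
    then have "{y, z} = e"
      using inj_on_image_eq_iff[OF inj_V edges_subset[OF yz(1)] hyperplane_subset[OF assms(1) e(1)]] by simp
    then show False using e yz by simp
  qed
  ultimately have "(\<alpha> y, \<alpha> z) \<in> {(x, y). {x, y} \<in> edges n T - (`) \<alpha> ` h}" by simp
  with step.IH show ?case by (rule rtrancl_into_rtrancl)
qed simp

lemma component_image:
  assumes h: "h \<in> hyperplanes n T" and x: "x \<in> V"
  shows "\<alpha> ` ({(x, y). {x, y} \<in> edges n T - h}\<^sup>* `` {x}) =
     {(x, y). {x, y} \<in> edges n T - (`) \<alpha> ` h}\<^sup>* `` {\<alpha> x}"
proof
  let ?R = "\<lambda>h. {(x, y). {x, y} \<in> edges n T - h}"
  show "\<alpha> ` ((?R h)\<^sup>* `` {x}) \<subseteq> (?R ((`) \<alpha> ` h))\<^sup>* `` {\<alpha> x}"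
    using component_step[OF h] by blast
  show "(?R ((`) \<alpha> ` h))\<^sup>* `` {\<alpha> x} \<subseteq> \<alpha> ` ((?R h)\<^sup>* `` {x})"
  proof
    fix y assume y: "y \<in> (?R ((`) \<alpha> ` h))\<^sup>* `` {\<alpha> x}"
    have "(?R ((`) \<alpha> ` h))\<^sup>* `` {\<alpha> x} \<in> halfspaces n T ((`) \<alpha> ` h)"
      unfolding halfspaces_def using vertex_image[OF x] by (rule quotientI)
    then have "y \<in> V" using halfspace_subset y by blast
    have "(\<beta> (\<alpha> x), \<beta> y) \<in> (?R ((`) \<beta> ` (`) \<alpha> ` h))\<^sup>*"
      using cube_iso.component_step[OF swap hyperplane_image[OF h]] y by blast
    then have "(x, \<beta> y) \<in> (?R h)\<^sup>*" unfolding hyperplane_image_inverse(1)[OF h] inverse_V(1)[OF x] .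
    moreover have "y = \<alpha> (\<beta> y)" using inverse_V \<open>y \<in> V\<close> by simp
    ultimately show "y \<in> \<alpha> ` ((?R h)\<^sup>* `` {x})" by blast
  qed
qed

lemma halfspace_image:
  assumes "h \<in> hyperplanes n T" "S \<in> halfspaces n T h"
  shows "\<alpha> ` S \<in> halfspaces n T ((`) \<alpha> ` h)"
proof -
  obtain x where x: "x \<in> V" "S = {(x, y). {x, y} \<in> edges n T - h}\<^sup>* `` {x}"
    using assms(2) by (auto simp: halfspaces_def quotient_def)
  show ?thesis
    unfolding x(2) component_image[OF assms(1) x(1)] unfolding halfspaces_def
    by (rule quotientI[OF vertex_image[OF x(1)]])
qed

lemma hyperplane_image': "h \<in> hyperplanes n T \<Longrightarrow> (`) \<beta> ` h \<in> hyperplanes n T"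
  by (rule cube_iso.hyperplane_image[OF swap])

lemma roller_map_eq:
  assumes "h \<in> hyperplanes n T"
  shows "roller_map n T \<alpha> u h = \<alpha> ` u ((`) \<beta> ` h)"
proof -
  have "inv_into (tree_product n T) \<alpha> x = \<beta> x" if "x \<in> V" for x
    using that inverse inj vertices_subset vertex_image' by (intro inv_into_f_eq) auto
  then have "(\<lambda>e. inv_into (tree_product n T) \<alpha> ` e) ` h = (`) \<beta> ` h"
    using hyperplane_subset[OF assms] by (intro image_cong) (auto simp: subset_iff)
  then show ?thesis using assms by (simp add: roller_map_def)
qed

lemma roller_map_image:
  assumes "h \<in> hyperplanes n T"
  shows "roller_map n T \<alpha> u ((`) \<alpha> ` h) = \<alpha> ` u h"
  using roller_map_eq[OF hyperplane_image[OF assms]] hyperplane_image_inverse(1)[OF assms] by simp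

lemma roller_map_ultrafilter:
  assumes u: "u \<in> ultrafilters n T"
  shows "roller_map n T \<alpha> u \<in> ultrafilters n T"
proof -
  have "roller_map n T \<alpha> u h \<in> halfspaces n T h" if h: "h \<in> hyperplanes n T" for h
  proof -
    have "u ((`) \<beta> ` h) \<in> halfspaces n T ((`) \<beta> ` h)"
      using u hyperplane_image'[OF h] by (auto simp: ultrafilters_def)
    then have "\<alpha> ` u ((`) \<beta> ` h) \<in> halfspaces n T ((`) \<alpha> ` (`) \<beta> ` h)"
      by (rule halfspace_image[OF hyperplane_image'[OF h]])
    then show ?thesis using roller_map_eq[OF h] hyperplane_image_inverse(2)[OF h] by simp
  qed
  moreover have "roller_map n T \<alpha> u \<in> extensional (hyperplanes n T)" by (simp add: roller_map_def)
  moreover have "roller_map n T \<alpha> u h \<inter> roller_map n T \<alpha> u k \<noteq> {}"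
    if "h \<in> hyperplanes n T" "k \<in> hyperplanes n T" for h k
  proof -
    have "u ((`) \<beta> ` h) \<inter> u ((`) \<beta> ` k) \<noteq> {}"
      using u that hyperplane_image' by (auto simp: ultrafilters_def)
    then show ?thesis unfolding roller_map_eq[OF that(1)] roller_map_eq[OF that(2)] by blast
  qed
  ultimately show ?thesis by (auto simp: ultrafilters_def PiE_iff)
qed

lemma roller_map_boundary:
  assumes "u \<in> roller_boundary n T"
  shows "roller_map n T \<alpha> u \<in> roller_boundary n T"
proof -
  have u: "u \<in> ultrafilters n T" using assms by (simp add: roller_boundary_def)
  have False if v: "v \<in> V" "\<And>h. h \<in> hyperplanes n T \<Longrightarrow> v \<in> roller_map n T \<alpha> u h" for v
  proof -
    have "\<beta> v \<in> u h" if h: "h \<in> hyperplanes n T" for h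
    proof -
      have "v \<in> \<alpha> ` u h" using v(2)[OF hyperplane_image[OF h]] roller_map_image[OF h] by simp
      then obtain x where "x \<in> u h" "v = \<alpha> x" by blast
      then show ?thesis using ultrafilter_subset[OF u h] inverse_V(1) by auto
    qed
    then show False using assms vertex_image'[OF v(1)] by (auto simp: roller_boundary_def)
  qed
  then show ?thesis using roller_map_ultrafilter[OF u] by (auto simp: roller_boundary_def)
qed

section \<open>Directions of edges under automorphisms\<close>

lemma opposite_image_dir_edge:
  assumes "j < n" "dir_edge j (\<alpha> x) (\<alpha> y)" "({x, y}, {x', y'}) \<in> opposite_edges n T"
  shows "dir_edge j (\<alpha> x') (\<alpha> y')"
  using opposite_dir_edge[OF assms(1,2)] opposite_image[OF assms(3)] by simp

text \<open>If the images had different directions, they would span a square, and its preimage would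
  contain two edges at \<open>x\<close> of the same direction, which forces
  \<open>y = y'\<close>.\<close>

lemma dir_edge_image_vertex:
  assumes ij: "i < n" "j < n" and d: "dir_edge i x y" "dir_edge i x y'" and a: "dir_edge j (\<alpha> x) (\<alpha> y)"
  shows "dir_edge j (\<alpha> x) (\<alpha> y')"
proof -
  have e: "{x, y'} \<in> edges n T" using dir_edge_iff d ij by blast
  have V: "x \<in> V" "y \<in> V" "y' \<in> V" using dir_edge_verts[OF ij(1)] d by blast+
  have "{\<alpha> x, \<alpha> y'} \<in> edges n T" using edge_image[OF e] by simp
  then obtain k where k: "k < n" "dir_edge k (\<alpha> x) (\<alpha> y')" using dir_edge_iff by blast
  show ?thesis
  proof (cases "k = j")
    case False
    then obtain Q where Q: "Q \<in> squares n T" "\<alpha> x \<in> Q" "\<alpha> y \<in> Q" "\<alpha> y' \<in> Q"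
      using dir_edges_span_square[OF ij(2) k(1) _ a k(2)] by blast
    have "\<beta> ` Q \<in> squares n T" by (rule cube_iso.square_image[OF swap Q(1)])
    moreover have "x \<in> \<beta> ` Q" "y \<in> \<beta> ` Q" "y' \<in> \<beta> ` Q"
      using Q(2-4) inverse_V(1) V by (metis imageI)+
    ultimately have "y = y'" using square_dir_edges ij(1) d by blast
    then show ?thesis using a by simp
  qed (use k in simp)
qed

text \<open>The direction of the image spreads along a path of vertices: a step in another direction
  passes to the opposite edge of a square, and a step in direction \<open>i\<close> reverses the
  edge just traversed and applies \<open>dir_edge_image_vertex\<close> at its other end.\<close>

lemma dir_edge_image:
  assumes ij: "i < n" "j < n" and d: "dir_edge i x y" and a: "dir_edge j (\<alpha> x) (\<alpha> y)" and d': "dir_edge i x' y'"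
  shows "dir_edge j (\<alpha> x') (\<alpha> y')"
proof -
  obtain c where c: "c \<in> coords" "x = vt c" using d unfolding dir_edge_def by blast
  obtain c' where c': "c' \<in> coords" "x' = vt c'" using d' unfolding dir_edge_def by blast
  have "(c, c') \<in> {(c, c(j := b)) | c j b. c \<in> coords \<and> j \<in> {..<n} \<and> {c j, b} \<in> uedges (T j)}\<^sup>*"
    using coords_ext[OF c(1)] coords_ext[OF c'(1)]
    by (intro coords_connected c c') (auto simp: extensional_def)
  then have "\<forall>b. {c' i, b} \<in> uedges (T i) \<longrightarrow> dir_edge j (\<alpha> (vt c')) (\<alpha> (vt (c'(i := b))))"
  proof (induction c' rule: rtrancl_induct)
    case base
    show ?case
    proof (intro allI impI)
      fix b assume "{c i, b} \<in> uedges (T i)"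
      then have "dir_edge i x (vt (c(i := b)))" using c unfolding dir_edge_def by blast
      then show "dir_edge j (\<alpha> (vt c)) (\<alpha> (vt (c(i := b))))"
        using dir_edge_image_vertex[OF ij d _ a] c(2) by simp
    qed
  next
    case (step p q)
    then obtain l e where q: "q = p(l := e)" "p \<in> coords" "l < n" "{p l, e} \<in> uedges (T l)" by auto
    have qc: "q \<in> coords" using q coords_upd_edge by blast
    show ?case
    proof (intro allI impI)
      fix b assume b: "{q i, b} \<in> uedges (T i)"
      show "dir_edge j (\<alpha> (vt q)) (\<alpha> (vt (q(i := b))))"
      proof (cases "l = i")
        case True
        have pq: "dir_edge i (vt p) (vt q)" using q True unfolding dir_edge_def by blast
        have "dir_edge j (\<alpha> (vt p)) (\<alpha> (vt q))" using step.IH q True by blast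
        then have "dir_edge j (\<alpha> (vt q)) (\<alpha> (vt p))" using dir_edge_sym ij(2) by blast
        moreover have "dir_edge i (vt q) (vt p)" using pq dir_edge_sym ij(1) by blast
        moreover have "dir_edge i (vt q) (vt (q(i := b)))" using qc b unfolding dir_edge_def by blast
        ultimately show ?thesis using dir_edge_image_vertex[OF ij] by blast
      next
        case False
        have pb: "{p i, b} \<in> uedges (T i)" using b q(1) False by simp
        have "({vt p, vt (p(i := b))}, {vt q, vt (q(i := b))}) \<in> opposite_edges n T"
          using opposite_move[OF q(2) ij(1) q(3) _ pb q(4)] False q(1) by simp
        moreover have "dir_edge j (\<alpha> (vt p)) (\<alpha> (vt (p(i := b))))" using step.IH pb by blast
        ultimately show ?thesis using opposite_image_dir_edge ij(2) by blast
      qed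
    qed
  qed
  moreover obtain c'' b where "c'' \<in> coords" "{c'' i, b} \<in> uedges (T i)" "x' = vt c''" "y' = vt (c''(i := b))"
    using d' unfolding dir_edge_def by blast
  ultimately show ?thesis using c' vt_inject by metis
qed

text \<open>Directions must be preserved by the inverse as well: to see that a fixed vertex stays
  fixed, an edge leaving its image is pulled back.\<close>

lemma flow_image:
  assumes pres: "\<And>i x y. i < n \<Longrightarrow> dir_edge i x y \<Longrightarrow> dir_edge i (\<alpha> x) (\<alpha> y)"
    "\<And>i x y. i < n \<Longrightarrow> dir_edge i x y \<Longrightarrow> dir_edge i (\<beta> x) (\<beta> y)"
    and u: "u \<in> ultrafilters n T" and i: "i < n" and x: "x \<in> V"
  shows "flow i (roller_map n T \<alpha> u) (\<alpha> x) = \<alpha> (flow i u x)"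
proof -
  let ?u = "roller_map n T \<alpha> u"
  have U: "?u \<in> ultrafilters n T" by (rule roller_map_ultrafilter[OF u])
  have transfer: "\<alpha> y \<in> ?u (hyp {\<alpha> x, \<alpha> y}) \<longleftrightarrow> y \<in> u (hyp {x, y})" if d: "dir_edge i x y" for y
  proof -
    have e: "{x, y} \<in> edges n T" using d i dir_edge_iff by blast
    have h: "hyp {x, y} \<in> hyperplanes n T" using e by (auto simp: hyperplanes_hyp)
    have y: "y \<in> V" using dir_edge_verts[OF i d] by simp
    have "?u (hyp {\<alpha> x, \<alpha> y}) = \<alpha> ` u (hyp {x, y})"
      using roller_map_image[OF h, of u] hyp_image[OF e] by simp
    then show ?thesis using inj_on_image_mem_iff[OF inj_V y ultrafilter_subset[OF u h]] by simp
  qed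
  from flow_cases[OF u i x] show ?thesis
  proof
    assume "dir_edge i x (flow i u x) \<and> flow i u x \<in> u (hyp {x, flow i u x})"
    then show ?thesis using transfer pres(1)[OF i] flow_dir_edge[OF U i] by blast
  next
    assume fx: "flow i u x = x"
    have "flow i ?u (\<alpha> x) = \<alpha> x"
    proof (rule ccontr)
      assume "flow i ?u (\<alpha> x) \<noteq> \<alpha> x"
      then obtain z where z: "dir_edge i (\<alpha> x) z" "z \<in> ?u (hyp {\<alpha> x, z})"
        using flow_cases[OF U i vertex_image[OF x]] by blast
      have "z \<in> V" using dir_edge_verts[OF i z(1)] by simp
      then have zz: "\<alpha> (\<beta> z) = z" by (rule inverse_V(2))
      have d: "dir_edge i x (\<beta> z)" using pres(2)[OF i z(1)] inverse_V(1)[OF x] by simp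
      then have "\<beta> z \<in> u (hyp {x, \<beta> z})" using transfer[OF d] z(2) zz by simp
      then have "flow i u x = \<beta> z" by (rule flow_dir_edge[OF u i d])
      then have "\<beta> z = x" using fx by simp
      obtain c b where c: "c \<in> coords" "{c i, b} \<in> uedges (T i)" "x = vt c" "\<beta> z = vt (c(i := b))"
        using d unfolding dir_edge_def by blast
      then show False
        using \<open>\<beta> z = x\<close> vt_inject[of "c(i := b)" c] coords_upd_edge[OF c(1) i c(2)] edge_neq[OF i c(2)]
        by (metis fun_upd_same)
    qed
    then show ?thesis using fx by simp
  qed
qed

end

section \<open>The Borel structure of the Roller boundary\<close>

context trees
begin

abbreviation X where "X \<equiv> roller_topology n T"
abbreviation M where "M \<equiv> roller_boundary_borel n T"

lemma topspace_roller: "topspace X = ultrafilters n T"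
  by (auto simp: roller_topology_def ultrafilters_def)

lemma boundary_subset: "roller_boundary n T \<subseteq> ultrafilters n T"
  by (auto simp: roller_boundary_def)

lemma opens_subset: "{U. openin X U} \<subseteq> Pow (topspace X)"
  using openin_subset by blast

lemma space_borel: "space (borel_of_topology X) = ultrafilters n T"
  by (simp add: borel_of_topology_def space_measure_of_conv topspace_roller)

lemma space_M: "space M = roller_boundary n T"
  using boundary_subset by (auto simp: roller_boundary_borel_def space_restrict_space space_borel)

lemma open_borel: "openin X U \<Longrightarrow> U \<in> sets (borel_of_topology X)"
  using opens_subset by (auto simp: borel_of_topology_def sets_measure_of)

lemma continuous_coordinate:
  assumes "h \<in> hyperplanes n T"
  shows "continuous_map X (discrete_topology (halfspaces n T h)) (\<lambda>u. u h)"
  unfolding roller_topology_def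
  by (intro continuous_map_from_subtopology continuous_map_product_projection assms)

lemma pred_coordinate:
  assumes h: "h \<in> hyperplanes n T"
  shows "Measurable.pred M (\<lambda>u. P (u h))"
proof -
  have "openin X {u \<in> topspace X. u h \<in> {S \<in> halfspaces n T h. P S}}"
    by (rule openin_continuous_map_preimage[OF continuous_coordinate[OF h]]) auto
  then have "{u \<in> topspace X. u h \<in> {S \<in> halfspaces n T h. P S}} \<in> sets (borel_of_topology X)"
    by (rule open_borel)
  then have "{u \<in> topspace X. u h \<in> {S \<in> halfspaces n T h. P S}} \<inter> roller_boundary n T \<in> sets M"
    unfolding roller_boundary_borel_def sets_restrict_space by blast
  also have "{u \<in> topspace X. u h \<in> {S \<in> halfspaces n T h. P S}} \<inter> roller_boundary n T =
      {u \<in> space M. P (u h)}"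
    using boundary_subset h by (auto simp: space_M topspace_roller ultrafilters_def)
  finally show ?thesis by (simp add: pred_def)
qed

lemma pred_flow:
  assumes i: "i < n" and x: "x \<in> V"
  shows "Measurable.pred M (\<lambda>u. flow i u x = y)"
proof -
  \<comment> \<open>\<open>Q z u\<close> says that the flow leaves \<open>x\<close> along the edge
    to \<open>z\<close>. The vertex stays put exactly if this fails for all of the countably many
    \<open>z\<close>.\<close>
  define Q where "Q z u \<longleftrightarrow> dir_edge i x z \<and> z \<in> u (hyp {x, z})" for z and u :: "'a halfspace_choice"
  have 1: "Measurable.pred M (Q z)" for z
  proof (cases "dir_edge i x z")
    case True
    then have "hyp {x, z} \<in> hyperplanes n T" using i dir_edge_iff hyperplanes_hyp by blast
    then show ?thesis unfolding Q_def[abs_def] using True pred_coordinate by auto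
  qed (simp add: Q_def[abs_def])
  have "Measurable.pred M (\<lambda>u. Q y u \<or> (y = x \<and> (\<forall>z\<in>V. \<not> Q z u)))"
    by (intro pred_intros_logic pred_all_countable countable_vertices 1) simp
  also have "?this \<longleftrightarrow> Measurable.pred M (\<lambda>u. flow i u x = y)"
  proof (rule pred_cong)
    fix u assume "u \<in> space M"
    then have u: "u \<in> ultrafilters n T" using boundary_subset space_M by auto
    have 2: "flow i u x = z" if "Q z u" for z
      using flow_dir_edge[OF u i] that by (auto simp: Q_def)
    have 3: "flow i u x = x \<or> (flow i u x \<in> V \<and> Q (flow i u x) u)"
      using flow_cases[OF u i x] dir_edge_verts[OF i] by (auto simp: Q_def)
    show "Q y u \<or> (y = x \<and> (\<forall>z\<in>V. \<not> Q z u)) \<longleftrightarrow> flow i u x = y"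
      using 2 3 by blast
  qed
  finally show ?thesis .
qed

lemma flow_closed:
  assumes "u \<in> ultrafilters n T" "i < n" "x \<in> V"
  shows "flow i u x \<in> V"
  using flow_step[OF assms] adjacent_subset assms(3) by auto

lemma measurable_flow:
  assumes "i < n" "x \<in> V"
  shows "(\<lambda>u. flow i u x) \<in> measurable M (count_space V)"
proof (rule measurable_countable_pred[OF countable_vertices])
  show "flow i u x \<in> V" if "u \<in> space M" for u
    using flow_closed[OF _ assms] that boundary_subset space_M by blast
qed (rule pred_flow[OF assms])

lemma countable_edges: "countable (edges n T)"
proof (rule countable_subset)
  show "edges n T \<subseteq> (\<lambda>(x, y). {x, y}) ` (V \<times> V)"
  proof
    fix e assume e: "e \<in> edges n T"
    then obtain x y where "e = {x, y}" unfolding edge_iff by blast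
    with edges_subset[OF e] show "e \<in> (\<lambda>(x, y). {x, y}) ` (V \<times> V)" by auto
  qed
qed (use countable_vertices in auto)

text \<open>The basic sets are numbered by codes of pairs of a vertex and a hyperplane. Numbers that
  code no pair give the empty set, so that the family is total even if there are no
  hyperplanes.\<close>

definition separator :: "nat \<Rightarrow> 'a halfspace_choice set" where
  "separator k = {u \<in> roller_boundary n T. \<exists>x h. x \<in> V \<and> h \<in> hyperplanes n T \<and>
     to_nat_on (V \<times> hyperplanes n T) (x, h) = k \<and> x \<in> u h}"

lemma countable_pairs: "countable (V \<times> hyperplanes n T)"
  using countable_vertices countable_edges by (simp add: hyperplanes_hyp)

lemma separator_eq:
  assumes "x \<in> V" "h \<in> hyperplanes n T"
  shows "separator (to_nat_on (V \<times> hyperplanes n T) (x, h)) = {u \<in> roller_boundary n T. x \<in> u h}"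
proof -
  have "x' = x \<and> h' = h" if "x' \<in> V" "h' \<in> hyperplanes n T"
    "to_nat_on (V \<times> hyperplanes n T) (x', h') = to_nat_on (V \<times> hyperplanes n T) (x, h)" for x' h'
    using inj_on_to_nat_on[OF countable_pairs] that assms by (auto dest: inj_onD)
  then show ?thesis using assms unfolding separator_def by blast
qed

lemma separator_sets: "separator k \<in> sets M"
proof (cases "k \<in> to_nat_on (V \<times> hyperplanes n T) ` (V \<times> hyperplanes n T)")
  case True
  then obtain x h where xh: "x \<in> V" "h \<in> hyperplanes n T" "k = to_nat_on (V \<times> hyperplanes n T) (x, h)"
    by auto
  show ?thesis
    using pred_coordinate[OF xh(2), of "\<lambda>S. x \<in> S"] separator_eq[OF xh(1,2)] xh(3)
    by (simp add: pred_def space_M)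
next
  case False
  then have "separator k = {}" unfolding separator_def by blast
  then show ?thesis by simp
qed

text \<open>At a hyperplane where they differ, the two ultrafilters choose disjoint halfspaces, and
  any vertex of the first one tells them apart.\<close>

lemma separator_separates:
  assumes "u \<in> roller_boundary n T" "w \<in> roller_boundary n T" "u \<noteq> w"
  shows "\<exists>k. (u \<in> separator k) \<noteq> (w \<in> separator k)"
proof -
  have uw: "u \<in> ultrafilters n T" "w \<in> ultrafilters n T" using assms boundary_subset by auto
  then have "u \<in> extensional (hyperplanes n T)" "w \<in> extensional (hyperplanes n T)"
    by (auto simp: ultrafilters_def PiE_iff)
  then obtain h where h: "h \<in> hyperplanes n T" "u h \<noteq> w h"
    using assms(3) by (meson extensionalityI)
  obtain i a b where i: "i < n" "{a, b} \<in> uedges (T i)" "h = par i a b"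
    using h(1) by (auto simp: hyperplanes_eq)
  have i': "{b, a} \<in> uedges (T i)" using i by (simp add: insert_commute)
  have "u h \<inter> w h = {}" "u h \<noteq> {}"
    using ultrafilter_par[OF uw(1) i(1,2)] ultrafilter_par[OF uw(2) i(1,2)] h(2) i(3)
      HS_disjoint[OF i(1,2)] HS_nonempty[OF i(1,2)] HS_nonempty[OF i(1) i'] by auto
  then obtain x where x: "x \<in> u h" "x \<notin> w h" by blast
  then have "x \<in> V" using ultrafilter_subset[OF uw(1) h(1)] by blast
  then show ?thesis
    using separator_eq[OF _ h(1)] x assms by (intro exI[of _ "to_nat_on (V \<times> hyperplanes n T) (x, h)"]) simp
qed

section \<open>Connectedness and distances in the product\<close>

lemma adjacent_connected:
  assumes "x \<in> V" "y \<in> V"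
  shows "\<exists>k. y \<in> rel_ball adjacent k x"
proof -
  obtain c where c: "c \<in> coords" "x = vt c" using assms(1) by (rule vertex_cases)
  obtain d where d: "d \<in> coords" "y = vt d" using assms(2) by (rule vertex_cases)
  have "(c, d) \<in> {(c, c(j := b)) | c j b. c \<in> coords \<and> j \<in> {..<n} \<and> {c j, b} \<in> uedges (T j)}\<^sup>*"
    using coords_ext[OF c(1)] coords_ext[OF d(1)]
    by (intro coords_connected c d) (auto simp: extensional_def)
  then have "(vt c, vt d) \<in> adjacent\<^sup>*"
  proof (induction rule: rtrancl_induct)
    case (step p q)
    then obtain j b where q: "q = p(j := b)" "p \<in> coords" "j < n" "{p j, b} \<in> uedges (T j)" by auto
    then have "{vt p, vt q} \<in> edges n T" unfolding edge_iff by blast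
    then have "(vt p, vt q) \<in> adjacent" by (simp add: adjacent_def)
    with step.IH show ?case by (rule rtrancl_into_rtrancl)
  qed simp
  from rel_ball_rtrancl[OF this] show ?thesis by (simp add: c(2) d(2))
qed

lemma product_dist_refl:
  assumes "x \<in> V"
  shows "product_dist n T x x = 0"
proof -
  obtain c where c: "c \<in> coords" "x = vt c" using assms by (rule vertex_cases)
  have "tree_dist (T i) (x i) (x i) = 0" if "i < n" for i
    using tree.tree_dist_refl[OF trees[OF that] coords_mem[OF c(1) that]] c(2) that by (simp add: vt_def)
  then show ?thesis by (simp add: product_dist_def)
qed

text \<open>The distance is a sum over the factors, so it suffices to change the coordinate in one
  infinite factor.\<close>

lemma ex_far_vertex:
  assumes "roller_boundary n T \<noteq> {}" "x \<in> V"
  shows "\<exists>y\<in>V. real R \<le> product_dist n T x y"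
proof -
  obtain i where i: "i < n" "infinite (uverts (T i))" using assms boundary_infinite_factor by blast
  obtain c where c: "c \<in> coords" "x = vt c" using assms(2) by (rule vertex_cases)
  obtain b where b: "b \<in> uverts (T i)" "real R \<le> tree_dist (T i) (vertex_point (c i)) (vertex_point b)"
    using ulf_tree.ex_far_vertex[OF ulf_trees[OF i(1)] i(2) coords_mem[OF c(1) i(1)]] by blast
  define y where "y = vt (c(i := b))"
  have "c(i := b) \<in> coords" using coords_upd c i b by blast
  then have y: "y \<in> V" by (simp add: vertices_eq y_def)
  have "tree_dist (T j) (x j) (y j) = (if j = i then tree_dist (T i) (vertex_point (c i)) (vertex_point b) else 0)"
    if j: "j < n" for j
    using tree.tree_dist_refl[OF trees[OF j] coords_mem[OF c(1) j]] j by (simp add: c(2) y_def vt_def)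
  then have "product_dist n T x y = (\<Sum>j<n. if j = i then tree_dist (T i) (vertex_point (c i)) (vertex_point b) else 0)"
    unfolding product_dist_def by (intro sum.cong) auto
  also have "\<dots> = tree_dist (T i) (vertex_point (c i)) (vertex_point b)" using i(1) by simp
  finally show ?thesis using b(2) y by (intro bexI[of _ y]) auto
qed

lemma dir_edge_unique:
  assumes "i < n" "j < n" "dir_edge i x y" "dir_edge j x y"
  shows "i = j"
proof (rule ccontr)
  assume "i \<noteq> j"
  obtain c b where c: "c \<in> coords" "{c i, b} \<in> uedges (T i)" "x = vt c" "y = vt (c(i := b))"
    using assms(3) unfolding dir_edge_def by blast
  obtain d e where d: "d \<in> coords" "{d j, e} \<in> uedges (T j)" "x = vt d" "y = vt (d(j := e))"
    using assms(4) unfolding dir_edge_def by blast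
  have "d = c" using c(1,3) d(1,3) vt_inject by blast
  moreover have "c(i := b) = d(j := e)"
    using c d vt_inject coords_upd_edge assms(1,2) by metis
  ultimately have "(c(i := b)) i = (c(j := e)) i" by simp
  then have "b = c i" using \<open>i \<noteq> j\<close> by simp
  then show False using c(2) edge_neq[OF assms(1)] by blast
qed

end

context cube_iso
begin

text \<open>The coordinate at \<open>h\<close> of the image depends on a single coordinate of
  \<open>u\<close>, the one at the preimage of \<open>h\<close>.\<close>

lemma continuous_roller_map: "continuous_map X X (roller_map n T \<alpha>)"
proof -
  have "continuous_map X (discrete_topology (halfspaces n T h)) (\<lambda>u. roller_map n T \<alpha> u h)"
    if h: "h \<in> hyperplanes n T" for h
  proof -
    have "continuous_map (discrete_topology (halfspaces n T ((`) \<beta> ` h))) (discrete_topology (halfspaces n T h)) ((`) \<alpha>)"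
      using halfspace_image[OF hyperplane_image'[OF h]] hyperplane_image_inverse(2)[OF h] by auto
    from continuous_map_compose[OF continuous_coordinate[OF hyperplane_image'[OF h]] this]
    show ?thesis by (simp add: o_def roller_map_eq[OF h])
  qed
  then have "continuous_map X (product_topology (\<lambda>h. discrete_topology (halfspaces n T h)) (hyperplanes n T)) (roller_map n T \<alpha>)"
    unfolding continuous_map_componentwise by (auto simp: roller_map_def)
  then show ?thesis
    using roller_map_ultrafilter topspace_roller
    by (subst (2) roller_topology_def) (auto simp: continuous_map_in_subtopology)
qed

lemma measurable_roller_map: "roller_map n T \<alpha> \<in> measurable M M"
  unfolding roller_boundary_borel_def
proof (rule measurable_restrict_space3)
  show "roller_map n T \<alpha> \<in> roller_boundary n T \<rightarrow> roller_boundary n T"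
    using roller_map_boundary by auto
  have "roller_map n T \<alpha> \<in> measurable (borel_of_topology X) (sigma (topspace X) {U. openin X U})"
  proof (rule measurable_measure_of[OF opens_subset])
    show "roller_map n T \<alpha> \<in> space (borel_of_topology X) \<rightarrow> topspace X"
      using roller_map_ultrafilter by (auto simp: space_borel topspace_roller)
    fix U assume "U \<in> {U. openin X U}"
    then have "openin X {u \<in> topspace X. roller_map n T \<alpha> u \<in> U}"
      using openin_continuous_map_preimage[OF continuous_roller_map] by blast
    then have "{u \<in> topspace X. roller_map n T \<alpha> u \<in> U} \<in> sets (borel_of_topology X)"
      by (rule open_borel)
    also have "{u \<in> topspace X. roller_map n T \<alpha> u \<in> U} = roller_map n T \<alpha> -` U \<inter> space (borel_of_topology X)"
      by (auto simp: space_borel topspace_roller)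
    finally show "roller_map n T \<alpha> -` U \<inter> space (borel_of_topology X) \<in> sets (borel_of_topology X)" .
  qed
  then show "roller_map n T \<alpha> \<in> measurable (borel_of_topology X) (borel_of_topology X)"
    by (simp add: borel_of_topology_def)
qed

text \<open>
  All edges of one direction have images of one direction, so these finitely many pairs determine
  the automorphism up to direction preserving ones.
\<close>

definition directions :: "(nat \<times> nat) set" where
  "directions = {(i, j). i < n \<and> j < n \<and> (\<exists>x y. dir_edge i x y \<and> dir_edge j (\<alpha> x) (\<alpha> y))}"

lemma ex_direction:
  assumes "i < n" "dir_edge i x y"
  shows "\<exists>j<n. dir_edge j (\<alpha> x) (\<alpha> y)"
  using edge_image[of "{x, y}"] dir_edge_iff assms by auto

lemma directions_image:
  assumes "(i, j) \<in> directions" "dir_edge i x y"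
  shows "dir_edge j (\<alpha> x) (\<alpha> y)"
  using assms dir_edge_image unfolding directions_def by blast

end

section \<open>Acylindrical actions\<close>

locale acylindrical_action = trees n T + group G + group_action G "tree_product n T" \<phi>
  for n :: nat and T :: "nat \<Rightarrow> 'a ugraph" and G :: "('g, 'm) monoid_scheme" (structure)
    and \<phi> :: "'g \<Rightarrow> 'a prod_point \<Rightarrow> 'a prod_point" +
  assumes countable_G: "countable (carrier G)"
    and automorphism: "g \<in> carrier G \<Longrightarrow> cube_automorphism n T (\<phi> g)"
    and acyl: "acylindrical G (tree_product n T) (product_dist n T) \<phi>"
begin

abbreviation zact :: "'g \<Rightarrow> 'a halfspace_choice \<Rightarrow> 'a halfspace_choice" where
  "zact g \<equiv> roller_map n T (\<phi> g)"

lemma cube_iso: "g \<in> carrier G \<Longrightarrow> cube_iso n T (\<phi> g) (\<phi> (inv g))"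
proof unfold_locales
  fix x assume g: "g \<in> carrier G" and x: "x \<in> tree_product n T"
  show "\<phi> (inv g) (\<phi> g x) = x" using orbit_sym_aux[OF g x] by simp
  show "\<phi> g (\<phi> (inv g) x) = x" using orbit_sym_aux[OF inv_closed[OF g] x] g by simp
qed (simp_all add: automorphism)

lemma phi_one: "x \<in> tree_product n T \<Longrightarrow> \<phi> \<one> x = x"
  using id_eq_one by (metis restrict_apply')

lemma phi_V: "g \<in> carrier G \<Longrightarrow> x \<in> V \<Longrightarrow> \<phi> g x \<in> V"
  by (rule cube_iso.vertex_image[OF cube_iso])

lemma phi_mult: "g \<in> carrier G \<Longrightarrow> h \<in> carrier G \<Longrightarrow> x \<in> V \<Longrightarrow> \<phi> (g \<otimes> h) x = \<phi> g (\<phi> h x)"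
  using composition_rule vertices_subset by blast

lemma zact_closed:
  "g \<in> carrier G \<Longrightarrow> u \<in> roller_boundary n T \<Longrightarrow> zact g u \<in> roller_boundary n T"
  by (rule cube_iso.roller_map_boundary[OF cube_iso])

lemma zact_eqI:
  assumes "g \<in> carrier G" "u \<in> ultrafilters n T" "w \<in> ultrafilters n T"
    and "\<And>h. h \<in> hyperplanes n T \<Longrightarrow> w ((`) (\<phi> g) ` h) = \<phi> g ` u h"
  shows "zact g u = w"
proof (rule extensionalityI)
  interpret iso: cube_iso n T "\<phi> g" "\<phi> (inv g)" by (rule cube_iso[OF assms(1)])
  show "zact g u \<in> extensional (hyperplanes n T)" by (simp add: roller_map_def)
  show "w \<in> extensional (hyperplanes n T)" using assms(3) by (auto simp: ultrafilters_def PiE_iff)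
  fix h assume h: "h \<in> hyperplanes n T"
  show "zact g u h = w h"
    using iso.roller_map_eq[OF h] assms(4)[OF iso.hyperplane_image'[OF h]]
      iso.hyperplane_image_inverse(2)[OF h] by simp
qed

lemma zact_one:
  assumes "u \<in> roller_boundary n T"
  shows "zact \<one> u = u"
proof -
  have u: "u \<in> ultrafilters n T" using assms boundary_subset by auto
  have id: "\<phi> \<one> ` S = S" if "S \<subseteq> V" for S
    using that vertices_subset phi_one by (force simp: subset_iff)
  have "u ((`) (\<phi> \<one>) ` h) = \<phi> \<one> ` u h" if h: "h \<in> hyperplanes n T" for h
  proof -
    have "(`) (\<phi> \<one>) ` h = (\<lambda>e. e) ` h"
      using id cube_iso.hyperplane_subset[OF cube_iso[OF one_closed] h] by (intro image_cong) auto
    then show ?thesis using id[OF ultrafilter_subset[OF u h]] by simp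
  qed
  then show ?thesis by (intro zact_eqI u one_closed)
qed

lemma zact_mult:
  assumes g: "g \<in> carrier G" and h: "h \<in> carrier G" and "u \<in> roller_boundary n T"
  shows "zact (g \<otimes> h) u = zact g (zact h u)"
proof -
  have u: "u \<in> ultrafilters n T" using assms boundary_subset by auto
  interpret g: cube_iso n T "\<phi> g" "\<phi> (inv g)" by (rule cube_iso[OF g])
  interpret h: cube_iso n T "\<phi> h" "\<phi> (inv h)" by (rule cube_iso[OF h])
  have im: "\<phi> (g \<otimes> h) ` S = \<phi> g ` \<phi> h ` S" if "S \<subseteq> V" for S
  proof -
    have "\<phi> (g \<otimes> h) ` S = (\<lambda>x. \<phi> g (\<phi> h x)) ` S"
      using that phi_mult[OF g h] by (intro image_cong) auto
    then show ?thesis by (simp add: image_image)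
  qed
  have "zact g (zact h u) ((`) (\<phi> (g \<otimes> h)) ` k) = \<phi> (g \<otimes> h) ` u k"
    if k: "k \<in> hyperplanes n T" for k
  proof -
    have "(`) (\<phi> (g \<otimes> h)) ` k = (\<lambda>e. \<phi> g ` \<phi> h ` e) ` k"
      by (rule image_cong[OF refl]) (rule im[OF h.hyperplane_subset[OF k]])
    then have "(`) (\<phi> (g \<otimes> h)) ` k = (`) (\<phi> g) ` (`) (\<phi> h) ` k" by (simp add: image_image)
    then show ?thesis
      using g.roller_map_image[OF h.hyperplane_image[OF k]] h.roller_map_image[OF k]
        im[OF ultrafilter_subset[OF u k]] by simp
  qed
  then show ?thesis
    using g h u by (intro zact_eqI g.roller_map_ultrafilter h.roller_map_ultrafilter) auto
qed

text \<open>Acylindricity bounds only the elements that nearly fix two distant points. So take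
  \<open>y\<close> far from \<open>x\<close>: finitely many elements fix both, and an element moving
  \<open>x\<close> to \<open>z\<close> moves \<open>y\<close> into a finite ball about
  \<open>z\<close>. For each possible image \<open>w\<close> of \<open>y\<close>, these elements
  form at most one coset of the stabilizer of the pair.\<close>

lemma finite_transporter:
  assumes ne: "roller_boundary n T \<noteq> {}" and x: "x \<in> V" and z: "z \<in> V"
  shows "finite {g \<in> carrier G. \<phi> g x = z}"
proof -
  obtain R where R: "\<And>x y. x \<in> tree_product n T \<Longrightarrow> y \<in> tree_product n T \<Longrightarrow> product_dist n T x y \<ge> R \<Longrightarrow>
      finite {g \<in> carrier G. product_dist n T x (\<phi> g x) \<le> 1 \<and> product_dist n T y (\<phi> g y) \<le> 1}"
  proof -
    from acyl[unfolded acylindrical_def, THEN spec, THEN mp, OF zero_less_one]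
    obtain R where "\<forall>x\<in>tree_product n T. \<forall>y\<in>tree_product n T. product_dist n T x y \<ge> R \<longrightarrow>
      finite {g \<in> carrier G. product_dist n T x (\<phi> g x) \<le> 1 \<and> product_dist n T y (\<phi> g y) \<le> 1}"
      by blast
    then show ?thesis using that[of R] by simp
  qed
  obtain y where y: "y \<in> V" "real (nat \<lceil>R\<rceil>) \<le> product_dist n T x y"
    using ex_far_vertex[OF ne x] by blast
  then have "R \<le> product_dist n T x y" by linarith
  then have "finite {g \<in> carrier G. product_dist n T x (\<phi> g x) \<le> 1 \<and> product_dist n T y (\<phi> g y) \<le> 1}"
    using R x y(1) vertices_subset by blast
  \<comment> \<open>Elements fixing \<open>x\<close> and \<open>y\<close> displace both by 0, so the
    bound for displacement at most 1 covers them.\<close>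
  then have stab: "finite {g \<in> carrier G. \<phi> g x = x \<and> \<phi> g y = y}"
    by (rule finite_subset[rotated]) (use product_dist_refl x y(1) in auto)
  obtain k where k: "y \<in> rel_ball adjacent k x" using adjacent_connected[OF x y(1)] by blast
  let ?F = "\<lambda>w. {g \<in> carrier G. \<phi> g x = z \<and> \<phi> g y = w}"
  have "finite (?F w)" for w
  proof (cases "?F w = {}")
    case False
    then obtain g0 where g0: "g0 \<in> carrier G" "\<phi> g0 x = z" "\<phi> g0 y = w" by blast
    have inv0: "\<phi> (inv g0) z = x" "\<phi> (inv g0) w = y"
      using cube_iso.inverse_V(1)[OF cube_iso[OF g0(1)]] x y(1) g0(2,3) by auto
    have "inj_on (\<lambda>g. inv g0 \<otimes> g) (?F w)"
      using g0(1) by (auto simp: inj_on_def)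
    moreover have "(\<lambda>g. inv g0 \<otimes> g) ` ?F w \<subseteq> {g \<in> carrier G. \<phi> g x = x \<and> \<phi> g y = y}"
      using g0(1) inv0 phi_mult[OF inv_closed[OF g0(1)]] x y(1) by auto
    ultimately show ?thesis using stab by (meson finite_imageD finite_subset)
  next
    case True
    show ?thesis unfolding True by (rule finite.emptyI)
  qed
  moreover have "{g \<in> carrier G. \<phi> g x = z} \<subseteq> (\<Union>w\<in>rel_ball adjacent k z. ?F w)"
  proof
    fix g assume g: "g \<in> {g \<in> carrier G. \<phi> g x = z}"
    then have "g \<in> carrier G" by simp
    then have "\<phi> g y \<in> rel_ball adjacent k (\<phi> g x)"
      using rel_ball_image[of adjacent "\<phi> g", OF cube_iso.adjacent_image[OF cube_iso]] k by simp
    then show "g \<in> (\<Union>w\<in>rel_ball adjacent k z. ?F w)" using g by auto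
  qed
  moreover have "finite (rel_ball adjacent k z)"
    using finite_card_rel_ball[of adjacent valency k z] finite_card_adjacent by blast
  ultimately show ?thesis by (meson finite_UN_I finite_subset)
qed

text \<open>For these elements the flow numbered \<open>i\<close> at \<open>u\<close> is carried to
  the flow with the same number at the image of \<open>u\<close>, as \<open>flow_system\<close>
  demands.\<close>

definition pure :: "'g set" where
  "pure = {g \<in> carrier G. \<forall>i<n. \<forall>x y. dir_edge i x y \<longrightarrow> dir_edge i (\<phi> g x) (\<phi> g y)}"

abbreviation P where "P \<equiv> G\<lparr>carrier := pure\<rparr>"

abbreviation directions where "directions g \<equiv> cube_iso.directions n T (\<phi> g)"

lemma pure_dir_edge: "g \<in> pure \<Longrightarrow> i < n \<Longrightarrow> dir_edge i x y \<Longrightarrow> dir_edge i (\<phi> g x) (\<phi> g y)"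
  by (auto simp: pure_def)

text \<open>If \<open>inv h\<close> takes an edge of direction \<open>i\<close> to direction
  \<open>k\<close>, then \<open>h\<close> sends direction \<open>k\<close> to \<open>i\<close>, and
  so does \<open>g\<close>. There are only finitely many sets of pairs of directions, which bounds
  the index of \<open>pure\<close>.\<close>

lemma mult_inv_pure:
  assumes g: "g \<in> carrier G" and h: "h \<in> carrier G" and eq: "directions g = directions h"
  shows "g \<otimes> inv h \<in> pure"
  unfolding pure_def
proof (intro CollectI conjI allI impI)
  show "g \<otimes> inv h \<in> carrier G" using g h by simp
  fix i x y assume i: "i < n" and d: "dir_edge i x y"
  interpret g: cube_iso n T "\<phi> g" "\<phi> (inv g)" by (rule cube_iso[OF g])
  interpret h: cube_iso n T "\<phi> h" "\<phi> (inv h)" by (rule cube_iso[OF h])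
  have xy: "x \<in> V" "y \<in> V" using dir_edge_verts[OF i d] by auto
  obtain k where k: "k < n" "dir_edge k (\<phi> (inv h) x) (\<phi> (inv h) y)"
    using cube_iso.ex_direction[OF h.swap i d] by blast
  moreover have "dir_edge i (\<phi> h (\<phi> (inv h) x)) (\<phi> h (\<phi> (inv h) y))"
    using d h.inverse_V(2) xy by simp
  ultimately have "(k, i) \<in> h.directions"
    using i unfolding h.directions_def by blast
  then have "dir_edge i (\<phi> g (\<phi> (inv h) x)) (\<phi> g (\<phi> (inv h) y))"
    using eq k(2) g.directions_image by simp
  then show "dir_edge i (\<phi> (g \<otimes> inv h) x) (\<phi> (g \<otimes> inv h) y)"
    using phi_mult[OF g inv_closed[OF h]] xy by simp
qed

lemma pure_subgroup: "subgroup pure G"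
proof
  show "pure \<subseteq> carrier G" by (auto simp: pure_def)
  show "\<one> \<in> pure"
    using phi_one dir_edge_verts vertices_subset unfolding pure_def by (auto simp: subset_iff)
  show "g \<otimes> h \<in> pure" if "g \<in> pure" "h \<in> pure" for g h
  proof -
    have "dir_edge i (\<phi> (g \<otimes> h) x) (\<phi> (g \<otimes> h) y)" if "i < n" "dir_edge i x y" for i x y
      using pure_dir_edge[OF \<open>g \<in> pure\<close> that(1) pure_dir_edge[OF \<open>h \<in> pure\<close> that]]
        phi_mult[of g h] dir_edge_verts[OF that] \<open>g \<in> pure\<close> \<open>h \<in> pure\<close> by (simp add: pure_def)
    then show ?thesis using that by (auto simp: pure_def)
  qed
  show "inv g \<in> pure" if "g \<in> pure" for g
  proof -
    have g: "g \<in> carrier G" using that by (simp add: pure_def)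
    interpret g: cube_iso n T "\<phi> g" "\<phi> (inv g)" by (rule cube_iso[OF g])
    have "dir_edge i (\<phi> (inv g) x) (\<phi> (inv g) y)" if d: "i < n" "dir_edge i x y" for i x y
    proof -
      \<comment> \<open>The preimage has some direction \<open>k\<close>; applying \<open>g\<close>
        keeps \<open>k\<close> and returns the given edge, so \<open>k\<close> is its
        direction.\<close>
      obtain k where k: "k < n" "dir_edge k (\<phi> (inv g) x) (\<phi> (inv g) y)"
        using cube_iso.ex_direction[OF g.swap d] by blast
      then have "dir_edge k x y"
        using pure_dir_edge[OF \<open>g \<in> pure\<close> k] g.inverse_V(2) dir_edge_verts[OF d] by simp
      then have "k = i" using dir_edge_unique[OF k(1) d(1)] d(2) by blast
      then show ?thesis using k by simp
    qed
    then show ?thesis using g by (auto simp: pure_def)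
  qed
qed

lemma flow_system_pure:
  "flow_system P M separator V adjacent (\<lambda>g. zact g) \<phi> n valency flow"
proof -
  have sub: "g \<in> carrier G" if "g \<in> pure" for g using that by (simp add: pure_def)
  have bd: "u \<in> roller_boundary n T" "u \<in> ultrafilters n T" if "u \<in> space M" for u
    using that space_M boundary_subset by auto
  have flow: "flow i (zact g u) (\<phi> g x) = \<phi> g (flow i u x)"
    if g: "g \<in> pure" and "i < n" "u \<in> space M" "x \<in> V" for g i u x
  proof (rule cube_iso.flow_image[OF cube_iso[OF sub[OF g]]])
    show "dir_edge j (\<phi> g y) (\<phi> g z)" if "j < n" "dir_edge j y z" for j y z
      using pure_dir_edge[OF g that] .
    show "dir_edge j (\<phi> (inv g) y) (\<phi> (inv g) z)" if "j < n" "dir_edge j y z" for j y z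
      using pure_dir_edge[OF subgroup.m_inv_closed[OF pure_subgroup g] that] .
  qed (use that bd in auto)
  interpret P: group P by (rule subgroup.subgroup_is_group[OF pure_subgroup is_group])
  show ?thesis
  proof (unfold_locales, goal_cases)
    case 1 show ?case using countable_G countable_subset[of pure "carrier G"] sub by auto
  next
    case 2 show ?case by (rule countable_vertices)
  next
    case (3 g) then show ?case using cube_iso.measurable_roller_map[OF cube_iso[OF sub]] by simp
  next
    case (4 u) then show ?case using zact_one bd by simp
  next
    case (5 g h u) then show ?case using zact_mult bd sub by simp
  next
    case (6 g x) then show ?case using phi_V sub by simp
  next
    case (7 x) then show ?case using phi_one vertices_subset by auto
  next
    case (8 g h x) then show ?case using phi_mult sub by simp
  next
    case (9 k) show ?case by (rule separator_sets)
  next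
    case (10 u w) then show ?case using separator_separates bd by simp
  next
    case 11 show ?case by (rule adjacent_subset)
  next
    case 12 show ?case by (rule adjacent_sym)
  next
    case (13 x) show ?case using finite_card_adjacent by blast
  next
    case (14 x) show ?case using finite_card_adjacent by blast
  next
    case (15 g x y) then show ?case using cube_iso.adjacent_image[OF cube_iso[OF sub]] by simp
  next
    case (16 x y)
    then have "finite {g \<in> carrier G. \<phi> g x = y}" using finite_transporter space_M by simp
    then show ?case by (rule finite_subset[rotated]) (use sub in auto)
  next
    case (17 i x) then show ?case by (rule measurable_flow)
  next
    case (18 i u x) then show ?case using flow_step bd by simp
  next
    case (19 i j u x) then show ?case using flow_commute bd by simp
  next
    case (20 g i u x) then show ?case using flow by simp
  next
    case (21 u x y) then show ?case using flow_merge bd by simp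
  qed
qed

text \<open>The finite relations come from \<open>pure\<close>, the orbits from \<open>G\<close>.
  Two gaps remain, the finitely many classes of the union in an orbit of \<open>pure\<close> and the
  finite index of \<open>pure\<close>; one use of \<open>hyperfinite_finite_index\<close> closes
  both.\<close>

lemma hyperfinite_boundary_action:
  "hyperfinite M (orbit_relation G (roller_boundary n T) (\<lambda>g. zact g))"
proof -
  interpret P: flow_system P M separator V adjacent "\<lambda>g. zact g" \<phi> n valency flow
    by (rule flow_system_pure)
  define E where "E = orbit_relation G (roller_boundary n T) (\<lambda>g. zact g)"
  obtain v where v: "v \<in> V" using coords_nonempty vertices_eq by auto
  define F where "F = P.approx v"
  have sub: "g \<in> carrier G" if "g \<in> pure" for g using that by (simp add: pure_def)
  have bd: "space M = roller_boundary n T" by (rule space_M)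
  have measurable_zact: "zact g \<in> measurable M M" if "g \<in> carrier G" for g
    by (rule cube_iso.measurable_roller_map[OF cube_iso[OF that]])
  \<comment> \<open>The enumeration is shifted by one so that index 0 is the identity, as
    \<open>act 0\<close> requires; repetitions do no harm.\<close>
  define \<gamma> where "\<gamma> j = (case j of 0 \<Rightarrow> \<one> | Suc m \<Rightarrow> from_nat_into (carrier G) m)" for j
  have \<gamma>: "\<gamma> j \<in> carrier G" for j
    using from_nat_into[of "carrier G"] by (auto simp: \<gamma>_def split: nat.splits)
  have \<gamma>_surj: "\<exists>j. \<gamma> j = g" if "g \<in> carrier G" for g
    using from_nat_into_surj[OF countable_G that] by (metis \<gamma>_def nat.case(2))
  have E_equiv: "equiv (space M) E"
  proof (rule equivI)
    show "E \<subseteq> space M \<times> space M" by (auto simp: E_def orbit_relation_def bd)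
    show "refl_on (space M) E"
      by (auto simp: refl_on_def E_def orbit_relation_def bd zact_one intro!: bexI[of _ \<one>])
    show "sym E"
    proof (rule symI)
      fix u w assume "(u, w) \<in> E"
      then obtain g where g: "u \<in> roller_boundary n T" "w \<in> roller_boundary n T" "g \<in> carrier G" "zact g u = w"
        by (auto simp: E_def orbit_relation_def)
      then have "zact (inv g) w = u" using zact_mult[of "inv g" g u] zact_one by simp
      then show "(w, u) \<in> E" using g by (auto simp: E_def orbit_relation_def)
    qed
    show "trans E"
    proof (rule transI)
      fix u w z assume "(u, w) \<in> E" "(w, z) \<in> E"
      then obtain g h where g: "u \<in> roller_boundary n T" "z \<in> roller_boundary n T"
          "g \<in> carrier G" "h \<in> carrier G" "zact g u = w" "zact h w = z"
        by (auto simp: E_def orbit_relation_def)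
      then have "zact (h \<otimes> g) u = z" using zact_mult by simp
      then show "(u, z) \<in> E" using g by (auto simp: E_def orbit_relation_def)
    qed
  qed
  have E_borel: "borel_equivalence M E"
  proof (rule borel_equivalenceI[OF E_equiv])
    have sep: "\<exists>k. (u \<in> separator k) \<noteq> (w \<in> separator k)" if "u \<in> space M" "w \<in> space M" "u \<noteq> w" for u w
      using that unfolding bd by (rule separator_separates)
    have "Measurable.pred (M \<Otimes>\<^sub>M M) (\<lambda>p. \<exists>g\<in>carrier G. zact g (fst p) = snd p)"
      by (rule pred_ex_countable[OF countable_G],
          rule pred_graph[where B = separator, OF measurable_zact separator_sets sep])
    also have "?this \<longleftrightarrow> Measurable.pred (M \<Otimes>\<^sub>M M) (\<lambda>p. p \<in> E)"
      by (intro pred_cong) (auto simp: E_def orbit_relation_def space_pair_measure bd)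
    finally show "Measurable.pred (M \<Otimes>\<^sub>M M) (\<lambda>p. p \<in> E)" .
  qed
  have "hyperfinite M E"
  proof (rule hyperfinite_finite_index[where F = F and act = "\<lambda>j. zact (\<gamma> j)"])
    show "borel_equivalence M (F k)" for k unfolding F_def by (rule P.approx_borel[OF v])
    show "finite (F k `` {u})" if "u \<in> space M" for k u unfolding F_def by (rule P.approx_finite[OF v that])
    show "F k \<subseteq> F (Suc k)" for k unfolding F_def by (rule P.approx_mono[OF v])
    show "F k \<subseteq> E" for k
      using P.approx_subset[of v k] sub unfolding F_def E_def by (auto simp: orbit_relation_def bd)
    show "zact (\<gamma> j) \<in> measurable M M" for j by (rule measurable_zact[OF \<gamma>])
    show "zact (\<gamma> 0) u = u" if "u \<in> space M" for u using that zact_one by (simp add: \<gamma>_def bd)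
    show "(u, zact (\<gamma> j) u) \<in> E" if "u \<in> space M" for u j
      using that zact_closed[OF \<gamma>] \<gamma> by (auto simp: E_def orbit_relation_def bd)
    show "\<exists>j. zact (\<gamma> j) u = w" if "(u, w) \<in> E" for u w
      using that \<gamma>_surj unfolding E_def orbit_relation_def by auto
    show "finite {j. \<forall>i<j. (zact (\<gamma> i) u, zact (\<gamma> j) u) \<notin> (\<Union>k. F k)}" if u: "u \<in> space M" for u
    proof (rule ccontr)
      let ?D = "{j. \<forall>i<j. (zact (\<gamma> i) u, zact (\<gamma> j) u) \<notin> (\<Union>k. F k)}"
      assume inf: "infinite ?D"
      have "(\<lambda>j. directions (\<gamma> j)) ` ?D \<subseteq> Pow ({..<n} \<times> {..<n})"
        using cube_iso.directions_def[OF cube_iso[OF \<gamma>]] by auto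
      then have "finite ((\<lambda>j. directions (\<gamma> j)) ` ?D)" by (rule finite_subset) simp
      \<comment> \<open>Infinitely many of the indices belong to one coset of \<open>pure\<close>,
        and \<open>3 ^ n + 1\<close> of them already exceed the bound of
        \<open>approx_finite_index\<close>.\<close>
      then obtain j0 where j0: "infinite {j \<in> ?D. directions (\<gamma> j) = directions (\<gamma> j0)}"
        using pigeonhole_infinite[OF inf] by blast
      then obtain D where D: "finite D" "card D = Suc (3 ^ n)"
          "D \<subseteq> {j \<in> ?D. directions (\<gamma> j) = directions (\<gamma> j0)}"
        using infinite_arbitrarily_large by meson
      have ub: "u \<in> roller_boundary n T" using u bd by simp
      \<comment> \<open>With \<open>w\<close> as base point, the points
        \<open>zact (\<gamma> j) u\<close> become images of one point under elements of
        \<open>pure\<close>.\<close>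
      define w where "w = zact (\<gamma> j0) u"
      have w: "w \<in> space M" using zact_closed[OF \<gamma> ub] bd by (simp add: w_def)
      define \<kappa> where "\<kappa> j = \<gamma> j \<otimes> inv (\<gamma> j0)" for j
      have \<kappa>: "\<kappa> j \<in> pure" if "j \<in> D" for j
        unfolding \<kappa>_def using D(3) that by (intro mult_inv_pure \<gamma>) auto
      have \<kappa>w: "zact (\<kappa> j) w = zact (\<gamma> j) u" for j
      proof -
        have "zact (\<kappa> j) w = zact (\<kappa> j \<otimes> \<gamma> j0) u"
          unfolding w_def \<kappa>_def using zact_mult[OF _ \<gamma> ub] \<gamma> by simp
        also have "\<kappa> j \<otimes> \<gamma> j0 = \<gamma> j" unfolding \<kappa>_def using \<gamma> by (simp add: m_assoc)
        finally show ?thesis .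
      qed
      have sym: "(b, a) \<in> (\<Union>k. F k)" if "(a, b) \<in> (\<Union>k. F k)" for a b
        using that P.approx_equiv[OF v] unfolding F_def by (auto simp: equiv_def dest: symD)
      have refl: "(a, a) \<in> (\<Union>k. F k)" if "a \<in> space M" for a
        using that P.approx_equiv[OF v] unfolding F_def by (auto simp: equiv_def refl_on_def)
      have distinct: "(zact (\<gamma> i) u, zact (\<gamma> j) u) \<notin> (\<Union>k. F k)" if "i \<in> D" "j \<in> D" "i \<noteq> j" for i j
      proof (cases "i < j")
        case True
        then show ?thesis using D(3) that(2) by blast
      next
        case False
        then have "j < i" using that(3) by simp
        then have "(zact (\<gamma> j) u, zact (\<gamma> i) u) \<notin> (\<Union>k. F k)" using D(3) that(1) by blast
        then show ?thesis using sym by meson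
      qed
      have inj: "inj_on \<kappa> D"
      proof (rule inj_onI, rule ccontr)
        fix i j assume ij: "i \<in> D" "j \<in> D" "\<kappa> i = \<kappa> j" "i \<noteq> j"
        then have "zact (\<gamma> i) u = zact (\<gamma> j) u" using \<kappa>w by metis
        then show False using distinct[OF ij(1,2,4)] refl zact_closed[OF \<gamma> ub] bd by metis
      qed
      have "\<exists>g\<in>\<kappa> ` D. \<exists>h\<in>\<kappa> ` D. g \<noteq> h \<and> (zact g w, zact h w) \<in> (\<Union>k. P.approx v k)"
        using \<kappa> D(1,2) card_image[OF inj] by (intro P.approx_finite_index v w) auto
      then obtain i j where "i \<in> D" "j \<in> D" "\<kappa> i \<noteq> \<kappa> j" "(zact (\<kappa> i) w, zact (\<kappa> j) w) \<in> (\<Union>k. F k)"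
        unfolding F_def by blast
      then show False using distinct[of i j] \<kappa>w by metis
    qed
  qed (rule E_borel)
  then show ?thesis by (simp add: E_def)
qed

end

theorem corollary3p2:
  fixes G :: "('g, 'm) monoid_scheme"
    and n :: nat
    and T :: "nat \<Rightarrow> 'a ugraph"
    and \<phi> :: "'g \<Rightarrow> 'a prod_point \<Rightarrow> 'a prod_point"
  assumes "group G" and "countable (carrier G)"
    and "n \<ge> 1"
    and "\<forall>i<n. is_tree (T i) \<and> uniformly_locally_finite (T i)"
    and "group_action G (tree_product n T) \<phi>"
    and "\<forall>g\<in>carrier G. cube_automorphism n T (\<phi> g)"
    and "acylindrical G (tree_product n T) (product_dist n T) \<phi>"
  shows "hyperfinite (roller_boundary_borel n T)
           (orbit_relation G (roller_boundary n T) (\<lambda>g. roller_map n T (\<phi> g)))"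
proof -
  have "acylindrical_action n T G \<phi>"
    using assms
    by (auto intro!: acylindrical_action.intro acylindrical_action_axioms.intro trees.intro ulf_tree.intro
        tree.intro ulf_tree_axioms.intro)
  then show ?thesis by (rule acylindrical_action.hyperfinite_boundary_action)
qed

end
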